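(* The map $P\mapsto\mathsf{G}P$ is a closure operator in the lattice $\mathcal{P}_{\mathrm{up}}$ of all upper stable C*-properties, that is, $$P\subseteq\mathsf{G}P=\mathsf{G}(\mathsf{G}P)\ \text{ for } P\in\mathcal{P}_{\mathrm{up}},\quad\text{and}\quad \mathsf{G}P\subseteq\mathsf{G}P_1\ \text{ if } P\subseteq P_1 \text{ in } \mathcal{P}_{\mathrm{up}}.$$ In the latter case ($P\subseteq P_1$ in $\mathcal{P}_{\mathrm{up}}$), $\mathfrak{r}_P^{\triangleright}(A)\subseteq\mathfrak{r}_{P_1}^{\triangleright}(A)$ in $\mathrm{Id}_A$ for each C*-algebra $A$. If $P,P_1\in \mathcal{P}_{\mathrm{up}}$ and $P\subseteq P_1\subseteq\mathsf{G}P$, then $\mathsf{G}P=\mathsf{G}P_1$ and $\mathfrak{r}_P^{\triangleright}(A)=\mathfrak{r}_{P_1}^{\triangleright}(A)$ for all C*-algebras $A$.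
   Context: For a C*-algebra $A$, $\mathrm{Id}_A$ is the lattice of all closed two-sided ideals of $A$ (called ideals), ordered by inclusion. A C*-property is a class $P$ of C*-algebras with $\{0\}\in P$ that is closed under *-isomorphism. $P$ is upper stable if $A\in P$ implies $A/I\in P$ for all $I\in\mathrm{Id}_A$. $\mathcal{P}_{\mathrm{up}}$ is the complete lattice of all upper stable C*-properties ordered by inclusion. The relation $\ll_P$ in $\mathrm{Id}_A$ is: $I\ll_P J$ iff $I\subseteq J$ and $J/I\in P$. $\mathsf{G}P$ is the C*-property of all C*-algebras $A$ such that $A=\{0\}$ or each non-zero quotient $A/I$, $I\in\mathrm{Id}_A$, has a non-zero ideal belonging to $P$ (it is always upper stable). Write $I\ll_P^{\triangleright}J$ if there is a family of ideals $(I_\lambda)_{1\le\lambda\le\gamma}$ ($\gamma$ an ordinal) with $I_1=I$, $I_\gamma=J$, $I_\lambda\ll_P I_{\lambda+1}$ for $\lambda<\gamma$, and $I_\beta=\overline{\bigcup_{\lambda<\beta}I_\lambda}$ for limit ordinals $\beta$. For $P$ upper stable, $\mathfrak{r}_P^{\triangleright}(A)=\overline{\sum\{J\in\mathrm{Id}_A:\{0\}\ll_P^{\triangleright}J\}}$ (the $\ll_P^{\triangleright}$-radical). *)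

theory Defs
  imports
    "HOL-Analysis.Abstract_Metric_Spaces"
    "HOL-Algebra.Module"
    "HOL-Algebra.AbelCoset"
    "HOL-Algebra.Algebraic_Closure_Type"
begin

section \<open>C*-algebras\<close>

text \<open>
  C*-algebras are not assumed to be unital. They live on a carrier inside an arbitrary type, so that
  ideals and quotients of a C*-algebra are again objects of the same type. The field \<^const>\<open>one\<close>
  is inherited from the record of modules; it carries no meaning here and is never constrained.
\<close>

record 'a cstar = "(complex, 'a) module" +
  cs_star :: "'a \<Rightarrow> 'a"
  cs_norm :: "'a \<Rightarrow> real"

text \<open>The guard makes this a metric in the sense of \<^locale>\<open>Metric_space\<close>, whose non-negativity and
  symmetry axioms range over the whole type.\<close>

definition cs_dist :: "'a cstar \<Rightarrow> 'a \<Rightarrow> 'a \<Rightarrow> real" where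
  "cs_dist A x y =
    (if x \<in> carrier A \<and> y \<in> carrier A then cs_norm A (x \<ominus>\<^bsub>A\<^esub> y) else 0)"

abbreviation cs_topology :: "'a cstar \<Rightarrow> 'a topology" where
  "cs_topology A \<equiv> Metric_space.mtopology (carrier A) (cs_dist A)"

locale cstar_algebra = module "ring_of_type_algebra :: complex ring" A
  for A :: "'a cstar" (structure) +
  assumes mult_closed: "\<lbrakk>x \<in> carrier A; y \<in> carrier A\<rbrakk> \<Longrightarrow> x \<otimes> y \<in> carrier A"
    and mult_assoc: "\<lbrakk>x \<in> carrier A; y \<in> carrier A; z \<in> carrier A\<rbrakk>
      \<Longrightarrow> (x \<otimes> y) \<otimes> z = x \<otimes> (y \<otimes> z)"
    and mult_distrib_right: "\<lbrakk>x \<in> carrier A; y \<in> carrier A; z \<in> carrier A\<rbrakk>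
      \<Longrightarrow> (x \<oplus> y) \<otimes> z = (x \<otimes> z) \<oplus> (y \<otimes> z)"
    and mult_distrib_left: "\<lbrakk>x \<in> carrier A; y \<in> carrier A; z \<in> carrier A\<rbrakk>
      \<Longrightarrow> x \<otimes> (y \<oplus> z) = (x \<otimes> y) \<oplus> (x \<otimes> z)"
    and smult_mult_left: "\<lbrakk>x \<in> carrier A; y \<in> carrier A\<rbrakk>
      \<Longrightarrow> (c \<odot> x) \<otimes> y = c \<odot> (x \<otimes> y)"
    and smult_mult_right: "\<lbrakk>x \<in> carrier A; y \<in> carrier A\<rbrakk>
      \<Longrightarrow> x \<otimes> (c \<odot> y) = c \<odot> (x \<otimes> y)"
    and star_closed: "x \<in> carrier A \<Longrightarrow> cs_star A x \<in> carrier A"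
    and star_star: "x \<in> carrier A \<Longrightarrow> cs_star A (cs_star A x) = x"
    and star_add: "\<lbrakk>x \<in> carrier A; y \<in> carrier A\<rbrakk>
      \<Longrightarrow> cs_star A (x \<oplus> y) = cs_star A x \<oplus> cs_star A y"
    and star_smult: "x \<in> carrier A \<Longrightarrow> cs_star A (c \<odot> x) = cnj c \<odot> cs_star A x"
    and star_mult: "\<lbrakk>x \<in> carrier A; y \<in> carrier A\<rbrakk>
      \<Longrightarrow> cs_star A (x \<otimes> y) = cs_star A y \<otimes> cs_star A x"
    and norm_nonneg: "x \<in> carrier A \<Longrightarrow> 0 \<le> cs_norm A x"
    and norm_eq_zero: "x \<in> carrier A \<Longrightarrow> cs_norm A x = 0 \<longleftrightarrow> x = \<zero>"
    and norm_triangle: "\<lbrakk>x \<in> carrier A; y \<in> carrier A\<rbrakk>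
      \<Longrightarrow> cs_norm A (x \<oplus> y) \<le> cs_norm A x + cs_norm A y"
    and norm_smult: "x \<in> carrier A \<Longrightarrow> cs_norm A (c \<odot> x) = cmod c * cs_norm A x"
    and norm_mult: "\<lbrakk>x \<in> carrier A; y \<in> carrier A\<rbrakk>
      \<Longrightarrow> cs_norm A (x \<otimes> y) \<le> cs_norm A x * cs_norm A y"
    and cstar_identity: "x \<in> carrier A \<Longrightarrow> cs_norm A (cs_star A x \<otimes> x) = (cs_norm A x)\<^sup>2"
    and complete: "Metric_space.mcomplete (carrier A) (cs_dist A)"

definition star_isomorphic :: "'a cstar \<Rightarrow> 'a cstar \<Rightarrow> bool" where
  "star_isomorphic A B \<longleftrightarrow>
    (\<exists>f. bij_betw f (carrier A) (carrier B) \<and>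
      (\<forall>x\<in>carrier A. \<forall>y\<in>carrier A.
        f (x \<oplus>\<^bsub>A\<^esub> y) = f x \<oplus>\<^bsub>B\<^esub> f y \<and> f (x \<otimes>\<^bsub>A\<^esub> y) = f x \<otimes>\<^bsub>B\<^esub> f y) \<and>
      (\<forall>x\<in>carrier A. f (cs_star A x) = cs_star B (f x) \<and>
        (\<forall>c. f (c \<odot>\<^bsub>A\<^esub> x) = c \<odot>\<^bsub>B\<^esub> f x)))"

definition zero_algebra :: "'a cstar \<Rightarrow> bool" where
  "zero_algebra A \<longleftrightarrow> carrier A = {\<zero>\<^bsub>A\<^esub>}"


section \<open>Ideals and quotients\<close>

definition ideals :: "'a cstar \<Rightarrow> 'a set set" where
  "ideals A = {I. submodule I (ring_of_type_algebra :: complex ring) A \<and>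
              (\<forall>x\<in>I. \<forall>a\<in>carrier A. a \<otimes>\<^bsub>A\<^esub> x \<in> I \<and> x \<otimes>\<^bsub>A\<^esub> a \<in> I) \<and>
              closedin (cs_topology A) I}"

abbreviation ideal_alg :: "'a cstar \<Rightarrow> 'a set \<Rightarrow> 'a cstar" where
  "ideal_alg A I \<equiv> A\<lparr>carrier := I\<rparr>"

text \<open>
  The quotient \<open>A/I\<close> is realised on a transversal of the cosets of \<open>I\<close>, instead of on the cosets
  themselves, in order to stay in the same type: \<open>coset_rep A I x\<close> depends only on the coset of \<open>x\<close>,
  and it stands for that coset.
\<close>

definition coset_rep :: "'a cstar \<Rightarrow> 'a set \<Rightarrow> 'a \<Rightarrow> 'a" where
  "coset_rep A I x = (SOME y. y \<in> I +>\<^bsub>A\<^esub> x)"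

definition quot_alg :: "'a cstar \<Rightarrow> 'a set \<Rightarrow> 'a cstar" where
  "quot_alg A I =
    \<lparr>carrier = coset_rep A I ` carrier A,
     monoid.mult = (\<lambda>x y. coset_rep A I (x \<otimes>\<^bsub>A\<^esub> y)),
     monoid.one = coset_rep A I \<one>\<^bsub>A\<^esub>,
     ring.zero = coset_rep A I \<zero>\<^bsub>A\<^esub>,
     ring.add = (\<lambda>x y. coset_rep A I (x \<oplus>\<^bsub>A\<^esub> y)),
     module.smult = (\<lambda>c x. coset_rep A I (c \<odot>\<^bsub>A\<^esub> x)),
     cs_star = (\<lambda>x. coset_rep A I (cs_star A x)),
     cs_norm = (\<lambda>x. INF y\<in>I +>\<^bsub>A\<^esub> x. cs_norm A y)\<rparr>"


section \<open>C*-properties\<close>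

text \<open>
  A class of C*-algebras is a set of C*-algebras with carrier in an arbitrary type \<open>'a\<close>. Ideals
  and quotients of an algebra with carrier in \<open>'a\<close> are available in \<open>'a\<close> again, so
  nothing in the sequel leads out of this universe.
\<close>

definition cstar_property :: "'a cstar set \<Rightarrow> bool" where
  "cstar_property P \<longleftrightarrow>
    (\<forall>A\<in>P. cstar_algebra A) \<and>
    (\<forall>A. cstar_algebra A \<and> zero_algebra A \<longrightarrow> A \<in> P) \<and>
    (\<forall>A B. A \<in> P \<and> cstar_algebra B \<and> star_isomorphic A B \<longrightarrow> B \<in> P)"

definition P_up :: "'a cstar set set" where
  "P_up = {P. cstar_property P \<and> (\<forall>A\<in>P. \<forall>I\<in>ideals A. quot_alg A I \<in> P)}"

definition GP :: "'a cstar set \<Rightarrow> 'a cstar set" where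
  "GP P = {A. cstar_algebra A \<and>
    (zero_algebra A \<or>
     (\<forall>I\<in>ideals A. \<not> zero_algebra (quot_alg A I) \<longrightarrow>
       (\<exists>J\<in>ideals (quot_alg A I). J \<noteq> {\<zero>\<^bsub>quot_alg A I\<^esub>} \<and> ideal_alg (quot_alg A I) J \<in> P)))}"


section \<open>The relations and the radical\<close>

definition ll :: "'a cstar set \<Rightarrow> 'a cstar \<Rightarrow> 'a set \<Rightarrow> 'a set \<Rightarrow> bool" where
  "ll P A I J \<longleftrightarrow> I \<in> ideals A \<and> J \<in> ideals A \<and> I \<subseteq> J \<and> quot_alg (ideal_alg A J) I \<in> P"

text \<open>
  The ordinals \<open>1, \<dots>, \<gamma>\<close> are the elements of a well-order \<open>r\<close> with least element \<open>lo\<close> and greatest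
  element \<open>hi\<close>. The type \<open>'a set\<close> of indices is large enough: the families in question are
  increasing, after omission of repetitions they still have the required properties, and then their
  members can serve as their own indices.
\<close>

definition ll_tri :: "'a cstar set \<Rightarrow> 'a cstar \<Rightarrow> 'a set \<Rightarrow> 'a set \<Rightarrow> bool" where
  "ll_tri P A I J \<longleftrightarrow>
    (\<exists>(r :: 'a set rel) (F :: 'a set \<Rightarrow> 'a set) lo hi.
      Well_order r \<and> lo \<in> Field r \<and> hi \<in> Field r \<and>
      (\<forall>k\<in>Field r. (lo, k) \<in> r \<and> (k, hi) \<in> r) \<and>
      (\<forall>k\<in>Field r. F k \<in> ideals A) \<and>
      F lo = I \<and> F hi = J \<and>
      (\<forall>k\<in>underS r hi. ll P A (F k) (F (wo_rel.suc r {k}))) \<and>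
      (\<forall>b\<in>Field r. b \<noteq> lo \<and> (\<forall>k\<in>underS r b. b \<noteq> wo_rel.suc r {k}) \<longrightarrow>
        F b = cs_topology A closure_of (\<Union>k\<in>underS r b. F k)))"

definition ideal_sum :: "'a cstar \<Rightarrow> 'a set set \<Rightarrow> 'a set" where
  "ideal_sum A S =
    {finsum A x T | x T. finite T \<and> T \<subseteq> S \<and> (\<forall>J\<in>T. x J \<in> J)}"

definition cs_radical :: "'a cstar set \<Rightarrow> 'a cstar \<Rightarrow> 'a set" where
  "cs_radical P A =
    cs_topology A closure_of (ideal_sum A {J \<in> ideals A. ll_tri P A {\<zero>\<^bsub>A\<^esub>} J})"

end

theory Submission
  imports Defs "HOL-Library.Bourbaki_Witt_Fixpoint"
begin

text \<open>
  By \<open>GP_iff\<close>, a C*-algebra \<open>A\<close> has the property \<open>GP P\<close> if and only if every closed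
  ideal \<open>I \<noteq> A\<close> lies strictly below a closed ideal \<open>J\<close> with \<open>J/I \<in> P\<close>. In this form monotonicity is
  evident, \<open>P \<subseteq> GP P\<close> follows with \<open>J = A\<close>, and \<open>GP P\<close> inherits isomorphism invariance and stability
  under quotients from the correspondence between the ideals of \<open>A/I\<close> and the ideals of \<open>A\<close> above \<open>I\<close>.
  For idempotence, let \<open>J/I \<in> GP P\<close> be non-zero; then \<open>J/I\<close> has a non-zero ideal \<open>K/I\<close> in \<open>P\<close>, and
  \<open>K\<close>, an ideal of an ideal, is an ideal of \<open>A\<close>.

  The radicals are compared through the equivalence \<open>ll_tri_iff_GP\<close>: there is a chain from \<open>0\<close> to \<open>J\<close>
  with subquotients in \<open>P\<close> if and only if \<open>J \<in> GP P\<close>. Hence the ideals whose sum is dense in the radical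
  depend on \<open>GP P\<close> only, and \<open>GP P = GP P1\<close> whenever \<open>P \<subseteq> P1 \<subseteq> GP P\<close>. If there is such a chain and
  \<open>L\<close> is an ideal strictly below \<open>J\<close>, then the first member of the chain that is not contained in \<open>L\<close>
  is the successor \<open>N\<close> of some member below \<open>L\<close>. So \<open>N/(N \<inter> L)\<close> is a quotient of an algebra in \<open>P\<close>, and
  it is isomorphic to \<open>K/L\<close> for the closure \<open>K\<close> of \<open>N + L\<close>. Conversely, if \<open>J \<in> GP P\<close>, one climbs from \<open>0\<close>
  to \<open>J\<close> by transfinite iteration; this is the tower of the Bourbaki-Witt theorem, which is well-ordered
  by inclusion and serves as its own index set.

  The facts on C*-algebras behind this argument are proved from the axioms. An approximate unit
  (\<open>approximate_unit\<close>) shows that closed ideals are self-adjoint, that ideals of ideals are ideals, that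
  quotients satisfy the C*-identity, and that \<open>N/(N \<inter> L)\<close> maps onto \<open>K/L\<close>. Since a *-isomorphism is
  only required to respect the algebraic operations, invariance under isomorphism needs in addition that
  *-homomorphisms are contractive (\<open>star_hom_contractive\<close>). Spectral theory is replaced in both cases by
  one observation: if \<open>a\<close> and \<open>b\<close> are commuting self-adjoint elements, then \<open>c = a + i b\<close> satisfies
  \<open>c* c = c c* = a\<^sup>2 + b\<^sup>2\<close>, so that \<open>\<parallel>a\<parallel>\<^sup>2 \<le> \<parallel>a\<^sup>2 + b\<^sup>2\<parallel>\<close> by the C*-identity.
\<close>

section \<open>The algebra and its metric\<close>

text \<open>
  Two-sided ideals without the condition of being closed, needed for sums and unions before the
  closure is taken.
\<close>

definition alg_ideal :: "'a cstar \<Rightarrow> 'a set \<Rightarrow> bool" where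
  "alg_ideal A I \<longleftrightarrow> I \<subseteq> carrier A \<and> \<zero>\<^bsub>A\<^esub> \<in> I \<and>
    (\<forall>x\<in>I. \<forall>y\<in>I. x \<oplus>\<^bsub>A\<^esub> y \<in> I) \<and> (\<forall>x\<in>I. \<forall>c. c \<odot>\<^bsub>A\<^esub> x \<in> I) \<and>
    (\<forall>x\<in>I. \<forall>a\<in>carrier A. a \<otimes>\<^bsub>A\<^esub> x \<in> I \<and> x \<otimes>\<^bsub>A\<^esub> a \<in> I)"

lemma ring_of_type_algebra_simps:
  "carrier (ring_of_type_algebra :: complex ring) = UNIV"
  "add (ring_of_type_algebra :: complex ring) a b = a + b"
  "monoid.mult (ring_of_type_algebra :: complex ring) a b = a * b"
  "zero (ring_of_type_algebra :: complex ring) = 0"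
  "one (ring_of_type_algebra :: complex ring) = 1"
  by (simp_all add: ring_of_type_algebra_def)

context cstar_algebra
begin

lemmas [simp] = mult_closed star_closed star_star star_add star_smult star_mult
  mult_distrib_left mult_distrib_right smult_mult_left smult_mult_right

lemma scale_closed [simp]: "x \<in> carrier A \<Longrightarrow> c \<odot> x \<in> carrier A"
  using smult_closed[of c x] by (simp add: ring_of_type_algebra_simps)

lemma scale_left_distrib: "x \<in> carrier A \<Longrightarrow> (a + b) \<odot> x = a \<odot> x \<oplus> b \<odot> x"
  using smult_l_distr[of a b x] by (simp add: ring_of_type_algebra_simps)

lemma scale_right_distrib [simp]:
  "x \<in> carrier A \<Longrightarrow> y \<in> carrier A \<Longrightarrow> a \<odot> (x \<oplus> y) = a \<odot> x \<oplus> a \<odot> y"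
  using smult_r_distr[of a x y] by (simp add: ring_of_type_algebra_simps)

lemma scale_scale [simp]: "x \<in> carrier A \<Longrightarrow> a \<odot> (b \<odot> x) = (a * b) \<odot> x"
  using smult_assoc1[of a b x] by (simp add: ring_of_type_algebra_simps)

lemma scale_one [simp]: "x \<in> carrier A \<Longrightarrow> 1 \<odot> x = x"
  using smult_one[of x] by (simp add: ring_of_type_algebra_simps)

lemma scale_zero_left [simp]: "x \<in> carrier A \<Longrightarrow> 0 \<odot> x = \<zero>"
  using smult_l_null[of x] by (simp add: ring_of_type_algebra_simps)

lemma scale_zero_right [simp]: "c \<odot> \<zero> = \<zero>"
  using smult_r_null[of c] by (simp add: ring_of_type_algebra_simps)

lemma minus_eq_scale: "x \<in> carrier A \<Longrightarrow> \<ominus> x = (-1) \<odot> x"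
  by (rule minus_equality)
    (use scale_left_distrib[of x "-1" 1] in \<open>simp_all add: scale_left_distrib[symmetric]\<close>)

lemma diff_eq_scale: "x \<in> carrier A \<Longrightarrow> y \<in> carrier A \<Longrightarrow> x \<ominus> y = x \<oplus> (-1) \<odot> y"
  by (simp add: minus_eq minus_eq_scale)

lemma mult_zero [simp]:
  assumes "x \<in> carrier A"
  shows "x \<otimes> \<zero> = \<zero>" "\<zero> \<otimes> x = \<zero>"
  using smult_mult_right[of x \<zero> 0] smult_mult_left[of \<zero> x 0] assms by simp_all

lemma star_zero [simp]: "cs_star A \<zero> = \<zero>"
  using star_smult[of \<zero> 0] by simp

lemma star_minus [simp]: "x \<in> carrier A \<Longrightarrow> cs_star A (\<ominus> x) = \<ominus> cs_star A x"
  by (simp add: minus_eq_scale)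

lemma star_diff [simp]:
  "x \<in> carrier A \<Longrightarrow> y \<in> carrier A \<Longrightarrow> cs_star A (x \<ominus> y) = cs_star A x \<ominus> cs_star A y"
  by (simp add: minus_eq)

lemma mult_minus [simp]:
  assumes "x \<in> carrier A" "y \<in> carrier A"
  shows "x \<otimes> (\<ominus> y) = \<ominus> (x \<otimes> y)" "(\<ominus> x) \<otimes> y = \<ominus> (x \<otimes> y)"
  using assms by (simp_all add: minus_eq_scale)

lemma mult_diff:
  assumes "x \<in> carrier A" "y \<in> carrier A" "z \<in> carrier A"
  shows "x \<otimes> (y \<ominus> z) = x \<otimes> y \<ominus> x \<otimes> z" "(y \<ominus> z) \<otimes> x = y \<otimes> x \<ominus> z \<otimes> x"
  using assms by (simp_all add: minus_eq)

lemma scale_diff: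
  "x \<in> carrier A \<Longrightarrow> y \<in> carrier A \<Longrightarrow> c \<odot> (x \<ominus> y) = c \<odot> x \<ominus> c \<odot> y"
  by (simp add: diff_eq_scale mult.commute)

lemma norm_zero [simp]: "cs_norm A \<zero> = 0"
  by (simp add: norm_eq_zero)

lemma norm_minus [simp]: "x \<in> carrier A \<Longrightarrow> cs_norm A (\<ominus> x) = cs_norm A x"
  by (simp add: minus_eq_scale norm_smult)

lemma norm_diff_commute:
  assumes "x \<in> carrier A" "y \<in> carrier A"
  shows "cs_norm A (x \<ominus> y) = cs_norm A (y \<ominus> x)"
proof -
  have "\<ominus> (x \<ominus> y) = y \<ominus> x"
    using assms by (simp add: minus_eq minus_add a_comm)
  then show ?thesis
    using norm_minus[of "x \<ominus> y"] assms by simp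
qed

lemma diff_add_diff:
  assumes "x \<in> carrier A" "y \<in> carrier A" "z \<in> carrier A"
  shows "(x \<ominus> y) \<oplus> (y \<ominus> z) = x \<ominus> z"
  using assms by (simp add: minus_eq a_assoc r_neg1)

lemma diff_add_cancel: "x \<in> carrier A \<Longrightarrow> y \<in> carrier A \<Longrightarrow> (x \<ominus> y) \<oplus> y = x"
  by (simp add: minus_eq a_assoc l_neg)

lemma add_diff_cancel: "x \<in> carrier A \<Longrightarrow> y \<in> carrier A \<Longrightarrow> (x \<oplus> y) \<ominus> y = x"
  by (simp add: minus_eq a_assoc r_neg)

lemma add_diff_add:
  assumes "x \<in> carrier A" "y \<in> carrier A" "x' \<in> carrier A" "y' \<in> carrier A"
  shows "(x \<oplus> y) \<ominus> (x' \<oplus> y') = (x \<ominus> x') \<oplus> (y \<ominus> y')"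
  using assms by (simp add: minus_eq minus_add a_ac)

lemma diff_self [simp]: "x \<in> carrier A \<Longrightarrow> x \<ominus> x = \<zero>"
  by (simp add: minus_eq r_neg)

lemma diff_zero [simp]: "x \<in> carrier A \<Longrightarrow> x \<ominus> \<zero> = x"
  by (simp add: diff_eq_scale)

lemma diff_eq_zero_iff:
  "x \<in> carrier A \<Longrightarrow> y \<in> carrier A \<Longrightarrow> x \<ominus> y = \<zero> \<longleftrightarrow> x = y"
  using diff_add_cancel[of x y] by auto

lemma norm_diff_triangle:
  assumes "x \<in> carrier A" "y \<in> carrier A" "z \<in> carrier A"
  shows "cs_norm A (x \<ominus> z) \<le> cs_norm A (x \<ominus> y) + cs_norm A (y \<ominus> z)"
  using norm_triangle[of "x \<ominus> y" "y \<ominus> z"] assms by (simp add: diff_add_diff)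

lemma norm_le_add_diff:
  assumes "x \<in> carrier A" "y \<in> carrier A"
  shows "cs_norm A x \<le> cs_norm A y + cs_norm A (x \<ominus> y)"
  using norm_diff_triangle[of x y \<zero>] assms by simp

lemma norm_triangle_diff:
  assumes "x \<in> carrier A" "y \<in> carrier A"
  shows "cs_norm A (x \<ominus> y) \<le> cs_norm A x + cs_norm A y"
  using norm_triangle[of x "\<ominus> y"] assms by (simp add: minus_eq)

lemma norm_add_diff_add:
  assumes "x \<in> carrier A" "y \<in> carrier A" "x' \<in> carrier A" "y' \<in> carrier A"
  shows "cs_norm A ((x \<oplus> y) \<ominus> (x' \<oplus> y')) \<le> cs_norm A (x \<ominus> x') + cs_norm A (y \<ominus> y')"
  using norm_triangle[of "x \<ominus> x'" "y \<ominus> y'"] assms by (simp add: add_diff_add)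

lemma norm_star [simp]:
  assumes x: "x \<in> carrier A"
  shows "cs_norm A (cs_star A x) = cs_norm A x"
proof -
  have le: "cs_norm A y \<le> cs_norm A (cs_star A y)" if y: "y \<in> carrier A" for y
  proof (cases "cs_norm A y = 0")
    case True
    then show ?thesis using y by (simp add: norm_nonneg)
  next
    case False
    have "cs_norm A y * cs_norm A y \<le> cs_norm A (cs_star A y) * cs_norm A y"
      using cstar_identity[OF y] norm_mult[of "cs_star A y" y] y by (simp add: power2_eq_square)
    then show ?thesis
      using False norm_nonneg[OF y] by simp
  qed
  show ?thesis
    using le[OF x] le[of "cs_star A x"] x by simp
qed

lemma cstar_identity': "x \<in> carrier A \<Longrightarrow> cs_norm A (x \<otimes> cs_star A x) = (cs_norm A x)\<^sup>2"
  using cstar_identity[of "cs_star A x"] by simp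

lemma cs_dist_eq: "x \<in> carrier A \<Longrightarrow> y \<in> carrier A \<Longrightarrow> cs_dist A x y = cs_norm A (x \<ominus> y)"
  by (simp add: cs_dist_def)

end

text \<open>
  This is stated for an arbitrary record, because it serves to establish the completeness axiom of
  ideals and of quotients, before they are known to be C*-algebras.
\<close>

lemma mcomplete_cs_dist_iff:
  assumes "Metric_space (carrier B) (cs_dist B)"
  shows "Metric_space.mcomplete (carrier B) (cs_dist B) \<longleftrightarrow>
    (\<forall>s. (\<forall>n. s n \<in> carrier B) \<and>
        (\<forall>e>0. \<exists>N::nat. \<forall>m\<ge>N. \<forall>n\<ge>N. cs_norm B (s m \<ominus>\<^bsub>B\<^esub> s n) < e) \<longrightarrow>
      (\<exists>x\<in>carrier B. \<forall>e>0. \<exists>N. \<forall>n\<ge>N. cs_norm B (s n \<ominus>\<^bsub>B\<^esub> x) < e))"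
    (is "_ \<longleftrightarrow> (\<forall>s. ?C s \<longrightarrow> ?L s)")
proof -
  interpret M: Metric_space "carrier B" "cs_dist B" by fact
  have C: "M.MCauchy s \<longleftrightarrow> ?C s" for s
    unfolding M.MCauchy_def by (auto simp: cs_dist_def image_subset_iff)
  have L: "(\<exists>x. limitin M.mtopology s x sequentially) \<longleftrightarrow> ?L s" if "?C s" for s
  proof -
    have "limitin M.mtopology s x sequentially \<longleftrightarrow>
        x \<in> carrier B \<and> (\<forall>e>0. \<exists>N. \<forall>n\<ge>N. cs_norm B (s n \<ominus>\<^bsub>B\<^esub> x) < e)" for x
      using that by (auto simp: M.limit_metric_sequentially cs_dist_def)
    then show ?thesis by blast
  qed
  show ?thesis
    unfolding M.mcomplete_def C by (intro iff_allI imp_cong refl L)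
qed

context cstar_algebra
begin

lemma metric_space_cs_dist: "Metric_space (carrier A) (cs_dist A)"
proof
  show "0 \<le> cs_dist A x y" for x y
    by (simp add: cs_dist_def norm_nonneg)
  show "cs_dist A x y = cs_dist A y x" for x y
    by (simp add: cs_dist_def norm_diff_commute)
  show "cs_dist A x y = 0 \<longleftrightarrow> x = y" if "x \<in> carrier A" "y \<in> carrier A" for x y
    using that by (simp add: cs_dist_def norm_eq_zero diff_eq_zero_iff)
  show "cs_dist A x z \<le> cs_dist A x y + cs_dist A y z"
    if "x \<in> carrier A" "y \<in> carrier A" "z \<in> carrier A" for x y z
    using that by (simp add: cs_dist_def norm_diff_triangle)
qed

sublocale metr: Metric_space "carrier A" "cs_dist A"
  by (rule metric_space_cs_dist)

lemma cauchy_has_limit: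
  assumes "\<And>n. s n \<in> carrier A"
    and "\<And>e. e > 0 \<Longrightarrow> \<exists>N::nat. \<forall>m\<ge>N. \<forall>n\<ge>N. cs_norm A (s m \<ominus> s n) < e"
  obtains x where "x \<in> carrier A" "\<And>e. e > 0 \<Longrightarrow> \<exists>N. \<forall>n\<ge>N. cs_norm A (s n \<ominus> x) < e"
proof -
  have "\<exists>x\<in>carrier A. \<forall>e>0. \<exists>N. \<forall>n\<ge>N. cs_norm A (s n \<ominus> x) < e"
    using complete[unfolded mcomplete_cs_dist_iff[OF metric_space_cs_dist], rule_format, of s] assms
    by simp
  then show thesis
    using that by blast
qed

lemma geometric_limit:
  fixes x :: "nat \<Rightarrow> 'a" and q C :: real
  assumes xc: "\<And>n. x n \<in> carrier A" and q: "0 \<le> q" "q < 1"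
    and step: "\<And>n. cs_norm A (x (Suc n) \<ominus> x n) \<le> C * q ^ n"
  obtains l where "l \<in> carrier A" "\<And>e. e > 0 \<Longrightarrow> \<exists>N. \<forall>n\<ge>N. cs_norm A (x n \<ominus> l) < e"
proof -
  define D where "D = C / (1 - q)"
  have C0: "C \<ge> 0" using step[of 0] norm_nonneg[of "x (Suc 0) \<ominus> x 0"] xc by simp
  have "D * (1 - q) = C" using q by (simp add: D_def)
  then have D: "D \<ge> 0" "C = D - D * q" using C0 q by (simp_all add: D_def right_diff_distrib)
  have tail: "cs_norm A (x (n + m) \<ominus> x n) \<le> D * q ^ n - D * q ^ (n + m)" for n m
  proof (induction m)
    case 0
    then show ?case using xc by simp
  next
    case (Suc m)
    have "cs_norm A (x (n + Suc m) \<ominus> x n) \<le> cs_norm A (x (n + Suc m) \<ominus> x (n + m)) + cs_norm A (x (n + m) \<ominus> x n)"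
      using xc by (intro norm_diff_triangle)
    then show ?case using Suc step[of "n + m"] by (simp add: D(2) algebra_simps)
  qed
  have tail': "cs_norm A (x m \<ominus> x n) \<le> D * q ^ n" if "m \<ge> n" for m n
  proof -
    have "cs_norm A (x m \<ominus> x n) \<le> D * q ^ n - D * q ^ m"
      using tail[of n "m - n"] that by simp
    moreover have "0 \<le> D * q ^ m" using D(1) q by simp
    ultimately show ?thesis by linarith
  qed
  show thesis
  proof (rule cauchy_has_limit[of x])
    show "x n \<in> carrier A" for n by (rule xc)
    fix e :: real assume e: "e > 0"
    obtain N where N: "q ^ N < e / (2 * D + 1)"
      using real_arch_pow_inv[of "e / (2 * D + 1)" q] e D q by auto
    have DN: "2 * (D * q ^ N) < e"
    proof -
      have "2 * (D * q ^ N) \<le> (2 * D + 1) * q ^ N" using q by (simp add: distrib_right)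
      also have "\<dots> < e" using N D(1) by (simp add: less_divide_eq mult.commute)
      finally show ?thesis .
    qed
    have "cs_norm A (x m \<ominus> x n) < e" if "m \<ge> N" "n \<ge> N" for m n
    proof -
      have "cs_norm A (x m \<ominus> x n) \<le> cs_norm A (x m \<ominus> x N) + cs_norm A (x n \<ominus> x N)"
        using norm_diff_triangle[of "x m" "x N" "x n"] norm_diff_commute[of "x n" "x N"] xc by simp
      then show ?thesis using tail'[OF that(1)] tail'[OF that(2)] DN by simp
    qed
    then show "\<exists>N. \<forall>m\<ge>N. \<forall>n\<ge>N. cs_norm A (x m \<ominus> x n) < e" by blast
  qed (rule that)
qed

lemma eqI_norm:
  assumes "x \<in> carrier A" "y \<in> carrier A" "\<And>e. e > 0 \<Longrightarrow> cs_norm A (x \<ominus> y) \<le> C * e"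
  shows "x = y"
proof -
  have C: "C \<ge> 0" using assms(3)[of 1] norm_nonneg[of "x \<ominus> y"] assms(1,2) by simp
  have "cs_norm A (x \<ominus> y) \<le> 0"
  proof (rule field_le_epsilon)
    fix e :: real assume e: "e > 0"
    have "cs_norm A (x \<ominus> y) \<le> C * (e / (C + 1))"
      using C e by (intro assms(3)) simp
    also have "\<dots> \<le> (C + 1) * (e / (C + 1))"
      using C e by (intro mult_right_mono) simp_all
    finally show "cs_norm A (x \<ominus> y) \<le> 0 + e" using C by simp
  qed
  then have "x \<ominus> y = \<zero>"
    using norm_nonneg[of "x \<ominus> y"] norm_eq_zero[of "x \<ominus> y"] assms(1,2) by simp
  then show ?thesis using diff_eq_zero_iff assms(1,2) by blast
qed

lemma in_closure_of_iff:
  assumes "S \<subseteq> carrier A"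
  shows "x \<in> cs_topology A closure_of S \<longleftrightarrow>
    x \<in> carrier A \<and> (\<forall>e>0. \<exists>y\<in>S. cs_norm A (x \<ominus> y) < e)"
proof -
  have "y \<in> S \<and> y \<in> metr.mball x e \<longleftrightarrow> y \<in> S \<and> cs_norm A (x \<ominus> y) < e"
    if "x \<in> carrier A" for y e
    using assms that by (auto simp: cs_dist_eq)
  then show ?thesis
    unfolding metr.metric_closure_of mem_Collect_eq by blast
qed

lemma closedin_iff:
  "closedin (cs_topology A) S \<longleftrightarrow>
    S \<subseteq> carrier A \<and> (\<forall>x\<in>carrier A. (\<forall>e>0. \<exists>y\<in>S. cs_norm A (x \<ominus> y) < e) \<longrightarrow> x \<in> S)"
proof -
  have "closedin (cs_topology A) S \<longleftrightarrow> S \<subseteq> carrier A \<and> cs_topology A closure_of S \<subseteq> S"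
    using closure_of_subset_eq[of S "cs_topology A"] by simp
  then show ?thesis
    using in_closure_of_iff[of S] by (simp add: subset_iff) blast
qed

end

section \<open>Polynomials in a self-adjoint element\<close>

definition conj_poly :: "complex poly \<Rightarrow> complex poly" where
  "conj_poly p = map_poly cnj p"

lemma coeff_conj_poly [simp]: "poly.coeff (conj_poly p) n = cnj (poly.coeff p n)"
  by (simp add: conj_poly_def coeff_map_poly)

lemma conj_poly_0 [simp]: "conj_poly 0 = 0"
  and conj_poly_1 [simp]: "conj_poly 1 = 1"
  and conj_poly_pCons [simp]: "conj_poly (pCons a p) = pCons (cnj a) (conj_poly p)"
  and conj_poly_add [simp]: "conj_poly (p + q) = conj_poly p + conj_poly q"
  and conj_poly_diff [simp]: "conj_poly (p - q) = conj_poly p - conj_poly q"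
  and conj_poly_minus [simp]: "conj_poly (- p) = - conj_poly p"
  and conj_poly_smult [simp]: "conj_poly (Polynomial.smult c p) = Polynomial.smult (cnj c) (conj_poly p)"
  and conj_poly_mult [simp]: "conj_poly (p * q) = conj_poly p * conj_poly q"
  by (rule poly_eqI; simp add: coeff_mult coeff_pCons coeff_1 split: nat.split)+

context cstar_algebra
begin

text \<open>
  Since \<open>A\<close> has no unit, \<open>p(k)\<close> need not be an element of \<open>A\<close>, but it acts on \<open>A\<close> by multiplication
  from the right: \<open>poly_act k p z\<close> is \<open>z p(k)\<close>. It makes \<open>A\<close> a module over \<open>\<complex>[X]\<close>, so that identities between
  commuting elements can be verified in the polynomial ring.
\<close>

definition poly_act :: "'a \<Rightarrow> complex poly \<Rightarrow> 'a \<Rightarrow> 'a" where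
  "poly_act k p z = fold_coeffs (\<lambda>a w. a \<odot> z \<oplus> w \<otimes> k) p \<zero>"

lemma poly_act_0 [simp]: "poly_act k 0 z = \<zero>"
  by (simp add: poly_act_def)

lemma poly_act_pCons [simp]:
  assumes "k \<in> carrier A" "z \<in> carrier A"
  shows "poly_act k (pCons a p) z = a \<odot> z \<oplus> poly_act k p z \<otimes> k"
  using assms by (cases "p = 0 \<and> a = 0") (auto simp: poly_act_def)

lemma poly_act_closed [simp]:
  assumes "k \<in> carrier A" "z \<in> carrier A"
  shows "poly_act k p z \<in> carrier A"
  using assms by (induction p) auto

lemma poly_act_add [simp]:
  assumes "k \<in> carrier A" "z \<in> carrier A"
  shows "poly_act k (p + q) z = poly_act k p z \<oplus> poly_act k q z"
  using assms by (induction p q rule: poly_induct2) (simp_all add: scale_left_distrib a_ac)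

lemma poly_act_smult [simp]:
  assumes "k \<in> carrier A" "z \<in> carrier A"
  shows "poly_act k (Polynomial.smult c p) z = c \<odot> poly_act k p z"
  using assms by (induction p) simp_all

lemma poly_act_minus [simp]:
  assumes "k \<in> carrier A" "z \<in> carrier A"
  shows "poly_act k (- p) z = \<ominus> poly_act k p z"
  using poly_act_smult[of k z "-1" p] assms by (simp add: minus_eq_scale)

lemma poly_act_diff [simp]:
  assumes "k \<in> carrier A" "z \<in> carrier A"
  shows "poly_act k (p - q) z = poly_act k p z \<ominus> poly_act k q z"
  using poly_act_add[of k z p "- q"] assms by (simp add: minus_eq)

lemma poly_act_1 [simp]:
  assumes "k \<in> carrier A" "z \<in> carrier A"
  shows "poly_act k 1 z = z"
  using assms by (simp add: one_pCons)

lemma poly_act_mult [simp]: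
  assumes "k \<in> carrier A" "z \<in> carrier A"
  shows "poly_act k (p * q) z = poly_act k p (poly_act k q z)"
  using assms by (induction p) simp_all

lemma mult_poly_act:
  assumes "k \<in> carrier A" "x \<in> carrier A" "z \<in> carrier A"
  shows "x \<otimes> poly_act k p z = poly_act k p (x \<otimes> z)"
  using assms by (induction p) (simp_all add: mult_assoc[symmetric])

lemma poly_act_mult_right:
  assumes "k \<in> carrier A" "z \<in> carrier A"
  shows "poly_act k p (z \<otimes> k) = poly_act k p z \<otimes> k"
  using assms by (induction p) simp_all

text \<open>
  The adjoint of \<open>p(k)\<close> is the polynomial with conjugate coefficients, in a form that does not mention
  left multiplication by a polynomial.
\<close>

lemma mult_star_poly_act:
  assumes k: "k \<in> carrier A" "cs_star A k = k" and "w \<in> carrier A" "z \<in> carrier A"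
  shows "w \<otimes> cs_star A (poly_act k p z) = poly_act k (conj_poly p) w \<otimes> cs_star A z"
  using assms(3,4)
proof (induction p arbitrary: w)
  case 0
  then show ?case by simp
next
  case (pCons a p)
  have "w \<otimes> (k \<otimes> cs_star A (poly_act k p z)) = (w \<otimes> k) \<otimes> cs_star A (poly_act k p z)"
    using pCons.prems k by (simp add: mult_assoc)
  also have "\<dots> = poly_act k (conj_poly p) (w \<otimes> k) \<otimes> cs_star A z"
    using pCons k by simp
  finally show ?case
    using pCons.prems k by (simp add: poly_act_mult_right)
qed

text \<open>
  \<open>C\<close> bounds the norm of \<open>p(k)\<close> in the algebra with unit adjoined. The value \<open>p(0)\<close> is the image of
  \<open>p(k)\<close> modulo \<open>A\<close>; keeping track of it makes it possible to rescale a polynomial to constant term \<open>1\<close>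
  at a controlled cost.
\<close>

definition poly_bound :: "'a \<Rightarrow> complex poly \<Rightarrow> real \<Rightarrow> bool" where
  "poly_bound k p C \<longleftrightarrow> 0 \<le> C \<and> cmod (poly p 0) \<le> C \<and>
     (\<forall>z\<in>carrier A. cs_norm A (poly_act k p z) \<le> C * cs_norm A z)"

context
  fixes k assumes k [simp]: "k \<in> carrier A"
begin

lemma poly_bound_mono: "poly_bound k p C \<Longrightarrow> C \<le> D \<Longrightarrow> poly_bound k p D"
  unfolding poly_bound_def by (meson mult_right_mono norm_nonneg order_trans)

lemma poly_bound_add:
  assumes "poly_bound k p C" "poly_bound k q D"
  shows "poly_bound k (p + q) (C + D)"
proof -
  have "cs_norm A (poly_act k (p + q) z) \<le> (C + D) * cs_norm A z" if z: "z \<in> carrier A" for z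
  proof -
    have "cs_norm A (poly_act k (p + q) z) \<le> cs_norm A (poly_act k p z) + cs_norm A (poly_act k q z)"
      using z by (simp add: norm_triangle)
    also have "\<dots> \<le> C * cs_norm A z + D * cs_norm A z"
      using assms z by (simp add: poly_bound_def add_mono)
    finally show ?thesis by (simp add: algebra_simps)
  qed
  then show ?thesis
    using assms by (auto simp: poly_bound_def intro: norm_triangle_le add_mono)
qed

lemma poly_bound_mult:
  assumes "poly_bound k p C" "poly_bound k q D"
  shows "poly_bound k (p * q) (C * D)"
proof -
  have "cs_norm A (poly_act k (p * q) z) \<le> (C * D) * cs_norm A z" if z: "z \<in> carrier A" for z
  proof -
    have "cs_norm A (poly_act k (p * q) z) \<le> C * cs_norm A (poly_act k q z)"
      using z assms by (simp add: poly_bound_def)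
    also have "\<dots> \<le> C * (D * cs_norm A z)"
      using assms z by (intro mult_left_mono) (auto simp: poly_bound_def)
    finally show ?thesis by (simp add: algebra_simps)
  qed
  then show ?thesis
    using assms by (auto simp: poly_bound_def Real_Vector_Spaces.norm_mult intro: mult_mono)
qed

lemma poly_bound_smult:
  assumes "poly_bound k p C"
  shows "poly_bound k (Polynomial.smult c p) (cmod c * C)"
  using assms by (auto simp: poly_bound_def Real_Vector_Spaces.norm_mult local.norm_smult mult.assoc mult_left_mono)

lemma poly_bound_const: "poly_bound k [:c:] (cmod c)"
  by (auto simp: poly_bound_def local.norm_smult)

lemma poly_bound_1: "poly_bound k 1 1"
  using poly_bound_const[of 1] by (simp add: one_pCons)

lemma poly_bound_X: "poly_bound k [:0, 1:] (cs_norm A k)"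
  using local.norm_mult[of _ k] by (auto simp: poly_bound_def norm_nonneg mult.commute)

lemma poly_bound_power: "poly_bound k p C \<Longrightarrow> poly_bound k (p ^ n) (C ^ n)"
  by (induction n) (auto simp: poly_bound_1 poly_bound_mult)

lemma poly_bound_exists: "\<exists>C. poly_bound k p C"
proof (induction p)
  case 0
  show ?case using poly_bound_const[of 0] by auto
next
  case (pCons a p)
  then obtain C where C: "poly_bound k p C" by blast
  have "pCons a p = [:a:] + [:0, 1:] * p" by simp
  then show ?case
    using poly_bound_add[OF poly_bound_const[of a] poly_bound_mult[OF poly_bound_X C]] by metis
qed

text \<open>
  That the optimal bound is attained is what lets an inequality such as
  \<open>C \<le> sqrt (C * (1 + \<eta>))\<close> between bounds be turned into an absolute one.
\<close>

lemma poly_bound_least: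
  "\<exists>C. poly_bound k p C \<and> (\<forall>D. poly_bound k p D \<longrightarrow> C \<le> D)"
proof -
  define S where "S = {D. poly_bound k p D}"
  have S: "S \<noteq> {}" "bdd_below S"
    using poly_bound_exists by (auto simp: S_def poly_bound_def intro!: bdd_belowI[of _ 0])
  have "cs_norm A (poly_act k p z) \<le> Inf S * cs_norm A z" if z: "z \<in> carrier A" for z
  proof (cases "cs_norm A z = 0")
    case True
    then show ?thesis
      using poly_bound_exists[of p] z by (force simp: poly_bound_def)
  next
    case False
    then have pos: "cs_norm A z > 0" using norm_nonneg[OF z] by simp
    have "cs_norm A (poly_act k p z) / cs_norm A z \<le> Inf S"
      using S pos z by (intro cInf_greatest) (auto simp: S_def poly_bound_def field_simps)
    then show ?thesis using pos by (simp add: field_simps)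
  qed
  moreover have "0 \<le> Inf S" "cmod (poly p 0) \<le> Inf S"
    using S(1) by (auto intro!: cInf_greatest simp: S_def poly_bound_def)
  ultimately have "poly_bound k p (Inf S)"
    by (simp add: poly_bound_def)
  then show ?thesis
    using cInf_lower[OF _ S(2)] by (intro exI[of _ "Inf S"]) (auto simp: S_def)
qed

context
  assumes sa: "cs_star A k = k"
begin

text \<open>
  With \<open>c = p + i q\<close> one has \<open>c* c = p\<^sup>2 + q\<^sup>2\<close>, so the C*-identity bounds \<open>c\<close> and \<open>c*\<close> by
  \<open>sqrt C\<close>, and \<open>p\<close> is their mean. This takes the place of positivity.
\<close>

lemma poly_bound_sqrt:
  assumes p: "conj_poly p = p" and q: "conj_poly q = q"
    and C: "poly_bound k (p * p + q * q) C"
  shows "poly_bound k p (sqrt C)"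
proof -
  have C0: "C \<ge> 0" using C by (simp add: poly_bound_def)
  define c where "c = p + Polynomial.smult \<i> q"
  define c' where "c' = p - Polynomial.smult \<i> q"
  have cc: "conj_poly c = c'" "conj_poly c' = c"
    by (simp_all add: c_def c'_def p q)
  have prod: "c' * c = p * p + q * q" "c * c' = p * p + q * q"
    by (simp_all add: c_def c'_def algebra_simps)
  have bound: "cs_norm A (poly_act k b z) \<le> sqrt C * cs_norm A z"
    if b: "conj_poly b * b = p * p + q * q" and z: "z \<in> carrier A" for b z
  proof -
    have "(cs_norm A (poly_act k b z))\<^sup>2 =
        cs_norm A (poly_act k b z \<otimes> cs_star A (poly_act k b z))"
      using z by (simp add: cstar_identity')
    also have "\<dots> = cs_norm A (poly_act k (conj_poly b * b) z \<otimes> cs_star A z)"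
      using z by (simp add: mult_star_poly_act sa)
    also have "\<dots> \<le> cs_norm A (poly_act k (conj_poly b * b) z) * cs_norm A z"
      using z local.norm_mult[of "poly_act k (conj_poly b * b) z" "cs_star A z"] by simp
    also have "\<dots> \<le> (C * cs_norm A z) * cs_norm A z"
      unfolding b using z C norm_nonneg[OF z] by (intro mult_right_mono) (auto simp: poly_bound_def)
    also have "\<dots> = (sqrt C * cs_norm A z)\<^sup>2"
      using C0 by (simp add: power_mult_distrib power2_eq_square)
    finally show ?thesis
      by (rule power2_le_imp_le) (use C0 norm_nonneg[OF z] in simp)
  qed
  have p_eq: "p = Polynomial.smult (1/2) (c + c')"
  proof (rule poly_eqI)
    fix n
    have "poly.coeff (c + c') n = 2 * poly.coeff p n"
      unfolding c_def c'_def coeff_add coeff_diff coeff_smult by simp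
    then show "poly.coeff p n = poly.coeff (Polynomial.smult (1/2) (c + c')) n"
      unfolding coeff_smult by (simp only:) simp
  qed
  have 1: "cs_norm A (poly_act k p z) \<le> sqrt C * cs_norm A z" if z: "z \<in> carrier A" for z
  proof -
    have "cs_norm A (poly_act k p z) = 1/2 * cs_norm A (poly_act k c z \<oplus> poly_act k c' z)"
      using z by (subst p_eq) (simp add: local.norm_smult del: scale_right_distrib)
    also have "\<dots> \<le> 1/2 * (cs_norm A (poly_act k c z) + cs_norm A (poly_act k c' z))"
      using z by (intro mult_left_mono norm_triangle) auto
    also have "\<dots> \<le> 1/2 * (sqrt C * cs_norm A z + sqrt C * cs_norm A z)"
      using z by (intro mult_left_mono add_mono bound) (auto simp: cc prod)
    finally show ?thesis by simp
  qed
  have real0: "Im (poly r 0) = 0" if "conj_poly r = r" for r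
    using that coeff_conj_poly[of r 0] by (simp add: poly_0_coeff_0 complex_eq_iff)
  obtain a b where ab: "poly p 0 = complex_of_real a" "poly q 0 = complex_of_real b"
    using real0[OF p] real0[OF q] by (metis complex_is_Real_iff Reals_cases)
  have "cmod (poly p 0) \<le> sqrt C"
  proof -
    have "cmod (complex_of_real (a * a + b * b)) \<le> C"
      using C by (simp add: poly_bound_def ab)
    then have "a\<^sup>2 \<le> C"
      unfolding norm_of_real by (simp add: power2_eq_square)
        (smt (verit) zero_le_square)
    then show ?thesis
      by (simp add: ab real_le_rsqrt)
  qed
  with 1 C0 show ?thesis by (simp add: poly_bound_def)
qed

text \<open>
  If \<open>g\<close> is an approximate inverse of \<open>h = d + X\<^sup>2\<close>, then \<open>a = d g\<close> and \<open>b = sqrt d X g\<close> satisfy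
  \<open>a\<^sup>2 + b\<^sup>2 = a (h g)\<close>, which is almost \<open>a\<close>. So \<open>\<parallel>a\<parallel>\<^sup>2\<close> and \<open>\<parallel>b\<parallel>\<^sup>2\<close> are both at most about \<open>\<parallel>a\<parallel>\<close>, whence
  both norms are at most about \<open>1\<close>: the estimates that functional calculus would give for the resolvent.
\<close>

lemma approx_resolvent_bounds:
  fixes d \<eta> :: real
  defines "h \<equiv> [:complex_of_real d, 0, 1:]"
  assumes d: "d > 0" and g: "conj_poly g = g" and bd: "poly_bound k (1 - h * g) \<eta>"
  shows "poly_bound k (Polynomial.smult d g) (1 + \<eta>)"
    and "poly_bound k ([:0, 1:] * g) ((1 + \<eta>) / sqrt d)"
proof -
  have \<eta>: "\<eta> \<ge> 0" using bd by (simp add: poly_bound_def)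
  define a where "a = Polynomial.smult (complex_of_real d) g"
  define b where "b = Polynomial.smult (complex_of_real (sqrt d)) ([:0, 1:] * g)"
  have sqrt: "complex_of_real (sqrt d) * complex_of_real (sqrt d) = complex_of_real d"
    using d by (simp flip: of_real_mult)
  have h: "h = [:complex_of_real d:] + [:0,1:] * [:0,1:]"
    by (simp add: h_def)
  have "a * a + b * b = a * (h * g)"
  proof -
    have "a * a = a * ([:complex_of_real d:] * g)"
      by (simp add: a_def)
    moreover have "b * b = Polynomial.smult (complex_of_real d) ([:0, 1:] * g * ([:0, 1:] * g))"
      unfolding b_def using sqrt by (simp only: mult_smult_left mult_smult_right smult_smult)
    then have "b * b = a * ([:0, 1:] * [:0, 1:] * g)"
      unfolding a_def mult_smult_left by (simp only: mult_ac)
    ultimately show ?thesis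
      unfolding h by (simp only: distrib_left distrib_right)
  qed
  moreover have hg: "poly_bound k (h * g) (1 + \<eta>)"
    using poly_bound_add[OF poly_bound_1 poly_bound_smult[OF bd, of "-1"]] by simp
  ultimately have sum: "poly_bound k (a * a + b * b) (C * (1 + \<eta>))" if "poly_bound k a C" for C
    using poly_bound_mult[OF that hg] by simp
  have real: "conj_poly a = a" "conj_poly b = b"
    by (simp_all add: a_def b_def g)
  obtain C where C: "poly_bound k a C" "\<And>D. poly_bound k a D \<Longrightarrow> C \<le> D"
    using poly_bound_least[of a] by blast
  have C0: "C \<ge> 0" using C(1) by (simp add: poly_bound_def)
  have "C \<le> sqrt (C * (1 + \<eta>))"
    by (intro C(2) poly_bound_sqrt[OF real] sum C(1))
  from power_mono[OF this C0, of 2] have "C * C \<le> C * (1 + \<eta>)"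
    using C0 \<eta> by (simp add: power2_eq_square[of C])
  then have "C \<le> 1 + \<eta>"
    using C0 \<eta> by (cases "C = 0") auto
  then have a: "poly_bound k a (1 + \<eta>)"
    using C(1) poly_bound_mono by blast
  then show "poly_bound k (Polynomial.smult d g) (1 + \<eta>)"
    by (simp add: a_def)
  have "poly_bound k b (sqrt ((1 + \<eta>) * (1 + \<eta>)))"
    using sum[OF a] by (intro poly_bound_sqrt[OF real(2,1)]) (simp add: add.commute)
  then have "poly_bound k b (1 + \<eta>)"
    using \<eta> by (simp add: real_sqrt_mult_self)
  then have "poly_bound k (Polynomial.smult (complex_of_real (1 / sqrt d)) b)
      (cmod (complex_of_real (1 / sqrt d)) * (1 + \<eta>))"
    by (rule poly_bound_smult)
  moreover have "Polynomial.smult (complex_of_real (1 / sqrt d)) b = [:0, 1:] * g"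
    using d unfolding b_def smult_smult by (simp flip: of_real_mult)
  moreover have "cmod (complex_of_real (1 / sqrt d)) * (1 + \<eta>) = (1 + \<eta>) / sqrt d"
    using d by (simp add: norm_divide)
  ultimately show "poly_bound k ([:0, 1:] * g) ((1 + \<eta>) / sqrt d)"
    by simp
qed

text \<open>
  The powers of the error term \<open>1 - h g\<close> are again of the form \<open>1 - h g'\<close>.
\<close>

lemma improve_approx_inverse:
  assumes h: "conj_poly h = h" and g: "conj_poly g = g"
    and bd: "poly_bound k (1 - h * g) q" "q < 1" and \<eta>: "\<eta> > 0"
  shows "\<exists>g'. conj_poly g' = g' \<and> poly_bound k (1 - h * g') \<eta>"
proof -
  have "\<exists>g'. conj_poly g' = g' \<and> (1 - h * g) ^ n = 1 - h * g'" for n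
  proof (induction n)
    case 0
    then show ?case by (intro exI[of _ 0]) simp
  next
    case (Suc n)
    then obtain g' where g': "conj_poly g' = g'" "(1 - h * g) ^ n = 1 - h * g'" by blast
    show ?case
      unfolding power_Suc g'(2)
      using g' by (intro exI[of _ "g + g' - g * h * g'"]) (simp add: g h algebra_simps)
  qed
  moreover obtain n where n: "q ^ n < \<eta>"
    using real_arch_pow_inv[OF \<eta> bd(2)] by blast
  ultimately obtain g' where "conj_poly g' = g'" "(1 - h * g) ^ n = 1 - h * g'" by blast
  then show ?thesis
    using poly_bound_mono[OF poly_bound_power[OF bd(1), of n], of \<eta>] n by (intro exI[of _ g']) simp
qed

text \<open>
  For large \<open>d\<close>, the constant \<open>1/d\<close> is an approximate inverse of \<open>d + X\<^sup>2\<close>. From \<open>d\<close> one can pass to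
  \<open>d/2\<close>: the old approximate inverse \<open>g\<close> has error at most \<open>1/4 + \<parallel>(d/2) g\<parallel>\<close> for the new polynomial, which
  is less than \<open>1\<close> by the resolvent estimate, and any error less than \<open>1\<close> can be improved. In this way
  arbitrarily small \<open>d\<close> are reached without inverting anything.
\<close>

lemma approx_resolvent_exists:
  fixes n :: nat and \<eta> :: real
  defines "D \<equiv> 2 * (cs_norm A k)\<^sup>2 + 1"
  assumes "\<eta> > 0"
  shows "\<exists>g. conj_poly g = g \<and> poly_bound k (1 - [:complex_of_real (D / 2 ^ n), 0, 1:] * g) \<eta>"
  using assms(2)
proof (induction n arbitrary: \<eta>)
  case 0
  have D: "D > 0" by (simp add: D_def add_nonneg_pos)
  define h where "h = [:complex_of_real D, 0, 1:]"
  define g where "g = [:complex_of_real (1 / D):]"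
  have "1 - h * g = Polynomial.smult (complex_of_real (- 1 / D)) ([:0, 1:] * [:0, 1:])"
    using D by (simp add: h_def g_def one_pCons flip: of_real_mult)
  moreover have "poly_bound k (Polynomial.smult (complex_of_real (- 1 / D)) ([:0, 1:] * [:0, 1:]))
      (cmod (complex_of_real (- 1 / D)) * (cs_norm A k * cs_norm A k))"
    by (intro poly_bound_smult poly_bound_mult poly_bound_X)
  moreover have "cmod (complex_of_real (- 1 / D)) * (cs_norm A k * cs_norm A k) < 1"
    unfolding norm_of_real using D
    by (simp add: power2_eq_square[symmetric]) (simp add: D_def add_nonneg_pos)
  ultimately have "\<exists>g'. conj_poly g' = g' \<and> poly_bound k (1 - h * g') \<eta>"
    using 0 by (intro improve_approx_inverse[of h g]) (auto simp: h_def g_def)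
  then show ?case
    by (simp add: h_def)
next
  case (Suc n)
  define d where "d = D / 2 ^ n"
  have d: "d > 0" by (simp add: d_def D_def add_nonneg_pos)
  obtain g where g: "conj_poly g = g"
      "poly_bound k (1 - [:complex_of_real d, 0, 1:] * g) (1/4)"
    using Suc.IH[of "1/4"] by (auto simp: d_def)
  have "poly_bound k (Polynomial.smult (1/2) (Polynomial.smult (complex_of_real d) g))
      (cmod (1/2) * (1 + 1/4))"
    by (intro poly_bound_smult approx_resolvent_bounds(1) d g)
  then have "poly_bound k (1 - [:complex_of_real d, 0, 1:] * g +
        Polynomial.smult (1/2) (Polynomial.smult (complex_of_real d) g)) (1/4 + cmod (1/2) * (1 + 1/4))"
    by (intro poly_bound_add g)
  moreover have "1 - [:complex_of_real d, 0, 1:] * g +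
        Polynomial.smult (1/2) (Polynomial.smult (complex_of_real d) g) =
      1 - [:complex_of_real (d / 2), 0, 1:] * g"
    by (rule poly_eqI) (simp add: algebra_simps)
  ultimately have "poly_bound k (1 - [:complex_of_real (d / 2), 0, 1:] * g)
      (1/4 + cmod (1/2) * (1 + 1/4))"
    by (simp only:)
  then have "\<exists>g'. conj_poly g' = g' \<and> poly_bound k (1 - [:complex_of_real (d / 2), 0, 1:] * g') \<eta>"
    by (rule improve_approx_inverse[rotated 2]) (use g(1) Suc.prems in simp_all)
  moreover have "d / 2 = D / 2 ^ Suc n"
    by (simp add: d_def)
  ultimately show ?case
    by simp
qed

text \<open>
  The polynomial \<open>u = 1 - X q\<close> is the approximation of \<open>d/(d + X\<^sup>2)\<close>, rescaled to constant term \<open>1\<close>.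
  Its norm is at most about \<open>1\<close> and the norm of \<open>X u\<close> is at most about \<open>sqrt d\<close>, so that \<open>k q(k)\<close> acts on \<open>k\<close>
  almost as a unit.
\<close>

lemma approx_unit_poly:
  assumes \<epsilon>: "\<epsilon> > 0"
  obtains q where "conj_poly q = q" "poly_bound k (1 - [:0, 1:] * q) (1 + \<epsilon>)"
    "poly_bound k ([:0, 1:] * (1 - [:0, 1:] * q)) \<epsilon>"
proof -
  define D where "D = 2 * (cs_norm A k)\<^sup>2 + 1"
  have D: "D > 0" by (simp add: D_def add_nonneg_pos)
  define \<eta> where "\<eta> = min (1/3) (\<epsilon>/3)"
  have \<eta>: "\<eta> > 0" "\<eta> \<le> 1/3" "3 * \<eta> \<le> \<epsilon>" using \<epsilon> by (auto simp: \<eta>_def)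
  have frac: "(1 + \<eta>) / (1 - \<eta>) \<le> 1 + 3 * \<eta>"
  proof -
    have "1 + \<eta> \<le> (1 + 3 * \<eta>) * (1 - \<eta>)"
      using \<eta> mult_nonneg_nonneg[of \<eta> "1 - 3 * \<eta>"] by (simp add: algebra_simps)
    then show ?thesis using \<eta> by (simp add: divide_le_eq)
  qed
  obtain n :: nat where n: "(1/2) ^ n < (\<epsilon>/2)\<^sup>2 / D"
    using real_arch_pow_inv[of "(\<epsilon>/2)\<^sup>2 / D" "1/2"] \<epsilon> D by auto
  define d where "d = D / 2 ^ n"
  have d: "d > 0" "sqrt d \<le> \<epsilon> / 2"
  proof -
    show "d > 0" using D by (simp add: d_def)
    have "d \<le> (\<epsilon>/2)\<^sup>2"
      using n D by (simp add: d_def field_simps)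
    then show "sqrt d \<le> \<epsilon> / 2"
      using real_sqrt_le_mono[of d "(\<epsilon>/2)\<^sup>2"] \<epsilon> by (simp only: real_sqrt_abs) simp
  qed
  obtain g where g: "conj_poly g = g"
      "poly_bound k (1 - [:complex_of_real d, 0, 1:] * g) \<eta>"
    using approx_resolvent_exists[OF \<eta>(1), of n] by (auto simp: d_def D_def)
  define a where "a = Polynomial.smult (complex_of_real d) g"
  define a0 where "a0 = poly a 0"
  have a: "poly_bound k a (1 + \<eta>)"
    unfolding a_def by (rule approx_resolvent_bounds(1)[OF d(1) g])
  have "poly_bound k (Polynomial.smult (complex_of_real d) ([:0, 1:] * g))
      (cmod (complex_of_real d) * ((1 + \<eta>) / sqrt d))"
    by (rule poly_bound_smult[OF approx_resolvent_bounds(2)[OF d(1) g]])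
  moreover have "cmod (complex_of_real d) * ((1 + \<eta>) / sqrt d) = sqrt d * (1 + \<eta>)"
    using d(1) by (simp add: field_simps)
  ultimately have Xa: "poly_bound k ([:0, 1:] * a) (sqrt d * (1 + \<eta>))"
    unfolding a_def by (simp only: mult_smult_right)
  have "cmod (1 - a0) \<le> \<eta>"
    using g(2) by (simp add: poly_bound_def a0_def a_def)
  then have a0: "1 - \<eta> \<le> cmod a0"
    using norm_triangle_ineq2[of 1 "1 - a0"] by simp
  then have "a0 \<noteq> 0" using \<eta> by auto
  have real_a0: "cnj a0 = a0"
    using g(1) coeff_conj_poly[of g 0] by (simp add: a0_def a_def poly_0_coeff_0)
  have inv: "cmod (1 / a0) \<le> 1 / (1 - \<eta>)"
    using a0 \<eta> by (simp add: norm_divide frac_le)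
  define u where "u = Polynomial.smult (1 / a0) a"
  have "poly_bound k u (cmod (1 / a0) * (1 + \<eta>))"
    unfolding u_def by (rule poly_bound_smult[OF a])
  moreover have "cmod (1 / a0) * (1 + \<eta>) \<le> 1 + \<epsilon>"
    using mult_right_mono[OF inv, of "1 + \<eta>"] frac \<eta> by simp
  ultimately have u: "poly_bound k u (1 + \<epsilon>)"
    using poly_bound_mono by blast
  have "poly_bound k (Polynomial.smult (1 / a0) ([:0, 1:] * a)) (cmod (1 / a0) * (sqrt d * (1 + \<eta>)))"
    by (rule poly_bound_smult[OF Xa])
  moreover have "cmod (1 / a0) * (sqrt d * (1 + \<eta>)) \<le> \<epsilon>"
  proof -
    have "cmod (1 / a0) * (sqrt d * (1 + \<eta>)) = sqrt d * (cmod (1 / a0) * (1 + \<eta>))"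
      by simp
    also have "\<dots> \<le> (\<epsilon> / 2) * (1 + 3 * \<eta>)"
      using mult_right_mono[OF inv, of "1 + \<eta>"] frac \<eta> d \<epsilon> by (intro mult_mono) auto
    also have "\<dots> \<le> (\<epsilon> / 2) * 2"
      using \<eta> \<epsilon> by (intro mult_left_mono) auto
    finally show ?thesis by simp
  qed
  ultimately have "poly_bound k (Polynomial.smult (1 / a0) ([:0, 1:] * a)) \<epsilon>"
    using poly_bound_mono by blast
  then have Xu: "poly_bound k ([:0, 1:] * u) \<epsilon>"
    unfolding u_def by (simp only: mult_smult_right)
  obtain c r where cr: "u = pCons c r" by (cases u)
  have "c = 1"
    using \<open>a0 \<noteq> 0\<close> arg_cong[OF cr, of "\<lambda>p. poly p 0"] by (simp add: u_def a0_def)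
  then have u_eq: "u = 1 - [:0, 1:] * (- r)"
    by (simp add: cr one_pCons)
  have "conj_poly u = u"
    by (simp add: u_def a_def g(1) real_a0)
  then have "conj_poly (- r) = - r"
    by (simp add: cr)
  with u Xu show thesis
    using that unfolding u_eq by blast
qed

end
end

section \<open>Approximate units\<close>

text \<open>
  The element \<open>e\<close> is \<open>k q(k)\<close> for \<open>k = y* y\<close>, so that right multiplication by \<open>1 - e\<close> is the action of
  the polynomial \<open>u\<close> above. Both the C*-identity for \<open>y - y e\<close> and the one for \<open>v = k - k e\<close> reduce to the
  bounds of \<open>u\<close> and of \<open>X u\<close>.
\<close>

lemma approximate_unit:
  assumes I: "alg_ideal A I" and y: "y \<in> I" and \<epsilon>: "\<epsilon> > 0"
  obtains e where "e \<in> I" "cs_star A e = e" "cs_norm A (y \<ominus> y \<otimes> e) < \<epsilon>"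
    "\<And>z. z \<in> carrier A \<Longrightarrow> cs_norm A (z \<ominus> z \<otimes> e) \<le> (1 + \<epsilon>) * cs_norm A z"
proof -
  define k where "k = cs_star A y \<otimes> y"
  have yc [simp]: "y \<in> carrier A" and kI: "k \<in> I" and k [simp]: "k \<in> carrier A"
    and sa: "cs_star A k = k"
    using y I by (auto simp: k_def alg_ideal_def)
  define \<delta> where "\<delta> = min (min 1 \<epsilon>) (\<epsilon>\<^sup>2 / 3)"
  have \<delta>: "\<delta> > 0" "\<delta> \<le> 1" "\<delta> \<le> \<epsilon>" "\<delta> \<le> \<epsilon>\<^sup>2 / 3"
    using \<epsilon> by (auto simp: \<delta>_def)
  obtain q where q: "conj_poly q = q" "poly_bound k (1 - [:0, 1:] * q) (1 + \<delta>)"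
    "poly_bound k ([:0, 1:] * (1 - [:0, 1:] * q)) \<delta>"
    using approx_unit_poly[OF k sa \<delta>(1)] by blast
  define u where "u = 1 - [:0, 1:] * q"
  have u: "conj_poly u = u" by (simp add: u_def q)
  define e where "e = poly_act k q k"
  have ec [simp]: "e \<in> carrier A" by (simp add: e_def)
  have u_act: "poly_act k u z = z \<ominus> z \<otimes> e" if z: "z \<in> carrier A" for z
    using z by (simp add: u_def e_def mult_poly_act poly_act_mult_right)
  have "poly_act k p k \<in> I" for p
    by (induction p) (use I kI in \<open>auto simp: alg_ideal_def\<close>)
  then have eI: "e \<in> I" by (simp add: e_def)
  have comm: "k \<otimes> poly_act k p k = poly_act k p k \<otimes> k" for p
    by (simp add: mult_poly_act poly_act_mult_right)
  have "cs_star A (poly_act k p k) = poly_act k (conj_poly p) k" for p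
    by (induction p) (simp_all add: sa comm[symmetric] flip: comm)
  then have se: "cs_star A e = e" by (simp add: e_def q)
  define v where "v = poly_act k u k"
  have v [simp]: "v \<in> carrier A" by (simp add: v_def)
  have sv: "cs_star A v = v"
    using comm[of q] by (simp add: v_def u_act sa se e_def[symmetric])
  have "(cs_norm A v)\<^sup>2 \<le> \<delta> * cs_norm A v"
  proof -
    have "(cs_norm A v)\<^sup>2 = cs_norm A (v \<otimes> v)"
      using cstar_identity[of v] by (simp add: sv)
    also have "v \<otimes> v = poly_act k ([:0, 1:] * u) v"
    proof -
      have "v \<otimes> v = v \<otimes> poly_act k u k" by (simp add: v_def)
      also have "\<dots> = poly_act k u v \<otimes> k"
        by (simp add: mult_poly_act poly_act_mult_right)
      finally show ?thesis by simp
    qed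
    also have "cs_norm A \<dots> \<le> \<delta> * cs_norm A v"
      using q(3) v unfolding poly_bound_def u_def by blast
    finally show ?thesis .
  qed
  then have Nv: "cs_norm A v \<le> \<delta>"
    using norm_nonneg[OF v] \<delta>(1) by (cases "cs_norm A v = 0") (auto simp: power2_eq_square)
  have "(cs_norm A (y \<ominus> y \<otimes> e))\<^sup>2 = cs_norm A (cs_star A (y \<ominus> y \<otimes> e) \<otimes> poly_act k u y)"
    using cstar_identity[of "y \<ominus> y \<otimes> e"] by (simp add: u_act)
  also have "cs_star A (y \<ominus> y \<otimes> e) \<otimes> poly_act k u y = poly_act k u v"
  proof -
    have "cs_star A (y \<ominus> y \<otimes> e) \<otimes> y = k \<ominus> e \<otimes> k"
      by (simp add: mult_diff se k_def mult_assoc)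
    also have "\<dots> = v"
      using comm[of q] by (simp add: v_def u_act e_def[symmetric])
    finally show ?thesis
      by (simp add: mult_poly_act)
  qed
  also have "cs_norm A (poly_act k u v) \<le> (1 + \<delta>) * cs_norm A v"
    using q(2) v unfolding poly_bound_def u_def by blast
  also have "\<dots> \<le> 2 * \<delta>"
    using Nv \<delta> norm_nonneg[OF v] by (intro mult_mono) auto
  also have "\<dots> < \<epsilon>\<^sup>2"
    using \<delta>(4) zero_less_power[OF \<epsilon>, of 2] by linarith
  finally have Ny: "cs_norm A (y \<ominus> y \<otimes> e) < \<epsilon>"
    using \<epsilon> by (simp add: power_less_imp_less_base)
  have "cs_norm A (z \<ominus> z \<otimes> e) \<le> (1 + \<epsilon>) * cs_norm A z" if z: "z \<in> carrier A" for z
  proof -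
    have "cs_norm A (z \<ominus> z \<otimes> e) \<le> (1 + \<delta>) * cs_norm A z"
      using q(2) z unfolding poly_bound_def u_def[symmetric] by (simp add: u_act)
    also have "\<dots> \<le> (1 + \<epsilon>) * cs_norm A z"
      using \<delta> norm_nonneg[OF z] by (intro mult_right_mono) auto
    finally show ?thesis .
  qed
  then show thesis
    using that eI se Ny by blast
qed


section \<open>Closed ideals\<close>

lemma alg_idealD:
  assumes "alg_ideal A I"
  shows "\<And>x. x \<in> I \<Longrightarrow> x \<in> carrier A" "\<zero> \<in> I"
    and "\<And>x y. x \<in> I \<Longrightarrow> y \<in> I \<Longrightarrow> x \<oplus> y \<in> I"
    and "\<And>c x. x \<in> I \<Longrightarrow> c \<odot> x \<in> I"
    and "\<And>x a. x \<in> I \<Longrightarrow> a \<in> carrier A \<Longrightarrow> a \<otimes> x \<in> I"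
    and "\<And>x a. x \<in> I \<Longrightarrow> a \<in> carrier A \<Longrightarrow> x \<otimes> a \<in> I"
    and "\<And>x y. x \<in> I \<Longrightarrow> y \<in> I \<Longrightarrow> x \<ominus> y \<in> I"
    and "\<And>x. x \<in> I \<Longrightarrow> \<ominus> x \<in> I"
  using assms by (auto simp: alg_ideal_def diff_eq_scale minus_eq_scale subset_iff)

lemma submodule_iff:
  "submodule I (ring_of_type_algebra :: complex ring) A \<longleftrightarrow>
    I \<subseteq> carrier A \<and> \<zero> \<in> I \<and> (\<forall>x\<in>I. \<forall>y\<in>I. x \<oplus> y \<in> I) \<and> (\<forall>x\<in>I. \<forall>c. c \<odot> x \<in> I)"
    (is "?L \<longleftrightarrow> ?R")
proof
  assume L: ?L
  note E = submoduleE[OF L]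
  have "x \<oplus> y \<in> I" "c \<odot> x \<in> I" if "x \<in> I" "y \<in> I" for x y c
    using E(4)[of c x] E(5)[of x y] that by (simp_all add: ring_of_type_algebra_simps)
  moreover have "\<zero> \<in> I"
  proof -
    obtain x where "x \<in> I" using E(2) by blast
    then show ?thesis
      using E(1,3) E(5)[of x "\<ominus> x"] by (auto simp: r_neg)
  qed
  ultimately show ?R using E(1) by blast
next
  assume ?R
  then show ?L
    by (intro submoduleI) (auto simp: minus_eq_scale subset_iff)
qed

lemma in_ideals_iff:
  "I \<in> ideals A \<longleftrightarrow> alg_ideal A I \<and>
    (\<forall>x\<in>carrier A. (\<forall>e>0. \<exists>y\<in>I. cs_norm A (x \<ominus> y) < e) \<longrightarrow> x \<in> I)"
  unfolding ideals_def closedin_iff alg_ideal_def submodule_iff mem_Collect_eq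
  by (rule iffI; elim conjE; intro conjI; assumption)

lemma ideal_alg_ideal: "I \<in> ideals A \<Longrightarrow> alg_ideal A I"
  by (simp add: in_ideals_iff)

lemma ideal_limit:
  assumes "I \<in> ideals A" "x \<in> carrier A" "\<And>e. e > 0 \<Longrightarrow> \<exists>y\<in>I. cs_norm A (x \<ominus> y) < e"
  shows "x \<in> I"
  using assms by (auto simp: in_ideals_iff)

lemma ideal_subset: "I \<in> ideals A \<Longrightarrow> I \<subseteq> carrier A"
  using ideal_alg_ideal by (auto simp: alg_ideal_def)

lemmas idealD = alg_idealD[OF ideal_alg_ideal]

lemma zero_ideal: "{\<zero>} \<in> ideals A"
proof -
  have "x = \<zero>" if "x \<in> carrier A" "\<forall>e>0. cs_norm A x < e" for x
    using that by (intro eqI_norm[of x \<zero> 1]) (auto intro: less_imp_le)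
  then show ?thesis
    by (auto simp: in_ideals_iff alg_ideal_def)
qed

lemma carrier_ideal: "carrier A \<in> ideals A"
  by (auto simp: in_ideals_iff alg_ideal_def)

lemma inter_ideal:
  assumes "I \<in> ideals A" "J \<in> ideals A"
  shows "I \<inter> J \<in> ideals A"
proof -
  have "alg_ideal A (I \<inter> J)"
    using idealD[OF assms(1)] idealD[OF assms(2)] by (auto simp: alg_ideal_def)
  moreover have "x \<in> I \<inter> J"
    if "x \<in> carrier A" "\<forall>e>0. \<exists>y\<in>I \<inter> J. cs_norm A (x \<ominus> y) < e" for x
    using that by (intro IntI ideal_limit[OF assms(1)] ideal_limit[OF assms(2)]) (meson IntD1 IntD2)+
  ultimately show ?thesis
    by (simp add: in_ideals_iff)
qed

lemma closure_of_subset_ideal: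
  assumes "S \<subseteq> I" "I \<in> ideals A"
  shows "cs_topology A closure_of S \<subseteq> I"
proof
  fix x assume "x \<in> cs_topology A closure_of S"
  then have "x \<in> carrier A" "\<forall>e>0. \<exists>y\<in>S. cs_norm A (x \<ominus> y) < e"
    using in_closure_of_iff[of S] assms(1) ideal_subset[OF assms(2)] by auto
  then show "x \<in> I"
    using assms(1) by (intro ideal_limit[OF assms(2)]) (meson subsetD)+
qed

lemma closure_of_alg_ideal:
  assumes I: "alg_ideal A I"
  shows "cs_topology A closure_of I \<in> ideals A"
proof -
  note D = alg_idealD[OF I]
  let ?K = "cs_topology A closure_of I"
  have sub: "I \<subseteq> carrier A" using D by blast
  have K: "x \<in> ?K \<longleftrightarrow> x \<in> carrier A \<and> (\<forall>e>0. \<exists>y\<in>I. cs_norm A (x \<ominus> y) < e)" for x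
    by (rule in_closure_of_iff[OF sub])
  have incl: "I \<subseteq> ?K"
    by (rule closure_of_subset) (simp add: sub)
  have add: "x \<oplus> y \<in> ?K" if xy: "x \<in> ?K" "y \<in> ?K" for x y
    unfolding K
  proof (intro conjI allI impI)
    show "x \<oplus> y \<in> carrier A" using xy by (simp add: K)
    fix e :: real assume "e > 0"
    then obtain x' y' where x'y': "x' \<in> I" "y' \<in> I"
      "cs_norm A (x \<ominus> x') < e/2" "cs_norm A (y \<ominus> y') < e/2"
      using xy unfolding K by (meson half_gt_zero)
    have "cs_norm A ((x \<oplus> y) \<ominus> (x' \<oplus> y')) \<le> cs_norm A (x \<ominus> x') + cs_norm A (y \<ominus> y')"
      using xy x'y' by (intro norm_add_diff_add) (auto simp: K D)
    then show "\<exists>z\<in>I. cs_norm A (x \<oplus> y \<ominus> z) < e"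
      using x'y' D(3) by (intro bexI[of _ "x' \<oplus> y'"]) auto
  qed
  \<comment> \<open>The remaining closure properties are instances of one Lipschitz argument.\<close>
  have lip: "f x \<in> ?K"
    if f: "\<And>y. y \<in> carrier A \<Longrightarrow> f y \<in> carrier A" "\<And>y. y \<in> I \<Longrightarrow> f y \<in> I"
      "\<And>y z. y \<in> carrier A \<Longrightarrow> z \<in> carrier A \<Longrightarrow> cs_norm A (f y \<ominus> f z) \<le> C * cs_norm A (y \<ominus> z)"
      and x: "x \<in> ?K" and C: "C > 0" for f x C
    unfolding K
  proof (intro conjI allI impI)
    show "f x \<in> carrier A" using x f by (simp add: K)
    fix e :: real assume "e > 0"
    then have "e / C > 0" using C by simp
    then obtain y where y: "y \<in> I" "cs_norm A (x \<ominus> y) < e / C"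
      using x unfolding K by meson
    have "cs_norm A (f x \<ominus> f y) \<le> C * cs_norm A (x \<ominus> y)"
      using x y D(1) by (intro f) (auto simp: K)
    also have "\<dots> < C * (e / C)"
      using y C by (intro mult_strict_left_mono)
    finally show "\<exists>z\<in>I. cs_norm A (f x \<ominus> z) < e"
      using f(2) y C by auto
  qed
  have scale: "c \<odot> x \<in> ?K" if "x \<in> ?K" for c x
  proof (rule lip[of "\<lambda>x. c \<odot> x" "cmod c + 1" x, OF _ _ _ that])
    show "cs_norm A (c \<odot> y \<ominus> c \<odot> z) \<le> (cmod c + 1) * cs_norm A (y \<ominus> z)"
      if "y \<in> carrier A" "z \<in> carrier A" for y z
      using that norm_nonneg[of "y \<ominus> z"] by (simp add: scale_diff[symmetric] norm_smult distrib_right)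
  qed (use D in \<open>auto simp: add_nonneg_pos\<close>)
  have mult: "a \<otimes> x \<in> ?K" "x \<otimes> a \<in> ?K" if "x \<in> ?K" and a: "a \<in> carrier A" for a x
  proof -
    have le: "cs_norm A a * t \<le> (cs_norm A a + 1) * t" if "t \<ge> 0" for t
      using that by (simp add: distrib_right)
    show "a \<otimes> x \<in> ?K"
    proof (rule lip[of "\<lambda>x. a \<otimes> x" "cs_norm A a + 1" x, OF _ _ _ that(1)])
      show "cs_norm A (a \<otimes> y \<ominus> a \<otimes> z) \<le> (cs_norm A a + 1) * cs_norm A (y \<ominus> z)"
        if "y \<in> carrier A" "z \<in> carrier A" for y z
        using that a le[of "cs_norm A (y \<ominus> z)"] norm_mult[of a "y \<ominus> z"] norm_nonneg[of "y \<ominus> z"]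
        by (simp add: mult_diff)
    qed (use D a norm_nonneg[OF a] in auto)
    show "x \<otimes> a \<in> ?K"
    proof (rule lip[of "\<lambda>x. x \<otimes> a" "cs_norm A a + 1" x, OF _ _ _ that(1)])
      show "cs_norm A (y \<otimes> a \<ominus> z \<otimes> a) \<le> (cs_norm A a + 1) * cs_norm A (y \<ominus> z)"
        if "y \<in> carrier A" "z \<in> carrier A" for y z
        using that a le[of "cs_norm A (y \<ominus> z)"] norm_mult[of "y \<ominus> z" a] norm_nonneg[of "y \<ominus> z"]
        by (simp add: mult_diff mult.commute)
    qed (use D a norm_nonneg[OF a] in auto)
  qed
  have "alg_ideal A ?K"
    using K D(2) incl add scale mult by (auto simp: alg_ideal_def)
  moreover have "x \<in> ?K" if x: "x \<in> carrier A" "\<forall>e>0. \<exists>y\<in>?K. cs_norm A (x \<ominus> y) < e" for x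
  proof -
    have "x \<in> cs_topology A closure_of ?K"
      using x K by (subst in_closure_of_iff) auto
    then show ?thesis by simp
  qed
  ultimately show ?thesis
    by (simp add: in_ideals_iff)
qed

text \<open>
  If \<open>x e\<close> is close to \<open>x\<close> with \<open>e = e*\<close> in the ideal, then \<open>x*\<close> is close to \<open>e x*\<close>, which is in
  the ideal.
\<close>

lemma ideal_star:
  assumes I: "I \<in> ideals A" and x: "x \<in> I"
  shows "cs_star A x \<in> I"
proof (rule ideal_limit[OF I])
  note D = idealD[OF I]
  show "cs_star A x \<in> carrier A" using D(1)[OF x] by simp
  fix \<epsilon> :: real assume "\<epsilon> > 0"
  then obtain e where e: "e \<in> I" "cs_star A e = e" "cs_norm A (x \<ominus> x \<otimes> e) < \<epsilon>"
    using approximate_unit[OF ideal_alg_ideal[OF I] x] by blast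
  have c: "x \<in> carrier A" "e \<in> carrier A"
    using D(1) x e(1) by blast+
  have "cs_norm A (cs_star A x \<ominus> e \<otimes> cs_star A x) < \<epsilon>"
    using norm_star[of "x \<ominus> x \<otimes> e"] c e(2,3) by simp
  moreover have "e \<otimes> cs_star A x \<in> I"
    by (rule D(6)) (simp_all add: c e(1))
  ultimately show "\<exists>y\<in>I. cs_norm A (cs_star A x \<ominus> y) < \<epsilon>"
    by blast
qed

text \<open>
  The additive inverse of a record is a description over its carrier, so it has to be compared with the
  inverse in the whole algebra.
\<close>

lemma minus_ideal_alg:
  assumes I: "I \<in> ideals A" and x: "x \<in> I" "y \<in> I"
  shows "x \<ominus>\<^bsub>ideal_alg A I\<^esub> y = x \<ominus> y"
proof -
  have "submodule I (ring_of_type_algebra :: complex ring) A"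
    using I by (simp add: ideals_def)
  then interpret B: module "ring_of_type_algebra :: complex ring" "ideal_alg A I"
    by (rule submodule.submodule_is_module) (rule module_axioms)
  have "\<ominus>\<^bsub>ideal_alg A I\<^esub> y = \<ominus> y"
    by (rule B.minus_equality) (use idealD(1,8)[OF I x(2)] x in \<open>simp_all add: l_neg\<close>)
  then show ?thesis
    using x by (simp add: a_minus_def)
qed

lemma ideal_alg_cstar:
  assumes I: "I \<in> ideals A"
  shows "cstar_algebra (ideal_alg A I)"
proof -
  let ?B = "ideal_alg A I"
  note D = idealD[OF I]
  have sub: "submodule I (ring_of_type_algebra :: complex ring) A"
    using I by (simp add: ideals_def)
  have module: "module (ring_of_type_algebra :: complex ring) ?B"
    by (rule submodule.submodule_is_module[OF sub module_axioms])
  have dist: "cs_dist ?B x y = cs_dist A x y" if "x \<in> I" "y \<in> I" for x y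
    using that by (simp add: cs_dist_def minus_ideal_alg[OF I] D)
  have metric: "Metric_space (carrier ?B) (cs_dist ?B)"
  proof
    show "0 \<le> cs_dist ?B x y" for x y
      using dist[of x y] by (cases "x \<in> I \<and> y \<in> I") (auto simp: cs_dist_def[of ?B])
    show "cs_dist ?B x y = cs_dist ?B y x" for x y
      using dist[of x y] dist[of y x] metr.commute[of x y]
      by (cases "x \<in> I \<and> y \<in> I") (auto simp: cs_dist_def[of ?B])
    show "cs_dist ?B x y = 0 \<longleftrightarrow> x = y" if "x \<in> carrier ?B" "y \<in> carrier ?B" for x y
      using that by (simp add: dist D)
    show "cs_dist ?B x z \<le> cs_dist ?B x y + cs_dist ?B y z"
      if "x \<in> carrier ?B" "y \<in> carrier ?B" "z \<in> carrier ?B" for x y z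
      using that by (simp add: dist D metr.triangle)
  qed
  have "Metric_space.mcomplete (carrier ?B) (cs_dist ?B)"
    unfolding mcomplete_cs_dist_iff[OF metric]
  proof (intro allI impI, elim conjE)
    fix s :: "nat \<Rightarrow> 'a"
    assume s: "\<forall>n. s n \<in> carrier ?B"
      and c: "\<forall>e>0. \<exists>N::nat. \<forall>m\<ge>N. \<forall>n\<ge>N. cs_norm ?B (s m \<ominus>\<^bsub>?B\<^esub> s n) < e"
    have sI: "s n \<in> I" for n using s by simp
    obtain x where x: "x \<in> carrier A" "\<And>e. e > 0 \<Longrightarrow> \<exists>N. \<forall>n\<ge>N. cs_norm A (s n \<ominus> x) < e"
      using cauchy_has_limit[of s] sI c D(1) by (auto simp: minus_ideal_alg[OF I])
    have "x \<in> I"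
    proof (rule ideal_limit[OF I x(1)])
      fix e :: real assume "e > 0"
      then obtain N where "\<forall>n\<ge>N. cs_norm A (s n \<ominus> x) < e" using x(2) by blast
      then have "cs_norm A (x \<ominus> s N) < e"
        using norm_diff_commute[of x "s N"] sI D(1) x(1) by simp
      then show "\<exists>y\<in>I. cs_norm A (x \<ominus> y) < e" using sI by blast
    qed
    then show "\<exists>x\<in>carrier ?B. \<forall>e>0. \<exists>N. \<forall>n\<ge>N. cs_norm ?B (s n \<ominus>\<^bsub>?B\<^esub> x) < e"
      using x(2) sI by (intro bexI[of _ x]) (auto simp: minus_ideal_alg[OF I])
  qed
  moreover have "x \<in> carrier A" "cs_star A x \<in> I" if "x \<in> carrier ?B" for x
    using that D(1) ideal_star[OF I] by simp_all
  moreover have "x \<otimes> y \<in> I" if "x \<in> carrier ?B" "y \<in> carrier ?B" for x y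
    using that D(1,5) by simp
  ultimately show ?thesis
    using module
    by (intro cstar_algebra.intro cstar_algebra_axioms.intro)
      (simp_all add: mult_assoc norm_nonneg norm_eq_zero norm_triangle norm_smult
        norm_mult cstar_identity)
qed

text \<open>
  If \<open>x \<in> K\<close> is close to \<open>x u\<close> with \<open>u \<in> K\<close>, then \<open>a x\<close> is close to \<open>(a x) u\<close>, a product of an
  element of \<open>J\<close> with an element of its ideal \<open>K\<close>. Multiplication from the right follows by taking
  adjoints.
\<close>

lemma ideal_of_ideal:
  assumes J: "J \<in> ideals A" and K: "K \<in> ideals (ideal_alg A J)"
  shows "K \<in> ideals A"
proof -
  interpret B: cstar_algebra "ideal_alg A J" by (rule ideal_alg_cstar[OF J])
  have KJ: "K \<subseteq> J" using B.ideal_subset[OF K] by simp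
  have JA: "J \<subseteq> carrier A" by (rule ideal_subset[OF J])
  have K_mult: "x \<otimes> y \<in> K" if "x \<in> J" "y \<in> K" for x y
    using B.idealD(5)[OF K, of y x] that by simp
  have lim: "x \<in> K" if x: "x \<in> carrier A" and e: "\<And>e. e > 0 \<Longrightarrow> \<exists>y\<in>K. cs_norm A (x \<ominus> y) < e" for x
  proof -
    have xJ: "x \<in> J"
    proof (rule ideal_limit[OF J x])
      fix d :: real assume "d > 0"
      then show "\<exists>y\<in>J. cs_norm A (x \<ominus> y) < d" using e[of d] KJ by auto
    qed
    show ?thesis
    proof (rule B.ideal_limit[OF K])
      fix d :: real assume "d > 0"
      then obtain y where y: "y \<in> K" "cs_norm A (x \<ominus> y) < d" using e[of d] by auto
      have "x \<ominus>\<^bsub>ideal_alg A J\<^esub> y = x \<ominus> y"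
        by (rule minus_ideal_alg[OF J xJ]) (use y KJ in auto)
      then show "\<exists>y\<in>K. cs_norm (ideal_alg A J) (x \<ominus>\<^bsub>ideal_alg A J\<^esub> y) < d"
        using y by (intro bexI[of _ y]) auto
    qed (simp add: xJ)
  qed
  have left: "a \<otimes> x \<in> K" if x: "x \<in> K" and a: "a \<in> carrier A" for a x
  proof (rule lim)
    have xJ: "x \<in> J" and xc: "x \<in> carrier A" using x KJ JA by auto
    show "a \<otimes> x \<in> carrier A" using xc a by simp
    fix e :: real assume e: "e > 0"
    define \<epsilon> where "\<epsilon> = e / (cs_norm A a + 1)"
    have N: "cs_norm A a + 1 > 0" using norm_nonneg[OF a] by simp
    then have "\<epsilon> > 0" using e by (simp add: \<epsilon>_def)
    then obtain u where u: "u \<in> K" "cs_norm (ideal_alg A J) (x \<ominus>\<^bsub>ideal_alg A J\<^esub> x \<otimes>\<^bsub>ideal_alg A J\<^esub> u) < \<epsilon>"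
      using B.approximate_unit[OF B.ideal_alg_ideal[OF K] x] by blast
    have uJ: "u \<in> J" and uc: "u \<in> carrier A" using u(1) KJ JA by auto
    have "x \<otimes> u \<in> J" by (rule idealD(5)[OF J uJ xc])
    then have u': "cs_norm A (x \<ominus> x \<otimes> u) < \<epsilon>"
      using u(2) by (simp add: minus_ideal_alg[OF J xJ])
    have "(a \<otimes> x) \<otimes> u \<in> K"
      by (rule K_mult[OF idealD(5)[OF J xJ a] u(1)])
    moreover have "cs_norm A (a \<otimes> x \<ominus> (a \<otimes> x) \<otimes> u) < e"
    proof -
      have "a \<otimes> x \<ominus> (a \<otimes> x) \<otimes> u = a \<otimes> (x \<ominus> x \<otimes> u)"
        using a xc uc by (simp add: mult_diff mult_assoc)
      also have "cs_norm A \<dots> \<le> cs_norm A a * cs_norm A (x \<ominus> x \<otimes> u)"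
        using a xc uc by (intro norm_mult) auto
      also have "\<dots> \<le> (cs_norm A a + 1) * cs_norm A (x \<ominus> x \<otimes> u)"
        using xc uc by (intro mult_right_mono norm_nonneg) auto
      also have "\<dots> < (cs_norm A a + 1) * \<epsilon>"
        using u' N by (intro mult_strict_left_mono)
      finally show ?thesis using N by (simp add: \<epsilon>_def)
    qed
    ultimately show "\<exists>y\<in>K. cs_norm A (a \<otimes> x \<ominus> y) < e" by blast
  qed
  have right: "x \<otimes> a \<in> K" if x: "x \<in> K" and a: "a \<in> carrier A" for a x
  proof -
    have star: "cs_star A y \<in> K" if "y \<in> K" for y
      using B.ideal_star[OF K that] by simp
    have xc: "x \<in> carrier A" using x KJ JA by auto
    have "cs_star A (cs_star A a \<otimes> cs_star A x) \<in> K"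
      by (intro star left x) (simp add: a)
    then show ?thesis using a xc by simp
  qed
  have "alg_ideal (ideal_alg A J) K" by (rule B.ideal_alg_ideal[OF K])
  then have "alg_ideal A K"
    using KJ JA left right by (simp add: alg_ideal_def subset_iff)
  with lim show ?thesis
    by (simp add: in_ideals_iff)
qed

lemma ideals_ideal_alg:
  assumes J: "J \<in> ideals A"
  shows "ideals (ideal_alg A J) = {K \<in> ideals A. K \<subseteq> J}"
proof -
  interpret B: cstar_algebra "ideal_alg A J" by (rule ideal_alg_cstar[OF J])
  have JA: "J \<subseteq> carrier A" by (rule ideal_subset[OF J])
  have "K \<in> ideals (ideal_alg A J)" if K: "K \<in> ideals A" "K \<subseteq> J" for K
  proof -
    have "alg_ideal A K" by (rule ideal_alg_ideal[OF K(1)])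
    then have "alg_ideal (ideal_alg A J) K"
      using K(2) JA by (simp add: alg_ideal_def subset_iff)
    moreover have "x \<in> K" if x: "x \<in> J"
      and e: "\<forall>e>0. \<exists>y\<in>K. cs_norm A (x \<ominus>\<^bsub>ideal_alg A J\<^esub> y) < e" for x
    proof (rule ideal_limit[OF K(1)])
      show "x \<in> carrier A" using x JA by auto
      fix d :: real assume "d > 0"
      then obtain y where y: "y \<in> K" "cs_norm A (x \<ominus>\<^bsub>ideal_alg A J\<^esub> y) < d" using e by auto
      have "x \<ominus>\<^bsub>ideal_alg A J\<^esub> y = x \<ominus> y"
        by (rule minus_ideal_alg[OF J x]) (use y K(2) in auto)
      then show "\<exists>y\<in>K. cs_norm A (x \<ominus> y) < d" using y by auto
    qed
    ultimately show ?thesis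
      by (simp add: B.in_ideals_iff)
  qed
  then show ?thesis
    using ideal_of_ideal[OF J] B.ideal_subset by auto
qed


section \<open>Quotients\<close>

definition quot_norm :: "'a set \<Rightarrow> 'a \<Rightarrow> real" where
  "quot_norm I x = (INF y\<in>I +> x. cs_norm A y)"

context
  fixes I assumes I: "I \<in> ideals A"
begin

abbreviation (input) rep :: "'a \<Rightarrow> 'a" where "rep \<equiv> coset_rep A I"
abbreviation (input) Q :: "'a cstar" where "Q \<equiv> quot_alg A I"

private lemma IA: "x \<in> I \<Longrightarrow> x \<in> carrier A"
  using ideal_subset[OF I] by blast

lemma coset_eq: "I +> x = {i \<oplus> x | i. i \<in> I}"
  by (auto simp: a_r_coset_def')

lemma coset_eq_iff:
  assumes x: "x \<in> carrier A" and y: "y \<in> carrier A"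
  shows "I +> x = I +> y \<longleftrightarrow> x \<ominus> y \<in> I"
proof
  assume "I +> x = I +> y"
  moreover have "\<zero> \<oplus> x \<in> I +> x" unfolding coset_eq using idealD(2)[OF I] by blast
  ultimately obtain i where i: "i \<in> I" "x = i \<oplus> y" using x unfolding coset_eq by auto
  then show "x \<ominus> y \<in> I" using y IA by (simp add: add_diff_cancel)
next
  assume xy: "x \<ominus> y \<in> I"
  have sub: "I +> a \<subseteq> I +> b" if "a \<in> carrier A" "b \<in> carrier A" "a \<ominus> b \<in> I" for a b
  proof
    fix w assume "w \<in> I +> a"
    then obtain i where i: "i \<in> I" "w = i \<oplus> a" unfolding coset_eq by blast
    have "i \<oplus> a = i \<oplus> ((a \<ominus> b) \<oplus> b)" using that by (simp add: diff_add_cancel)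
    also have "\<dots> = (i \<oplus> (a \<ominus> b)) \<oplus> b" using that i IA by (simp add: a_assoc)
    finally show "w \<in> I +> b"
      unfolding coset_eq using i idealD(3)[OF I i(1) that(3)] by blast
  qed
  have "y \<ominus> x = \<ominus> (x \<ominus> y)" using x y by (simp add: minus_eq minus_add a_comm)
  then have "y \<ominus> x \<in> I" using idealD(8)[OF I xy] by simp
  then show "I +> x = I +> y" using sub xy x y by blast
qed

lemma rep_diff:
  assumes x: "x \<in> carrier A"
  shows "rep x \<in> carrier A" "rep x \<ominus> x \<in> I"
proof -
  have "rep x \<in> I +> x"
    unfolding coset_rep_def by (rule someI[of _ "\<zero> \<oplus> x"]) (use idealD(2)[OF I] in \<open>auto simp: coset_eq\<close>)
  then obtain i where i: "i \<in> I" "rep x = i \<oplus> x" by (auto simp: coset_eq)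
  then show "rep x \<in> carrier A" using x IA by simp
  show "rep x \<ominus> x \<in> I" using i x IA by (simp add: add_diff_cancel)
qed

lemma rep_eq_iff:
  assumes x: "x \<in> carrier A" and y: "y \<in> carrier A"
  shows "rep x = rep y \<longleftrightarrow> x \<ominus> y \<in> I"
proof
  assume "rep x = rep y"
  then show "x \<ominus> y \<in> I"
    using coset_eq_iff[OF rep_diff(1)[OF x] x] coset_eq_iff[OF rep_diff(1)[OF y] y]
      coset_eq_iff[OF x y] rep_diff(2)[OF x] rep_diff(2)[OF y] by simp
next
  assume "x \<ominus> y \<in> I"
  then show "rep x = rep y" using coset_eq_iff[OF x y] by (simp add: coset_rep_def)
qed

lemma rep_closed [simp]: "x \<in> carrier A \<Longrightarrow> rep x \<in> carrier A"
  by (rule rep_diff)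

lemma rep_rep [simp]: "x \<in> carrier A \<Longrightarrow> rep (rep x) = rep x"
  by (simp add: rep_eq_iff rep_diff(2))

lemma rep_add [simp]:
  assumes "x \<in> carrier A" "y \<in> carrier A"
  shows "rep (rep x \<oplus> y) = rep (x \<oplus> y)" "rep (x \<oplus> rep y) = rep (x \<oplus> y)"
  using assms by (simp_all add: rep_eq_iff add_diff_add rep_diff)

lemma rep_mult [simp]:
  assumes "x \<in> carrier A" "y \<in> carrier A"
  shows "rep (rep x \<otimes> y) = rep (x \<otimes> y)" "rep (x \<otimes> rep y) = rep (x \<otimes> y)"
  using assms idealD(6)[OF I rep_diff(2)[of x], of y] idealD(5)[OF I rep_diff(2)[of y], of x]
  by (simp_all add: rep_eq_iff mult_diff)

lemma rep_scale [simp]: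
  assumes "x \<in> carrier A"
  shows "rep (c \<odot> rep x) = rep (c \<odot> x)"
  using assms idealD(4)[OF I rep_diff(2)[of x], of c] by (simp add: rep_eq_iff scale_diff)

lemma rep_star [simp]:
  assumes "x \<in> carrier A"
  shows "rep (cs_star A (rep x)) = rep (cs_star A x)"
  using assms ideal_star[OF I rep_diff(2)[of x]] by (simp add: rep_eq_iff)

lemma rep_eq_zero_iff: "x \<in> carrier A \<Longrightarrow> rep x = rep \<zero> \<longleftrightarrow> x \<in> I"
  by (simp add: rep_eq_iff)

lemma rep_minus_left: "x \<in> carrier A \<Longrightarrow> rep (rep (\<ominus> x) \<oplus> x) = rep \<zero>"
  by (simp add: l_neg)

lemma quot_alg_simps [simp]:
  "carrier Q = rep ` carrier A"
  "\<zero>\<^bsub>Q\<^esub> = rep \<zero>"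
  "x \<oplus>\<^bsub>Q\<^esub> y = rep (x \<oplus> y)"
  "x \<otimes>\<^bsub>Q\<^esub> y = rep (x \<otimes> y)"
  "c \<odot>\<^bsub>Q\<^esub> x = rep (c \<odot> x)"
  "cs_star Q x = rep (cs_star A x)"
  "cs_norm Q x = quot_norm I x"
  by (simp_all add: quot_alg_def quot_norm_def)

lemma bdd_below_norm_coset: "x \<in> carrier A \<Longrightarrow> bdd_below (cs_norm A ` (I +> x))"
  by (rule bdd_belowI[of _ 0]) (auto simp: coset_eq IA intro!: norm_nonneg)

lemma quot_norm_le:
  assumes "x \<in> carrier A" "i \<in> I"
  shows "quot_norm I x \<le> cs_norm A (x \<oplus> i)"
  unfolding quot_norm_def
  by (rule cINF_lower[OF bdd_below_norm_coset]) (use assms IA in \<open>auto simp: coset_eq a_comm\<close>)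

lemma quot_norm_greatest:
  assumes "x \<in> carrier A" "\<And>i. i \<in> I \<Longrightarrow> c \<le> cs_norm A (x \<oplus> i)"
  shows "c \<le> quot_norm I x"
  unfolding quot_norm_def
proof (rule cINF_greatest)
  show "I +> x \<noteq> {}" using idealD(2)[OF I] by (auto simp: coset_eq)
  fix y assume "y \<in> I +> x"
  then obtain i where "i \<in> I" "y = x \<oplus> i" using assms(1) IA by (auto simp: coset_eq a_comm)
  then show "c \<le> cs_norm A y" using assms(2) by simp
qed

lemma quot_norm_less:
  assumes "x \<in> carrier A" "quot_norm I x < c"
  obtains i where "i \<in> I" "cs_norm A (x \<oplus> i) < c"
proof -
  have "\<exists>i\<in>I. cs_norm A (x \<oplus> i) < c"
  proof (rule ccontr)
    assume "\<not> ?thesis"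
    then have "c \<le> quot_norm I x" by (intro quot_norm_greatest assms) (auto simp: not_less)
    then show False using assms(2) by simp
  qed
  then show thesis using that by blast
qed

lemma quot_norm_le_norm: "x \<in> carrier A \<Longrightarrow> quot_norm I x \<le> cs_norm A x"
  using quot_norm_le[of x \<zero>] idealD(2)[OF I] by simp

lemma quot_norm_nonneg: "x \<in> carrier A \<Longrightarrow> 0 \<le> quot_norm I x"
  by (rule quot_norm_greatest) (auto intro!: norm_nonneg simp: IA)

lemma quot_norm_cong:
  assumes "x \<in> carrier A" "y \<in> carrier A" "x \<ominus> y \<in> I"
  shows "quot_norm I x = quot_norm I y"
  using coset_eq_iff[OF assms(1,2)] assms(3) by (simp add: quot_norm_def)

lemma quot_norm_rep [simp]: "x \<in> carrier A \<Longrightarrow> quot_norm I (rep x) = quot_norm I x"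
  by (intro quot_norm_cong) (simp_all add: rep_diff)

lemma quot_norm_eq_zero_iff:
  assumes x: "x \<in> carrier A"
  shows "quot_norm I x = 0 \<longleftrightarrow> x \<in> I"
proof
  assume 0: "quot_norm I x = 0"
  show "x \<in> I"
  proof (rule ideal_limit[OF I x])
    fix e :: real assume "e > 0"
    then obtain i where i: "i \<in> I" "cs_norm A (x \<oplus> i) < e"
      using quot_norm_less[OF x, of e] 0 by auto
    then have "cs_norm A (x \<ominus> \<ominus> i) < e" using IA by (simp add: minus_eq)
    then show "\<exists>y\<in>I. cs_norm A (x \<ominus> y) < e" using idealD(8)[OF I i(1)] by blast
  qed
next
  assume xI: "x \<in> I"
  then have "quot_norm I x \<le> 0"
    using quot_norm_le[OF x idealD(8)[OF I xI]] x by (simp add: r_neg)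
  then show "quot_norm I x = 0" using quot_norm_nonneg[OF x] by simp
qed

lemma quot_norm_triangle:
  assumes x: "x \<in> carrier A" and y: "y \<in> carrier A"
  shows "quot_norm I (x \<oplus> y) \<le> quot_norm I x + quot_norm I y"
proof (rule field_le_epsilon)
  fix e :: real assume "e > 0"
  obtain i where i: "i \<in> I" "cs_norm A (x \<oplus> i) < quot_norm I x + e/2"
    using quot_norm_less[OF x, of "quot_norm I x + e/2"] \<open>e > 0\<close> by auto
  obtain j where j: "j \<in> I" "cs_norm A (y \<oplus> j) < quot_norm I y + e/2"
    using quot_norm_less[OF y, of "quot_norm I y + e/2"] \<open>e > 0\<close> by auto
  have "quot_norm I (x \<oplus> y) \<le> cs_norm A ((x \<oplus> y) \<oplus> (i \<oplus> j))"
    using x y i j by (intro quot_norm_le idealD(3)[OF I]) auto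
  also have "(x \<oplus> y) \<oplus> (i \<oplus> j) = (x \<oplus> i) \<oplus> (y \<oplus> j)"
    using x y i j IA by (simp add: a_ac)
  also have "cs_norm A \<dots> \<le> cs_norm A (x \<oplus> i) + cs_norm A (y \<oplus> j)"
    using x y i j IA by (intro norm_triangle) auto
  finally show "quot_norm I (x \<oplus> y) \<le> quot_norm I x + quot_norm I y + e"
    using i j by simp
qed

lemma quot_norm_mult:
  assumes x: "x \<in> carrier A" and y: "y \<in> carrier A"
  shows "quot_norm I (x \<otimes> y) \<le> quot_norm I x * quot_norm I y"
proof -
  have prod: "quot_norm I (x \<otimes> y) \<le> cs_norm A (x \<oplus> i) * cs_norm A (y \<oplus> j)"
    if i: "i \<in> I" and j: "j \<in> I" for i j
  proof -
    note c = IA[OF i] IA[OF j]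
    have "(x \<oplus> i) \<otimes> (y \<oplus> j) = x \<otimes> y \<oplus> (x \<otimes> j \<oplus> (i \<otimes> y \<oplus> i \<otimes> j))"
      using x y c by (simp add: a_ac)
    moreover have "x \<otimes> j \<oplus> (i \<otimes> y \<oplus> i \<otimes> j) \<in> I"
      using x y c i j by (intro idealD(3)[OF I] idealD(5)[OF I] idealD(6)[OF I])
    ultimately have "quot_norm I (x \<otimes> y) \<le> cs_norm A ((x \<oplus> i) \<otimes> (y \<oplus> j))"
      using x y quot_norm_le[of "x \<otimes> y"] by simp
    also have "\<dots> \<le> cs_norm A (x \<oplus> i) * cs_norm A (y \<oplus> j)"
      using x y c by (intro norm_mult) auto
    finally show ?thesis .
  qed
  have lim: "((\<lambda>e. (quot_norm I x + e) * (quot_norm I y + e)) \<longlongrightarrow>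
      (quot_norm I x + 0) * (quot_norm I y + 0)) (at_right 0)"
    by (intro tendsto_intros)
  have "quot_norm I (x \<otimes> y) \<le> (quot_norm I x + e) * (quot_norm I y + e)" if e: "e > 0" for e
  proof -
    obtain i where i: "i \<in> I" "cs_norm A (x \<oplus> i) < quot_norm I x + e"
      using quot_norm_less[OF x, of "quot_norm I x + e"] e by auto
    obtain j where j: "j \<in> I" "cs_norm A (y \<oplus> j) < quot_norm I y + e"
      using quot_norm_less[OF y, of "quot_norm I y + e"] e by auto
    have "cs_norm A (x \<oplus> i) * cs_norm A (y \<oplus> j) \<le> (quot_norm I x + e) * (quot_norm I y + e)"
      using x y i j IA e quot_norm_nonneg[OF x] by (intro mult_mono) (auto intro!: norm_nonneg)
    then show ?thesis using prod[OF i(1) j(1)] by simp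
  qed
  then have "\<forall>\<^sub>F e in at_right 0. quot_norm I (x \<otimes> y) \<le> (quot_norm I x + e) * (quot_norm I y + e)"
    by (intro eventually_at_rightI[of 0 1]) auto
  then show ?thesis
    using tendsto_lowerbound[OF lim] by simp
qed

lemma quot_norm_scale:
  assumes x: "x \<in> carrier A"
  shows "quot_norm I (c \<odot> x) = cmod c * quot_norm I x"
proof -
  have le: "quot_norm I (c \<odot> x) \<le> cmod c * quot_norm I x" if x: "x \<in> carrier A" and c: "c \<noteq> 0" for c x
  proof -
    have "quot_norm I (c \<odot> x) / cmod c \<le> quot_norm I x"
    proof (rule quot_norm_greatest[OF x])
      fix i assume i: "i \<in> I"
      have "quot_norm I (c \<odot> x) \<le> cs_norm A (c \<odot> x \<oplus> c \<odot> i)"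
        using x i by (intro quot_norm_le idealD(4)[OF I]) auto
      also have "\<dots> = cmod c * cs_norm A (x \<oplus> i)"
        using x IA[OF i] norm_smult[of "x \<oplus> i" c] by simp
      finally show "quot_norm I (c \<odot> x) / cmod c \<le> cs_norm A (x \<oplus> i)"
        using c by (simp add: field_simps)
    qed
    then show ?thesis using c by (simp add: field_simps)
  qed
  show ?thesis
  proof (cases "c = 0")
    case True
    then show ?thesis using x quot_norm_eq_zero_iff[of \<zero>] idealD(2)[OF I] by simp
  next
    case False
    have "quot_norm I ((1/c) \<odot> (c \<odot> x)) \<le> cmod (1/c) * quot_norm I (c \<odot> x)"
      using x False by (intro le) auto
    then have "cmod c * quot_norm I x \<le> quot_norm I (c \<odot> x)"
      using x False by (simp add: norm_divide field_simps)
    then show ?thesis using le[OF x False] by simp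
  qed
qed

lemma quot_norm_star:
  assumes x: "x \<in> carrier A"
  shows "quot_norm I (cs_star A x) = quot_norm I x"
proof -
  have le: "quot_norm I (cs_star A x) \<le> quot_norm I x" if x: "x \<in> carrier A" for x
  proof (rule quot_norm_greatest[OF x])
    fix i assume i: "i \<in> I"
    show "quot_norm I (cs_star A x) \<le> cs_norm A (x \<oplus> i)"
      using quot_norm_le[of "cs_star A x" "cs_star A i"] ideal_star[OF I i] x IA[OF i]
        norm_star[of "x \<oplus> i"] by simp
  qed
  show ?thesis using le[OF x] le[of "cs_star A x"] x by simp
qed

text \<open>
  Only \<open>\<parallel>[x]\<parallel>\<^sup>2 \<le> \<parallel>w + i\<parallel>\<close> for \<open>w = x* x\<close> and \<open>i\<close> in the ideal needs an argument. The coset of \<open>x\<close> contains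
  \<open>x - x e\<close>, whose norm squared is the norm of \<open>(1 - e) w (1 - e)\<close>. If \<open>e\<close> is an approximate unit for \<open>i\<close>,
  then \<open>w\<close> can be replaced by \<open>w + i\<close> in this expression, and \<open>1 - e\<close> is almost contractive.
\<close>

lemma quot_norm_cstar_identity:
  assumes x: "x \<in> carrier A"
  shows "quot_norm I (cs_star A x \<otimes> x) = (quot_norm I x)\<^sup>2"
proof (rule antisym)
  show "quot_norm I (cs_star A x \<otimes> x) \<le> (quot_norm I x)\<^sup>2"
    using quot_norm_mult[of "cs_star A x" x] x by (simp add: quot_norm_star power2_eq_square)
  define w where "w = cs_star A x \<otimes> x"
  have w: "w \<in> carrier A" using x by (simp add: w_def)
  show "(quot_norm I x)\<^sup>2 \<le> quot_norm I (cs_star A x \<otimes> x)"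
    unfolding w_def[symmetric]
  proof (rule quot_norm_greatest[OF w])
    fix i assume i: "i \<in> I"
    have ic: "i \<in> carrier A" by (rule IA[OF i])
    let ?n = "cs_norm A (w \<oplus> i)"
    have "(quot_norm I x)\<^sup>2 \<le> (1 + \<epsilon>) * ((1 + \<epsilon>) * ?n) + (1 + \<epsilon>) * \<epsilon>" if \<epsilon>: "\<epsilon> > 0" for \<epsilon>
    proof -
      obtain e where e: "e \<in> I" "cs_star A e = e" "cs_norm A (i \<ominus> i \<otimes> e) < \<epsilon>"
        "\<And>z. z \<in> carrier A \<Longrightarrow> cs_norm A (z \<ominus> z \<otimes> e) \<le> (1 + \<epsilon>) * cs_norm A z"
        using approximate_unit[OF ideal_alg_ideal[OF I] i \<epsilon>] by blast
      have ec: "e \<in> carrier A" by (rule IA[OF e(1)])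
      have left: "cs_norm A (z \<ominus> e \<otimes> z) \<le> (1 + \<epsilon>) * cs_norm A z" if z: "z \<in> carrier A" for z
        using e(4)[of "cs_star A z"] norm_star[of "z \<ominus> e \<otimes> z"] z ec e(2) by simp
      \<comment> \<open>\<open>R z = z (1 - e)\<close> and \<open>T z = (1 - e) z (1 - e)\<close>\<close>
      define R where "R z = z \<ominus> z \<otimes> e" for z
      define T where "T z = R z \<ominus> e \<otimes> R z" for z
      have Rc: "R z \<in> carrier A" if "z \<in> carrier A" for z using that ec by (simp add: R_def)
      have R_diff: "R (a \<ominus> b) = R a \<ominus> R b" if "a \<in> carrier A" "b \<in> carrier A" for a b
        using that ec by (simp add: R_def minus_eq minus_add a_ac)
      have T_diff: "T (a \<ominus> b) = T a \<ominus> T b" if "a \<in> carrier A" "b \<in> carrier A" for a b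
        unfolding T_def R_diff[OF that] using Rc[OF that(1)] Rc[OF that(2)] ec
        by (simp add: minus_eq minus_add a_ac)
      have Tc: "T z \<in> carrier A" if "z \<in> carrier A" for z using Rc[OF that] ec by (simp add: T_def)
      have T_le: "cs_norm A (T z) \<le> (1 + \<epsilon>) * cs_norm A (R z)" if "z \<in> carrier A" for z
        using left[OF Rc[OF that]] by (simp add: T_def)
      have "quot_norm I x \<le> cs_norm A (R x)"
        using quot_norm_le[OF x idealD(8)[OF I idealD(5)[OF I e(1) x]]] by (simp add: R_def minus_eq)
      then have "(quot_norm I x)\<^sup>2 \<le> (cs_norm A (R x))\<^sup>2"
        using quot_norm_nonneg[OF x] by (rule power_mono)
      also have "\<dots> = cs_norm A (cs_star A (R x) \<otimes> R x)"
        using cstar_identity[OF Rc[OF x]] by simp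
      also have "cs_star A (R x) \<otimes> R x = T w"
        using x ec e(2)
        by (simp add: T_def R_def w_def mult_diff mult_assoc) (simp add: minus_eq minus_add a_ac)
      also have "T w = T ((w \<oplus> i) \<ominus> i)" using w ic by (simp add: add_diff_cancel)
      also have "\<dots> = T (w \<oplus> i) \<ominus> T i" using w ic by (intro T_diff) auto
      also have "cs_norm A \<dots> \<le> cs_norm A (T (w \<oplus> i)) + cs_norm A (T i)"
        using w ic by (intro norm_triangle_diff Tc) auto
      also have "\<dots> \<le> (1 + \<epsilon>) * cs_norm A (R (w \<oplus> i)) + (1 + \<epsilon>) * cs_norm A (R i)"
        using w ic by (intro add_mono T_le) auto
      also have "\<dots> \<le> (1 + \<epsilon>) * ((1 + \<epsilon>) * ?n) + (1 + \<epsilon>) * \<epsilon>"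
        using w ic e(3) e(4)[of "w \<oplus> i"] \<epsilon> by (intro add_mono mult_left_mono) (auto simp: R_def)
      finally show ?thesis .
    qed
    then have "\<forall>\<^sub>F e in at_right 0. (quot_norm I x)\<^sup>2 \<le> (1 + e) * ((1 + e) * ?n) + (1 + e) * e"
      by (intro eventually_at_rightI[of 0 1]) auto
    moreover have "((\<lambda>e. (1 + e) * ((1 + e) * ?n) + (1 + e) * e) \<longlongrightarrow>
        (1 + 0) * ((1 + 0) * ?n) + (1 + 0) * 0) (at_right (0::real))"
      by (intro tendsto_intros)
    ultimately show "(quot_norm I x)\<^sup>2 \<le> ?n"
      using tendsto_lowerbound[of _ _ "at_right (0::real)"] by fastforce
  qed
qed

lemma quot_norm_diff_commute:
  assumes "x \<in> carrier A" "y \<in> carrier A"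
  shows "quot_norm I (x \<ominus> y) = quot_norm I (y \<ominus> x)"
proof -
  have "y \<ominus> x = (-1) \<odot> (x \<ominus> y)"
    using assms by (simp add: diff_eq_scale a_comm)
  then show ?thesis
    using quot_norm_scale[of "x \<ominus> y" "-1"] assms by simp
qed

lemma quot_norm_diff_triangle:
  assumes "x \<in> carrier A" "y \<in> carrier A" "z \<in> carrier A"
  shows "quot_norm I (x \<ominus> z) \<le> quot_norm I (x \<ominus> y) + quot_norm I (y \<ominus> z)"
  using quot_norm_triangle[of "x \<ominus> y" "y \<ominus> z"] assms by (simp add: diff_add_diff)

text \<open>Completeness of the quotient: a rapidly converging subsequence of a Cauchy sequence of
  cosets lifts to a Cauchy sequence.\<close>

lemma quot_norm_cauchy_has_limit:
  assumes s: "\<And>n. s n \<in> carrier A"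
    and c: "\<And>e. e > 0 \<Longrightarrow> \<exists>N::nat. \<forall>m\<ge>N. \<forall>n\<ge>N. quot_norm I (s m \<ominus> s n) < e"
  obtains x where "x \<in> carrier A" "\<And>e. e > 0 \<Longrightarrow> \<exists>N. \<forall>n\<ge>N. quot_norm I (s n \<ominus> x) < e"
proof -
  have "\<forall>k. \<exists>N. \<forall>m\<ge>N. \<forall>n\<ge>N. quot_norm I (s m \<ominus> s n) < (1/2) ^ k"
    using c by simp
  from choice[OF this] obtain N where
    "\<forall>k. \<forall>m\<ge>N k. \<forall>n\<ge>N k. quot_norm I (s m \<ominus> s n) < (1/2) ^ k" ..
  then have N: "quot_norm I (s m \<ominus> s n) < (1/2) ^ k" if "m \<ge> N k" "n \<ge> N k" for k m n
    using that by simp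
  define r where "r k = (\<Sum>j\<le>k. N j)" for k
  have r: "r k \<ge> N k" "r (Suc k) \<ge> r k" for k
    using member_le_sum[of k "{..k}" N] by (simp_all add: r_def)
  have "\<forall>k. \<exists>i. i \<in> I \<and> cs_norm A ((s (r (Suc k)) \<ominus> s (r k)) \<oplus> i) < (1/2) ^ k"
  proof
    fix k
    have "quot_norm I (s (r (Suc k)) \<ominus> s (r k)) < (1/2) ^ k"
      using r[of k] by (intro N) auto
    then obtain i where "i \<in> I" "cs_norm A ((s (r (Suc k)) \<ominus> s (r k)) \<oplus> i) < (1/2) ^ k"
      using s by (elim quot_norm_less[rotated]) simp_all
    then show "\<exists>i. i \<in> I \<and> cs_norm A ((s (r (Suc k)) \<ominus> s (r k)) \<oplus> i) < (1/2) ^ k"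
      by blast
  qed
  from choice[OF this] obtain i where
    "\<forall>k. i k \<in> I \<and> cs_norm A ((s (r (Suc k)) \<ominus> s (r k)) \<oplus> i k) < (1/2) ^ k" ..
  then have i: "i k \<in> I" "cs_norm A ((s (r (Suc k)) \<ominus> s (r k)) \<oplus> i k) < (1/2) ^ k" for k
    by simp_all
  define d where "d k = (s (r (Suc k)) \<ominus> s (r k)) \<oplus> i k" for k
  have d: "d k \<in> carrier A" "cs_norm A (d k) < (1/2) ^ k" for k
    using s IA[OF i(1)] i(2) by (auto simp: d_def)
  define x where "x = rec_nat (s (r 0)) (\<lambda>k y. y \<oplus> d k)"
  have x_simps: "x 0 = s (r 0)" "x (Suc k) = x k \<oplus> d k" for k
    by (simp_all add: x_def)
  have xc: "x k \<in> carrier A" for k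
    by (induction k) (simp_all add: x_simps s d)
  have x_rep: "s (r k) \<ominus> x k \<in> I" for k
  proof (induction k)
    case 0
    then show ?case using idealD(2)[OF I] s by (simp add: x_simps)
  next
    case (Suc k)
    have "s (r (Suc k)) \<ominus> x (Suc k) = (s (r k) \<ominus> x k) \<ominus> i k"
    proof -
      have "s (r (Suc k)) \<ominus> x (Suc k) =
          (s (r k) \<oplus> (s (r (Suc k)) \<ominus> s (r k))) \<ominus> (x k \<oplus> d k)"
        using s diff_add_cancel[of "s (r (Suc k))" "s (r k)"] by (simp add: x_simps a_comm)
      also have "\<dots> = (s (r k) \<ominus> x k) \<oplus> ((s (r (Suc k)) \<ominus> s (r k)) \<ominus> d k)"
        using s xc d by (intro add_diff_add) auto
      also have "(s (r (Suc k)) \<ominus> s (r k)) \<ominus> d k = \<ominus> i k"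
      proof -
        define t where "t = s (r (Suc k)) \<ominus> s (r k)"
        have "t \<in> carrier A" "i k \<in> carrier A" using s IA[OF i(1)] by (simp_all add: t_def)
        then show ?thesis
          unfolding d_def t_def[symmetric] by (simp add: minus_eq minus_add a_assoc[symmetric] r_neg)
      qed
      finally show ?thesis by (simp add: minus_eq)
    qed
    then show ?case using idealD(7)[OF I Suc i(1)] by simp
  qed
  have step: "cs_norm A (x (Suc k) \<ominus> x k) \<le> 1 * (1/2) ^ k" for k
    using xc[of k] d[of k] add_diff_cancel[of "d k" "x k"] by (simp add: x_simps a_comm)
  obtain l where l: "l \<in> carrier A" "\<And>e. e > 0 \<Longrightarrow> \<exists>N. \<forall>n\<ge>N. cs_norm A (x n \<ominus> l) < e"
    by (rule geometric_limit[OF xc _ _ step]) auto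
  have "\<exists>N. \<forall>n\<ge>N. quot_norm I (s n \<ominus> l) < e" if e: "e > 0" for e
  proof -
    obtain j where j: "(1/2) ^ j < e / 2"
      using real_arch_pow_inv[of "e/2" "1/2"] e by auto
    obtain M where M: "\<forall>n\<ge>M. cs_norm A (x n \<ominus> l) < e/2"
      using l(2)[of "e/2"] e by auto
    define k where "k = j + M"
    have "quot_norm I (s n \<ominus> l) < e" if n: "n \<ge> r k" for n
    proof -
      have "quot_norm I (s n \<ominus> s (r k)) < (1/2) ^ k"
        using n r(1)[of k] by (intro N) auto
      also have "\<dots> \<le> (1/2) ^ j" unfolding k_def by (rule power_decreasing) auto
      finally have "quot_norm I (s n \<ominus> s (r k)) < e/2" using j by simp
      moreover have "quot_norm I (s (r k) \<ominus> l) < e/2"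
      proof -
        have "(s (r k) \<ominus> l) \<ominus> (x k \<ominus> l) = s (r k) \<ominus> x k"
          using add_diff_add[of "s (r k)" "\<ominus> l" "x k" "\<ominus> l"] s xc l(1) by (simp add: minus_eq[symmetric])
        then have "quot_norm I (s (r k) \<ominus> l) = quot_norm I (x k \<ominus> l)"
          using s xc l(1) x_rep by (intro quot_norm_cong) auto
        also have "\<dots> \<le> cs_norm A (x k \<ominus> l)"
          using xc l(1) by (intro quot_norm_le_norm) auto
        also have "\<dots> < e/2" using M by (simp add: k_def)
        finally show ?thesis .
      qed
      ultimately show ?thesis
        using quot_norm_diff_triangle[of "s n" "s (r k)" l] s l(1) by simp
    qed
    then show ?thesis by blast
  qed
  with l(1) show thesis by (rule that)
qed

lemma quot_alg_cstar: "cstar_algebra Q"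
proof -
  have group: "abelian_group Q"
  proof (rule abelian_groupI)
    show "\<exists>y\<in>carrier Q. y \<oplus>\<^bsub>Q\<^esub> x = \<zero>\<^bsub>Q\<^esub>" if "x \<in> carrier Q" for x
    proof -
      obtain a where a: "a \<in> carrier A" "x = rep a" using \<open>x \<in> carrier Q\<close> by auto
      then show ?thesis
        using rep_minus_left[OF a(1)] by (intro bexI[of _ "rep (\<ominus> a)"]) auto
    qed
    show "x \<oplus>\<^bsub>Q\<^esub> y = y \<oplus>\<^bsub>Q\<^esub> x" if "x \<in> carrier Q" "y \<in> carrier Q" for x y
      using that by (auto simp: a_comm)
  qed (auto simp: a_assoc)
  have module: "module (ring_of_type_algebra :: complex ring) Q"
  proof (rule moduleI)
    show "cring (ring_of_type_algebra :: complex ring)" by (rule R.is_cring)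
  qed (auto simp: group ring_of_type_algebra_simps scale_left_distrib[symmetric])
  then interpret B: module "ring_of_type_algebra :: complex ring" Q .
  have minus: "rep x \<ominus>\<^bsub>Q\<^esub> rep y = rep (x \<ominus> y)" if "x \<in> carrier A" "y \<in> carrier A" for x y
  proof -
    have "\<ominus>\<^bsub>Q\<^esub> rep y = rep (\<ominus> y)"
      by (rule B.minus_equality) (use that rep_minus_left in auto)
    then show ?thesis
      using that by (simp add: minus_eq a_minus_def[of Q])
  qed
  have dist: "cs_dist Q (rep x) (rep y) = quot_norm I (x \<ominus> y)"
    if "x \<in> carrier A" "y \<in> carrier A" for x y
    using that by (simp add: cs_dist_def minus)
  have metric: "Metric_space (carrier Q) (cs_dist Q)"
  proof
    show "0 \<le> cs_dist Q x y" for x y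
    proof (cases "x \<in> carrier Q \<and> y \<in> carrier Q")
      case True
      then show ?thesis by (auto simp: dist quot_norm_nonneg)
    qed (auto simp: cs_dist_def)
    show "cs_dist Q x y = cs_dist Q y x" for x y
    proof (cases "x \<in> carrier Q \<and> y \<in> carrier Q")
      case True
      then show ?thesis by (auto simp: dist quot_norm_diff_commute)
    qed (auto simp: cs_dist_def)
    show "cs_dist Q x y = 0 \<longleftrightarrow> x = y" if "x \<in> carrier Q" "y \<in> carrier Q" for x y
      using that by (auto simp: dist quot_norm_eq_zero_iff rep_eq_iff)
    show "cs_dist Q x z \<le> cs_dist Q x y + cs_dist Q y z"
      if "x \<in> carrier Q" "y \<in> carrier Q" "z \<in> carrier Q" for x y z
      using that by (auto simp: dist quot_norm_diff_triangle)
  qed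
  have "Metric_space.mcomplete (carrier Q) (cs_dist Q)"
    unfolding mcomplete_cs_dist_iff[OF metric]
  proof (intro allI impI, elim conjE)
    fix s :: "nat \<Rightarrow> 'a"
    assume s: "\<forall>n. s n \<in> carrier Q"
      and c: "\<forall>e>0. \<exists>N::nat. \<forall>m\<ge>N. \<forall>n\<ge>N. cs_norm Q (s m \<ominus>\<^bsub>Q\<^esub> s n) < e"
    have sc: "s n \<in> carrier A" "rep (s n) = s n" for n
      using s by (metis imageE quot_alg_simps(1) rep_closed rep_rep)+
    have minus': "cs_norm Q (s n \<ominus>\<^bsub>Q\<^esub> rep x) = quot_norm I (s n \<ominus> x)" if "x \<in> carrier A" for n x
      using minus[OF sc(1)[of n] that] sc that by simp
    obtain x where x: "x \<in> carrier A" "\<And>e. e > 0 \<Longrightarrow> \<exists>N. \<forall>n\<ge>N. quot_norm I (s n \<ominus> x) < e"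
    proof (rule quot_norm_cauchy_has_limit[of s])
      show "\<exists>N::nat. \<forall>m\<ge>N. \<forall>n\<ge>N. quot_norm I (s m \<ominus> s n) < e" if "e > 0" for e
        using c[rule_format, OF that] minus'[OF sc(1)] sc(2) by simp
    qed (use sc in blast)+
    then show "\<exists>x\<in>carrier Q. \<forall>e>0. \<exists>N. \<forall>n\<ge>N. cs_norm Q (s n \<ominus>\<^bsub>Q\<^esub> x) < e"
      using minus'[OF x(1)] by (intro bexI[of _ "rep x"]) auto
  qed
  then show ?thesis
    using module
    by (intro cstar_algebra.intro cstar_algebra_axioms.intro)
      (auto simp: mult_assoc quot_norm_nonneg quot_norm_eq_zero_iff rep_eq_zero_iff
        quot_norm_triangle quot_norm_scale quot_norm_mult quot_norm_cstar_identity
        mult_distrib_left[symmetric] smult_mult_right[symmetric]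
        simp del: mult_distrib_left smult_mult_right)
qed

end
end

section \<open>Homomorphisms and quotients\<close>

definition star_hom :: "'a cstar \<Rightarrow> 'a cstar \<Rightarrow> ('a \<Rightarrow> 'a) \<Rightarrow> bool" where
  "star_hom A B f \<longleftrightarrow> f ` carrier A \<subseteq> carrier B \<and>
    (\<forall>x\<in>carrier A. \<forall>y\<in>carrier A.
      f (x \<oplus>\<^bsub>A\<^esub> y) = f x \<oplus>\<^bsub>B\<^esub> f y \<and> f (x \<otimes>\<^bsub>A\<^esub> y) = f x \<otimes>\<^bsub>B\<^esub> f y) \<and>
    (\<forall>x\<in>carrier A. f (cs_star A x) = cs_star B (f x) \<and> (\<forall>c. f (c \<odot>\<^bsub>A\<^esub> x) = c \<odot>\<^bsub>B\<^esub> f x))"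

lemma star_homD:
  assumes "star_hom A B f"
  shows "\<And>x. x \<in> carrier A \<Longrightarrow> f x \<in> carrier B"
    "\<And>x y. x \<in> carrier A \<Longrightarrow> y \<in> carrier A \<Longrightarrow> f (x \<oplus>\<^bsub>A\<^esub> y) = f x \<oplus>\<^bsub>B\<^esub> f y"
    "\<And>x y. x \<in> carrier A \<Longrightarrow> y \<in> carrier A \<Longrightarrow> f (x \<otimes>\<^bsub>A\<^esub> y) = f x \<otimes>\<^bsub>B\<^esub> f y"
    "\<And>x. x \<in> carrier A \<Longrightarrow> f (cs_star A x) = cs_star B (f x)"
    "\<And>x c. x \<in> carrier A \<Longrightarrow> f (c \<odot>\<^bsub>A\<^esub> x) = c \<odot>\<^bsub>B\<^esub> f x"
  using assms by (auto simp: star_hom_def)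

lemma star_isomorphic_iff_hom:
  "star_isomorphic A B \<longleftrightarrow> (\<exists>f. star_hom A B f \<and> bij_betw f (carrier A) (carrier B))"
  unfolding star_isomorphic_def star_hom_def
  by (intro iff_exI) (auto dest: bij_betw_imp_surj_on)

lemma star_hom_comp:
  assumes "star_hom A B f" "star_hom B C g"
  shows "star_hom A C (\<lambda>x. g (f x))"
  unfolding star_hom_def using star_homD[OF assms(1)] star_homD[OF assms(2)] by (simp add: image_subset_iff)

lemma star_hom_inverse:
  assumes A: "cstar_algebra A" and f: "star_hom A B f" "bij_betw f (carrier A) (carrier B)"
  defines "g \<equiv> inv_into (carrier A) f"
  shows "star_hom B A g" "bij_betw g (carrier B) (carrier A)"
    "\<And>x. x \<in> carrier A \<Longrightarrow> g (f x) = x" "\<And>y. y \<in> carrier B \<Longrightarrow> f (g y) = y"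
proof -
  interpret A: cstar_algebra A by fact
  show g: "bij_betw g (carrier B) (carrier A)"
    unfolding g_def by (rule bij_betw_inv_into[OF f(2)])
  show gf: "g (f x) = x" if "x \<in> carrier A" for x
    unfolding g_def using f(2) that by (rule bij_betw_inv_into_left)
  show fg: "f (g y) = y" if "y \<in> carrier B" for y
    unfolding g_def using f(2) that by (rule bij_betw_inv_into_right)
  have gc: "g y \<in> carrier A" if "y \<in> carrier B" for y
    using bij_betw_apply[OF g that] .
  note h = star_homD[OF f(1)]
  show "star_hom B A g"
    unfolding star_hom_def
  proof (intro conjI ballI allI)
    show "g ` carrier B \<subseteq> carrier A" using gc by auto
    fix x assume x: "x \<in> carrier B"
    show "g (cs_star B x) = cs_star A (g x)"
      using gf[of "cs_star A (g x)"] h(4)[OF gc[OF x]] gc[OF x] fg[OF x] by simp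
    show "g (c \<odot>\<^bsub>B\<^esub> x) = c \<odot>\<^bsub>A\<^esub> g x" for c
      using gf[of "c \<odot>\<^bsub>A\<^esub> g x"] h(5)[OF gc[OF x]] gc[OF x] fg[OF x] by simp
    fix y assume y: "y \<in> carrier B"
    show "g (x \<oplus>\<^bsub>B\<^esub> y) = g x \<oplus>\<^bsub>A\<^esub> g y"
      using gf[of "g x \<oplus>\<^bsub>A\<^esub> g y"] h(2)[OF gc[OF x] gc[OF y]] gc x y fg by simp
    show "g (x \<otimes>\<^bsub>B\<^esub> y) = g x \<otimes>\<^bsub>A\<^esub> g y"
      using gf[of "g x \<otimes>\<^bsub>A\<^esub> g y"] h(3)[OF gc[OF x] gc[OF y]] gc x y fg by simp
  qed
qed

lemma star_isomorphic_sym: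
  assumes "cstar_algebra A" "star_isomorphic A B"
  shows "star_isomorphic B A"
proof -
  obtain f where "star_hom A B f" "bij_betw f (carrier A) (carrier B)"
    using assms(2) unfolding star_isomorphic_iff_hom by blast
  from star_hom_inverse(1,2)[OF assms(1) this] show ?thesis
    unfolding star_isomorphic_iff_hom by blast
qed

lemma star_hom_diff_zero:
  assumes A: "cstar_algebra A" and B: "cstar_algebra B" and f: "star_hom A B f"
  shows "f \<zero>\<^bsub>A\<^esub> = \<zero>\<^bsub>B\<^esub>"
    "\<And>x y. x \<in> carrier A \<Longrightarrow> y \<in> carrier A \<Longrightarrow> f (x \<ominus>\<^bsub>A\<^esub> y) = f x \<ominus>\<^bsub>B\<^esub> f y"
proof -
  interpret A: cstar_algebra A by fact
  interpret B: cstar_algebra B by fact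
  note h = star_homD[OF f]
  show "f \<zero>\<^bsub>A\<^esub> = \<zero>\<^bsub>B\<^esub>"
    using h(5)[of "\<zero>\<^bsub>A\<^esub>" 0] h(1)[of "\<zero>\<^bsub>A\<^esub>"] by simp
  show "f (x \<ominus>\<^bsub>A\<^esub> y) = f x \<ominus>\<^bsub>B\<^esub> f y" if "x \<in> carrier A" "y \<in> carrier A" for x y
    using that h(1,2,5) by (simp add: A.diff_eq_scale B.diff_eq_scale)
qed

text \<open>First isomorphism theorem: \<open>f\<close> itself, restricted to the transversal, is the isomorphism.\<close>

lemma first_isomorphism:
  assumes A: "cstar_algebra A" and B: "cstar_algebra B" and I: "I \<in> ideals A"
    and f: "star_hom A B f" "f ` carrier A = carrier B"
    and ker: "\<And>x. x \<in> carrier A \<Longrightarrow> f x = \<zero>\<^bsub>B\<^esub> \<longleftrightarrow> x \<in> I"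
  shows "star_isomorphic (quot_alg A I) B"
proof -
  interpret A: cstar_algebra A by fact
  interpret B: cstar_algebra B by fact
  note h = star_homD[OF f(1)]
  let ?rep = "coset_rep A I"
  have eq: "f x = f y \<longleftrightarrow> x \<ominus>\<^bsub>A\<^esub> y \<in> I" if "x \<in> carrier A" "y \<in> carrier A" for x y
    using that ker[of "x \<ominus>\<^bsub>A\<^esub> y"] star_hom_diff_zero(2)[OF A B f(1)] h(1)
    by (simp add: B.diff_eq_zero_iff)
  have rep: "f (?rep x) = f x" if "x \<in> carrier A" for x
    using eq[of "?rep x" x] A.rep_diff[OF I that] that by simp
  have hom: "star_hom (quot_alg A I) B f"
    unfolding star_hom_def A.quot_alg_simps[OF I]
    using h rep by (auto simp: A.rep_closed[OF I])
  have "inj_on f (?rep ` carrier A)"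
    by (auto intro!: inj_onI simp: A.rep_closed[OF I] rep eq A.rep_eq_iff[OF I])
  moreover have "f ` (?rep ` carrier A) = carrier B"
    using rep f(2) by (simp add: image_image cong: image_cong)
  ultimately show ?thesis
    unfolding star_isomorphic_iff_hom using hom
    by (intro exI[of _ f]) (simp add: bij_betw_def A.quot_alg_simps[OF I])
qed

lemma quot_hom:
  assumes A: "cstar_algebra A" and I: "I \<in> ideals A"
  shows "star_hom A (quot_alg A I) (coset_rep A I)"
proof -
  interpret A: cstar_algebra A by fact
  show ?thesis
    by (auto simp: star_hom_def A.quot_alg_simps[OF I] A.rep_add[OF I] A.rep_mult[OF I]
        A.rep_star[OF I] A.rep_scale[OF I] A.rep_closed[OF I])
qed

text \<open>
  As quotients live on a transversal, the ideal \<open>J/I\<close> of \<open>A/I\<close> and the quotient of the algebra \<open>J\<close> by \<open>I\<close>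
  are the same record, not just isomorphic ones.
\<close>

lemma ideal_alg_quot_alg:
  "ideal_alg (quot_alg A I) (coset_rep A I ` J) = quot_alg (ideal_alg A J) I"
proof -
  have "coset_rep (ideal_alg A J) I = coset_rep A I"
    by (simp add: coset_rep_def a_r_coset_def' fun_eq_iff)
  then show ?thesis
    by (simp add: quot_alg_def a_r_coset_def')
qed

lemma (in cstar_algebra) ideal_quot_image:
  assumes I: "I \<in> ideals A" and J: "J \<in> ideals A" "I \<subseteq> J"
  shows "coset_rep A I ` J \<in> ideals (quot_alg A I)"
    and "\<And>x. x \<in> carrier A \<Longrightarrow> coset_rep A I x \<in> coset_rep A I ` J \<longleftrightarrow> x \<in> J"
proof -
  interpret B: cstar_algebra "quot_alg A I" by (rule quot_alg_cstar[OF I])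
  let ?rep = "coset_rep A I"
  have JA: "J \<subseteq> carrier A" by (rule ideal_subset[OF J(1)])
  show mem: "?rep x \<in> ?rep ` J \<longleftrightarrow> x \<in> J" if x: "x \<in> carrier A" for x
  proof
    assume "?rep x \<in> ?rep ` J"
    then obtain y where y: "y \<in> J" "?rep x = ?rep y" by auto
    then have yc: "y \<in> carrier A" using JA by auto
    then have "x \<ominus> y \<in> I" using x y(2) by (simp add: rep_eq_iff[OF I])
    then have "(x \<ominus> y) \<oplus> y \<in> J" using J(2) y(1) by (intro idealD(3)[OF J(1)]) auto
    then show "x \<in> J" using x yc by (simp add: diff_add_cancel)
  qed simp
  note hom = quot_hom[OF cstar_algebra_axioms I]
  note h = star_homD[OF hom]
  note z = star_hom_diff_zero[OF cstar_algebra_axioms B.cstar_algebra_axioms hom]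
  have cl: "x \<in> carrier A" if "x \<in> J" for x using that JA by blast
  have "alg_ideal (quot_alg A I) (?rep ` J)"
    unfolding alg_ideal_def quot_alg_simps(1)[OF I]
    using idealD(2)[OF J(1)]
    by (auto simp: cl z(1)[symmetric] h(2)[symmetric] h(3)[symmetric] h(5)[symmetric]
        intro!: imageI idealD(3)[OF J(1)] idealD(4)[OF J(1)]
        intro: idealD(5)[OF J(1)] idealD(6)[OF J(1)])
  moreover have "x \<in> ?rep ` J" if x: "x \<in> carrier (quot_alg A I)"
    and lim: "\<forall>e>0. \<exists>y\<in>?rep ` J. cs_norm (quot_alg A I) (x \<ominus>\<^bsub>quot_alg A I\<^esub> y) < e" for x
  proof -
    obtain a where a: "a \<in> carrier A" "x = ?rep a" using x by (auto simp: quot_alg_simps[OF I])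
    have "a \<in> J"
    proof (rule ideal_limit[OF J(1) a(1)])
      fix e :: real assume "e > 0"
      then obtain b where b: "b \<in> J" "cs_norm (quot_alg A I) (x \<ominus>\<^bsub>quot_alg A I\<^esub> ?rep b) < e"
        using lim by blast
      have bc: "b \<in> carrier A" using b JA by auto
      have "x \<ominus>\<^bsub>quot_alg A I\<^esub> ?rep b = ?rep (a \<ominus> b)"
        using z(2)[OF a(1) bc] a(2) by simp
      then have "quot_norm I (a \<ominus> b) < e"
        using b(2) a(1) bc by (simp add: quot_alg_simps[OF I] quot_norm_rep[OF I])
      then obtain i where i: "i \<in> I" "cs_norm A ((a \<ominus> b) \<oplus> i) < e"
        using quot_norm_less[OF I, of "a \<ominus> b" e] a(1) bc by auto
      have ic: "i \<in> carrier A" "i \<in> J" using i J(2) JA by auto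
      have "(a \<ominus> b) \<oplus> i = a \<ominus> (b \<ominus> i)"
        using a bc ic by (simp add: minus_eq minus_add a_ac)
      then show "\<exists>y\<in>J. cs_norm A (a \<ominus> y) < e"
        using i(2) idealD(7)[OF J(1) b(1) ic(2)] by auto
    qed
    then show ?thesis using a by blast
  qed
  ultimately show "?rep ` J \<in> ideals (quot_alg A I)"
    by (simp add: B.in_ideals_iff)
qed

lemma (in cstar_algebra) ideal_quot_preimage:
  assumes I: "I \<in> ideals A" and L: "L \<in> ideals (quot_alg A I)"
  obtains J where "J \<in> ideals A" "I \<subseteq> J" "L = coset_rep A I ` J"
proof -
  interpret B: cstar_algebra "quot_alg A I" by (rule quot_alg_cstar[OF I])
  let ?rep = "coset_rep A I"
  define J where "J = {x \<in> carrier A. ?rep x \<in> L}"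
  note hom = quot_hom[OF cstar_algebra_axioms I]
  note h = star_homD[OF hom]
  note z = star_hom_diff_zero[OF cstar_algebra_axioms B.cstar_algebra_axioms hom]
  have "alg_ideal (quot_alg A I) L" by (rule B.ideal_alg_ideal[OF L])
  then have "alg_ideal A J"
    unfolding alg_ideal_def J_def by (auto simp: h z(1))
  moreover have "x \<in> J" if x: "x \<in> carrier A" and lim: "\<forall>e>0. \<exists>y\<in>J. cs_norm A (x \<ominus> y) < e" for x
  proof -
    have "?rep x \<in> L"
    proof (rule B.ideal_limit[OF L])
      show "?rep x \<in> carrier (quot_alg A I)" using h(1) x by simp
      fix e :: real assume "e > 0"
      then obtain y where y: "y \<in> carrier A" "?rep y \<in> L" "cs_norm A (x \<ominus> y) < e"
        using lim by (auto simp: J_def)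
      have "cs_norm (quot_alg A I) (?rep (x \<ominus> y)) \<le> cs_norm A (x \<ominus> y)"
        using x y(1) quot_norm_le_norm[OF I, of "x \<ominus> y"]
        by (simp add: quot_alg_simps[OF I] quot_norm_rep[OF I])
      then have "cs_norm (quot_alg A I) (?rep x \<ominus>\<^bsub>quot_alg A I\<^esub> ?rep y) < e"
        unfolding z(2)[OF x y(1), symmetric] using y(3) by (rule le_less_trans)
      then show "\<exists>y\<in>L. cs_norm (quot_alg A I) (?rep x \<ominus>\<^bsub>quot_alg A I\<^esub> y) < e"
        using y(2) by blast
    qed
    then show ?thesis using x by (simp add: J_def)
  qed
  ultimately have "J \<in> ideals A"
    by (simp add: in_ideals_iff)
  moreover have "I \<subseteq> J"
  proof
    fix x assume x: "x \<in> I"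
    then have xc: "x \<in> carrier A" using ideal_subset[OF I] by auto
    then have "?rep x = \<zero>\<^bsub>quot_alg A I\<^esub>"
      using x by (simp add: quot_alg_simps[OF I] rep_eq_zero_iff[OF I])
    then show "x \<in> J" using xc B.idealD(2)[OF L] by (simp add: J_def)
  qed
  moreover have "L = ?rep ` J"
    using B.ideal_subset[OF L] unfolding J_def quot_alg_simps[OF I] by auto
  ultimately show thesis by (rule that)
qed

section \<open>Contractivity of homomorphisms\<close>

text \<open>
  The equation says \<open>k\<^sup>2 + (1 - s)\<^sup>2 = 1\<close>: together with \<open>1 - s\<close>, the square root of \<open>1 - k\<^sup>2\<close>, the element
  \<open>k\<close> forms a point of the unit circle. In the form \<open>s = (k\<^sup>2 + s\<^sup>2)/2\<close> it is a fixed point equation for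
  a map that is contracting on the ball of radius \<open>\<parallel>k\<parallel> < 1\<close>.
\<close>

lemma (in cstar_algebra) half_circle_root:
  assumes k: "k \<in> carrier A" "cs_star A k = k" "cs_norm A k < 1"
  obtains s where "s \<in> carrier A" "cs_star A s = s" "s \<otimes> k = k \<otimes> s"
    "s \<oplus> s = k \<otimes> k \<oplus> s \<otimes> s"
proof -
  define q where "q = cs_norm A k"
  have q: "0 \<le> q" "q < 1" using k norm_nonneg by (auto simp: q_def)
  define F where "F s = (1/2) \<odot> (k \<otimes> k \<oplus> s \<otimes> s)" for s
  define x where "x n = (F ^^ n) \<zero>" for n
  have x_simps: "x 0 = \<zero>" "x (Suc n) = F (x n)" for n by (simp_all add: x_def)
  have half: "cs_norm A ((1/2) \<odot> u) = cs_norm A u / 2" if "u \<in> carrier A" for u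
    using that by (simp add: norm_smult)
  have inv: "x n \<in> carrier A \<and> cs_star A (x n) = x n \<and> x n \<otimes> k = k \<otimes> x n \<and> cs_norm A (x n) \<le> q" for n
  proof (induction n)
    case 0
    then show ?case using k q by (simp add: x_simps)
  next
    case (Suc n)
    let ?y = "x n"
    have y: "?y \<in> carrier A" "cs_star A ?y = ?y" "?y \<otimes> k = k \<otimes> ?y" "cs_norm A ?y \<le> q"
      using Suc by auto
    have "cs_norm A (k \<otimes> k \<oplus> ?y \<otimes> ?y) \<le> cs_norm A (k \<otimes> k) + cs_norm A (?y \<otimes> ?y)"
      using k y by (intro norm_triangle) auto
    also have "\<dots> \<le> q * q + q * q"
      using norm_mult[of k k] norm_mult[of ?y ?y] k y q
        mult_mono[of "cs_norm A ?y" q "cs_norm A ?y" q] norm_nonneg[of ?y]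
      by (simp add: q_def)
    also have "\<dots> \<le> 2 * q" using mult_left_le[of q q] q by simp
    finally have "cs_norm A (F ?y) \<le> q"
      using k y by (simp add: F_def half del: scale_right_distrib)
    moreover have "(?y \<otimes> ?y) \<otimes> k = k \<otimes> (?y \<otimes> ?y)"
    proof -
      have "(?y \<otimes> ?y) \<otimes> k = ?y \<otimes> (k \<otimes> ?y)" using k y by (simp add: mult_assoc)
      also have "\<dots> = (k \<otimes> ?y) \<otimes> ?y" using k y by (simp add: mult_assoc[symmetric])
      finally show ?thesis using k y by (simp add: mult_assoc)
    qed
    ultimately show ?case
      using k y by (simp add: x_simps F_def mult_assoc)
  qed
  have lip: "cs_norm A (F u \<ominus> F v) \<le> (cs_norm A u + cs_norm A v) / 2 * cs_norm A (u \<ominus> v)"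
    if u: "u \<in> carrier A" and v: "v \<in> carrier A" for u v
  proof -
    have "F u \<ominus> F v = (1/2) \<odot> ((k \<otimes> k \<oplus> u \<otimes> u) \<ominus> (k \<otimes> k \<oplus> v \<otimes> v))"
      using k u v unfolding F_def by (subst scale_diff) auto
    also have "(k \<otimes> k \<oplus> u \<otimes> u) \<ominus> (k \<otimes> k \<oplus> v \<otimes> v) = u \<otimes> u \<ominus> v \<otimes> v"
      using k u v by (simp add: add_diff_add)
    also have "u \<otimes> u \<ominus> v \<otimes> v = u \<otimes> (u \<ominus> v) \<oplus> (u \<ominus> v) \<otimes> v"
      using u v by (simp add: mult_diff diff_add_diff)
    finally have "cs_norm A (F u \<ominus> F v) = cs_norm A (u \<otimes> (u \<ominus> v) \<oplus> (u \<ominus> v) \<otimes> v) / 2"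
      using u v half[of "u \<otimes> (u \<ominus> v) \<oplus> (u \<ominus> v) \<otimes> v"] by (simp only: mult_closed minus_closed a_closed)
    also have "\<dots> \<le> (cs_norm A u * cs_norm A (u \<ominus> v) + cs_norm A (u \<ominus> v) * cs_norm A v) / 2"
      using norm_triangle[of "u \<otimes> (u \<ominus> v)" "(u \<ominus> v) \<otimes> v"]
        norm_mult[of u "u \<ominus> v"] norm_mult[of "u \<ominus> v" v] u v by simp
    finally show ?thesis by (simp add: algebra_simps)
  qed
  have step: "cs_norm A (x (Suc n) \<ominus> x n) \<le> 1 * q ^ n" for n
  proof (induction n)
    case 0
    then show ?case using inv[of "Suc 0"] q by (simp add: x_simps(1))
  next
    case (Suc n)
    have "cs_norm A (x (Suc (Suc n)) \<ominus> x (Suc n)) \<le>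
        (cs_norm A (x (Suc n)) + cs_norm A (x n)) / 2 * cs_norm A (x (Suc n) \<ominus> x n)"
      unfolding x_simps(2)[of "Suc n"] using inv lip[of "x (Suc n)" "x n"]
      by (simp add: x_simps(2)[of n, symmetric])
    also have "\<dots> \<le> q * q ^ n"
      using inv[of n] inv[of "Suc n"] Suc q by (intro mult_mono) (auto intro!: norm_nonneg)
    finally show ?case by simp
  qed
  have xc: "x n \<in> carrier A" for n using inv by blast
  obtain s where s: "s \<in> carrier A" "\<And>e. e > 0 \<Longrightarrow> \<exists>N. \<forall>n\<ge>N. cs_norm A (x n \<ominus> s) < e"
    by (rule geometric_limit[OF xc q step]) (rule that)
  have close: "\<exists>n. cs_norm A (x n \<ominus> s) < e \<and> cs_norm A (x (Suc n) \<ominus> s) < e" if e: "e > 0" for e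
  proof -
    obtain N where "\<forall>n\<ge>N. cs_norm A (x n \<ominus> s) < e" using s(2)[OF e] by blast
    then show ?thesis by (intro exI[of _ N]) simp
  qed
  have ss: "cs_star A s = s"
  proof (rule eqI_norm[where C = 2])
    fix e :: real assume "e > 0"
    then obtain n where n: "cs_norm A (x n \<ominus> s) < e" using close by blast
    have "cs_norm A (cs_star A s \<ominus> s) \<le> cs_norm A (cs_star A s \<ominus> x n) + cs_norm A (x n \<ominus> s)"
      using s(1) inv[of n] by (intro norm_diff_triangle) auto
    also have "cs_norm A (cs_star A s \<ominus> x n) = cs_norm A (x n \<ominus> s)"
      using norm_star[of "s \<ominus> x n"] s(1) inv[of n] norm_diff_commute[of s "x n"] by simp
    finally show "cs_norm A (cs_star A s \<ominus> s) \<le> 2 * e" using n by simp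
  qed (use s(1) in auto)
  have comm: "s \<otimes> k = k \<otimes> s"
  proof (rule eqI_norm[where C = "2 * q"])
    fix e :: real assume "e > 0"
    then obtain n where n: "cs_norm A (x n \<ominus> s) < e" using close by blast
    have xn: "x n \<in> carrier A" "x n \<otimes> k = k \<otimes> x n" using inv[of n] by auto
    have "cs_norm A (s \<otimes> k \<ominus> k \<otimes> s) \<le> cs_norm A (s \<otimes> k \<ominus> x n \<otimes> k) + cs_norm A (k \<otimes> x n \<ominus> k \<otimes> s)"
      using norm_diff_triangle[of "s \<otimes> k" "x n \<otimes> k" "k \<otimes> s"] s(1) xn k by simp
    also have "\<dots> \<le> cs_norm A (s \<ominus> x n) * q + q * cs_norm A (x n \<ominus> s)"
      using norm_mult[of "s \<ominus> x n" k] norm_mult[of k "x n \<ominus> s"] s(1) xn(1) k(1)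
      by (simp add: mult_diff q_def)
    also have "\<dots> = 2 * q * cs_norm A (x n \<ominus> s)"
      using norm_diff_commute[of s "x n"] s(1) xn(1) by simp
    also have "\<dots> \<le> 2 * q * e" using n q by (intro mult_left_mono) auto
    finally show "cs_norm A (s \<otimes> k \<ominus> k \<otimes> s) \<le> 2 * q * e" .
  qed (use s(1) k in auto)
  have "F s = s"
  proof (rule eqI_norm[where C = "(cs_norm A s + q) / 2 + 1"])
    fix e :: real assume "e > 0"
    then obtain n where n: "cs_norm A (x n \<ominus> s) < e" "cs_norm A (x (Suc n) \<ominus> s) < e" using close by blast
    have xn: "x n \<in> carrier A" "x (Suc n) \<in> carrier A" "cs_norm A (x n) \<le> q"
      using inv[of n] inv[of "Suc n"] by auto
    have Fs: "F s \<in> carrier A" using s(1) k by (simp add: F_def)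
    have "cs_norm A (F s \<ominus> s) \<le> cs_norm A (F s \<ominus> F (x n)) + cs_norm A (x (Suc n) \<ominus> s)"
      using norm_diff_triangle[of "F s" "x (Suc n)" s] Fs xn s(1) by (simp add: x_simps)
    also have "\<dots> \<le> (cs_norm A s + cs_norm A (x n)) / 2 * cs_norm A (s \<ominus> x n) + e"
      using lip[OF s(1) xn(1)] n by simp
    also have "\<dots> \<le> (cs_norm A s + q) / 2 * e + e"
      using n xn s(1) q norm_diff_commute[of s "x n"] norm_nonneg[OF s(1)]
      by (intro add_mono mult_mono) (auto intro!: norm_nonneg)
    finally show "cs_norm A (F s \<ominus> s) \<le> ((cs_norm A s + q) / 2 + 1) * e"
      by (simp add: algebra_simps)
  qed (use s(1) k in \<open>auto simp: F_def\<close>)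
  then have "s \<oplus> s = F s \<oplus> F s" by simp
  also have "\<dots> = (1/2 + 1/2) \<odot> (k \<otimes> k \<oplus> s \<otimes> s)"
    using k s(1) unfolding F_def by (subst scale_left_distrib) auto
  also have "\<dots> = k \<otimes> k \<oplus> s \<otimes> s"
    using k s(1) by simp
  finally show thesis using that s(1) ss comm by blast
qed

text \<open>
  The hypotheses say that \<open>l\<close> and \<open>1 - t\<close> are commuting self-adjoint elements with \<open>l\<^sup>2 + (1 - t)\<^sup>2 = 1\<close>.
  Hence \<open>l + i (1 - t)\<close> and \<open>l - i (1 - t)\<close> are unitary, and \<open>l\<close> is their mean.
\<close>

lemma (in cstar_algebra) mult_circle_norm:
  assumes l: "l \<in> carrier A" "cs_star A l = l" and t: "t \<in> carrier A" "cs_star A t = t"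
    and comm: "t \<otimes> l = l \<otimes> t" and circle: "t \<oplus> t = l \<otimes> l \<oplus> t \<otimes> t"
    and z: "z \<in> carrier A"
  shows "cs_norm A (z \<otimes> l) \<le> cs_norm A z"
proof -
  define y where "y = cs_star A z"
  define a where "a = z \<otimes> l"
  define b where "b = z \<ominus> z \<otimes> t"
  have y: "y \<in> carrier A" and a: "a \<in> carrier A" and b: "b \<in> carrier A"
    using z l t by (simp_all add: y_def a_def b_def)
  have sa: "cs_star A a = l \<otimes> y" and sb: "cs_star A b = y \<ominus> t \<otimes> y"
    using z l t by (simp_all add: y_def a_def b_def)
  have ab: "a \<otimes> cs_star A b = b \<otimes> cs_star A a"
  proof -
    have "a \<otimes> cs_star A b = z \<otimes> (l \<otimes> y) \<ominus> z \<otimes> ((l \<otimes> t) \<otimes> y)"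
      using z l t y unfolding sb by (simp add: a_def mult_diff mult_assoc)
    also have "\<dots> = b \<otimes> cs_star A a"
      using z l t y unfolding sa comm[symmetric] by (simp add: b_def mult_diff mult_assoc)
    finally show ?thesis .
  qed
  have aabb: "a \<otimes> cs_star A a \<oplus> b \<otimes> cs_star A b = z \<otimes> cs_star A z"
  proof -
    define p where "p = z \<otimes> (t \<otimes> y)"
    have p: "p \<in> carrier A" using z t y by (simp add: p_def)
    have "z \<otimes> ((t \<oplus> t) \<otimes> y) = p \<oplus> p"
      using z t y by (simp add: p_def)
    then have pp: "z \<otimes> (l \<otimes> (l \<otimes> y)) \<oplus> z \<otimes> (t \<otimes> (t \<otimes> y)) = p \<oplus> p"
      unfolding circle using z l t y by (simp add: mult_assoc)
    have "b \<otimes> cs_star A b = (z \<otimes> y \<ominus> p) \<ominus> (p \<ominus> z \<otimes> (t \<otimes> (t \<otimes> y)))"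
      using z t y unfolding sb by (simp add: b_def p_def mult_diff mult_assoc)
    also have "\<dots> = (z \<otimes> y \<ominus> (p \<oplus> p)) \<oplus> z \<otimes> (t \<otimes> (t \<otimes> y))"
      using z t y p by (simp add: minus_eq minus_add a_ac)
    finally have "a \<otimes> cs_star A a \<oplus> b \<otimes> cs_star A b =
        (z \<otimes> y \<ominus> (p \<oplus> p)) \<oplus> (z \<otimes> (l \<otimes> (l \<otimes> y)) \<oplus> z \<otimes> (t \<otimes> (t \<otimes> y)))"
      using z l t y p unfolding sa by (simp add: a_def mult_assoc a_ac)
    then show ?thesis
      unfolding pp using z y p by (simp add: diff_add_cancel y_def)
  qed
  have norm_eq: "cs_norm A (a \<oplus> u \<odot> b) = cs_norm A z" if u: "cnj u = - u" "u * u = -1" for u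
  proof -
    have star: "cs_star A (a \<oplus> u \<odot> b) = cs_star A a \<ominus> u \<odot> cs_star A b"
      using a b by (simp add: u(1) diff_eq_scale)
    have "(a \<oplus> u \<odot> b) \<otimes> cs_star A (a \<oplus> u \<odot> b) =
        (a \<otimes> cs_star A a \<ominus> u \<odot> (a \<otimes> cs_star A b)) \<oplus> (u \<odot> (b \<otimes> cs_star A a) \<oplus> b \<otimes> cs_star A b)"
      unfolding star using a b u(2) by (simp add: mult_diff diff_eq_scale) (simp add: a_ac)
    also have "\<dots> = (a \<otimes> cs_star A a \<ominus> u \<odot> (b \<otimes> cs_star A a)) \<oplus> u \<odot> (b \<otimes> cs_star A a) \<oplus> b \<otimes> cs_star A b"
      unfolding ab using a b by (simp add: a_assoc)
    also have "\<dots> = z \<otimes> cs_star A z"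
      using a b by (simp add: diff_add_cancel aabb)
    finally have "(cs_norm A (a \<oplus> u \<odot> b))\<^sup>2 = (cs_norm A z)\<^sup>2"
      using cstar_identity'[of "a \<oplus> u \<odot> b"] cstar_identity'[OF z] a b by simp
    then show ?thesis
      using a b z by (simp add: norm_nonneg)
  qed
  have "a = (1/2) \<odot> ((a \<oplus> \<i> \<odot> b) \<oplus> (a \<oplus> (- \<i>) \<odot> b))"
  proof -
    have "(a \<oplus> \<i> \<odot> b) \<oplus> (a \<oplus> (- \<i>) \<odot> b) = (a \<oplus> a) \<oplus> (\<i> + - \<i>) \<odot> b"
      using a b by (subst scale_left_distrib) (simp_all add: a_ac)
    also have "\<dots> = (1 + 1) \<odot> a"
      using a b by (subst scale_left_distrib) simp_all
    finally show ?thesis using a by simp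
  qed
  then have "cs_norm A a = 1/2 * cs_norm A ((a \<oplus> \<i> \<odot> b) \<oplus> (a \<oplus> (- \<i>) \<odot> b))"
    using a b norm_smult[of "(a \<oplus> \<i> \<odot> b) \<oplus> (a \<oplus> (- \<i>) \<odot> b)" "1/2"] by simp
  also have "\<dots> \<le> 1/2 * (cs_norm A (a \<oplus> \<i> \<odot> b) + cs_norm A (a \<oplus> (- \<i>) \<odot> b))"
    using a b by (intro mult_left_mono norm_triangle) auto
  also have "\<dots> = cs_norm A z"
    by (simp add: norm_eq)
  finally show ?thesis by (simp add: a_def)
qed

text \<open>
  The equation of \<open>half_circle_root\<close> is purely algebraic, so \<open>f\<close> carries it from \<open>A\<close> to \<open>B\<close>: for
  self-adjoint \<open>k\<close>, \<open>\<parallel>k\<parallel> < 1\<close> implies \<open>\<parallel>f k\<parallel> \<le> 1\<close>. The general case follows from the C*-identity.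
\<close>

lemma star_hom_contractive:
  assumes A: "cstar_algebra A" and B: "cstar_algebra B" and f: "star_hom A B f"
    and x: "x \<in> carrier A"
  shows "cs_norm B (f x) \<le> cs_norm A x"
proof -
  interpret A: cstar_algebra A by fact
  interpret B: cstar_algebra B by fact
  note h = star_homD[OF f]
  have unit: "cs_norm B (f k) \<le> 1"
    if k: "k \<in> carrier A" "cs_star A k = k" "cs_norm A k < 1" for k
  proof -
    obtain s where s: "s \<in> carrier A" "cs_star A s = s" "s \<otimes>\<^bsub>A\<^esub> k = k \<otimes>\<^bsub>A\<^esub> s"
      "s \<oplus>\<^bsub>A\<^esub> s = k \<otimes>\<^bsub>A\<^esub> k \<oplus>\<^bsub>A\<^esub> s \<otimes>\<^bsub>A\<^esub> s"
      using A.half_circle_root[OF k] by blast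
    have fk: "f k \<in> carrier B" "cs_star B (f k) = f k"
      using h(1)[OF k(1)] h(4)[OF k(1)] k(2) by simp_all
    have "cs_norm B (f k \<otimes>\<^bsub>B\<^esub> f k) \<le> cs_norm B (f k)"
    proof (rule B.mult_circle_norm[where t = "f s"])
      show "f s \<otimes>\<^bsub>B\<^esub> f k = f k \<otimes>\<^bsub>B\<^esub> f s"
        using h(3)[OF s(1) k(1)] h(3)[OF k(1) s(1)] s(3) by simp
      show "f s \<oplus>\<^bsub>B\<^esub> f s = f k \<otimes>\<^bsub>B\<^esub> f k \<oplus>\<^bsub>B\<^esub> f s \<otimes>\<^bsub>B\<^esub> f s"
        using h(2)[OF s(1) s(1)] s(1,4) k(1) by (simp add: h)
      show "f s \<in> carrier B" "cs_star B (f s) = f s"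
        using h(1)[OF s(1)] h(4)[OF s(1)] s(2) by simp_all
    qed (fact fk)+
    then have "(cs_norm B (f k))\<^sup>2 \<le> cs_norm B (f k)"
      using B.cstar_identity[OF fk(1)] fk(2) by simp
    then show ?thesis
      using B.norm_nonneg[OF fk(1)] by (cases "cs_norm B (f k) = 0") (auto simp: power2_eq_square)
  qed
  have sa: "cs_norm B (f k) \<le> cs_norm A k" if k: "k \<in> carrier A" "cs_star A k = k" for k
  proof (rule dense_le)
    show "c \<le> cs_norm A k" if c: "c < cs_norm B (f k)" for c
    proof (rule ccontr)
      assume "\<not> c \<le> cs_norm A k"
      then have c0: "cs_norm A k < c" "c > 0" using A.norm_nonneg[OF k(1)] by auto
      have "cs_norm B (f (complex_of_real (1/c) \<odot>\<^bsub>A\<^esub> k)) \<le> 1"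
        using k c0 by (intro unit) (simp_all add: A.norm_smult norm_divide)
      then have "cs_norm B (f k) \<le> c"
        using k c0 h(1,5) by (simp add: B.norm_smult norm_divide)
      then show False using c by simp
    qed
  qed
  have "(cs_norm B (f x))\<^sup>2 = cs_norm B (f (cs_star A x \<otimes>\<^bsub>A\<^esub> x))"
    using x h(1,3,4) B.cstar_identity[of "f x"] by simp
  also have "\<dots> \<le> cs_norm A (cs_star A x \<otimes>\<^bsub>A\<^esub> x)"
    using x by (intro sa) auto
  also have "\<dots> = (cs_norm A x)\<^sup>2"
    using x by (simp add: A.cstar_identity)
  finally show ?thesis
    by (rule power2_le_imp_le) (use x in \<open>simp add: A.norm_nonneg\<close>)
qed

section \<open>Isomorphisms and ideals\<close>

text \<open>
  The image is closed since the inverse of \<open>f\<close> is contractive.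
\<close>

lemma star_iso_image_ideal:
  assumes A: "cstar_algebra A" and B: "cstar_algebra B"
    and f: "star_hom A B f" "bij_betw f (carrier A) (carrier B)" and I: "I \<in> ideals A"
  shows "f ` I \<in> ideals B"
proof -
  interpret A: cstar_algebra A by fact
  interpret B: cstar_algebra B by fact
  define g where "g = inv_into (carrier A) f"
  have g: "star_hom B A g" "\<And>x. x \<in> carrier A \<Longrightarrow> g (f x) = x" "\<And>y. y \<in> carrier B \<Longrightarrow> f (g y) = y"
    using star_hom_inverse[OF A f] by (simp_all add: g_def)
  note hf = star_homD[OF f(1)] and hg = star_homD[OF g(1)]
  have IA: "I \<subseteq> carrier A" by (rule A.ideal_subset[OF I])
  have mem: "y \<in> f ` I \<longleftrightarrow> y \<in> carrier B \<and> g y \<in> I" for y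
  proof
    show "y \<in> f ` I" if "y \<in> carrier B \<and> g y \<in> I"
      using that g(3)[of y] by (metis imageI)
    show "y \<in> carrier B \<and> g y \<in> I" if "y \<in> f ` I"
      using that IA g(2) hf(1) by auto
  qed
  have "alg_ideal A I" by (rule A.ideal_alg_ideal[OF I])
  then have "alg_ideal B (f ` I)"
    unfolding alg_ideal_def mem Ball_def subset_iff
    using hg star_hom_diff_zero(1)[OF B A g(1)] by auto
  moreover have "y \<in> f ` I"
    if y: "y \<in> carrier B" and lim: "\<forall>e>0. \<exists>w\<in>f ` I. cs_norm B (y \<ominus>\<^bsub>B\<^esub> w) < e" for y
  proof -
    have "g y \<in> I"
    proof (rule A.ideal_limit[OF I hg(1)[OF y]])
      fix e :: real assume "e > 0"
      then obtain w where w: "w \<in> carrier B" "g w \<in> I" "cs_norm B (y \<ominus>\<^bsub>B\<^esub> w) < e"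
        using lim mem by blast
      have "cs_norm A (g (y \<ominus>\<^bsub>B\<^esub> w)) \<le> cs_norm B (y \<ominus>\<^bsub>B\<^esub> w)"
        by (rule star_hom_contractive[OF B A g(1)]) (use y w in auto)
      then have "cs_norm A (g y \<ominus>\<^bsub>A\<^esub> g w) < e"
        using w(3) star_hom_diff_zero(2)[OF B A g(1) y w(1)] by simp
      then show "\<exists>w\<in>I. cs_norm A (g y \<ominus>\<^bsub>A\<^esub> w) < e" using w(2) by blast
    qed
    then show ?thesis using y mem by blast
  qed
  ultimately show ?thesis
    by (simp add: B.in_ideals_iff)
qed

lemma quot_quot_iso:
  assumes A: "cstar_algebra A" and I: "I \<in> ideals A" and K: "K \<in> ideals A" "I \<subseteq> K"
  shows "star_isomorphic (quot_alg A K) (quot_alg (quot_alg A I) (coset_rep A I ` K))"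
proof -
  interpret A: cstar_algebra A by fact
  let ?B = "quot_alg A I" and ?L = "coset_rep A I ` K"
  have B: "cstar_algebra ?B" by (rule A.quot_alg_cstar[OF I])
  then interpret B: cstar_algebra ?B .
  have L: "?L \<in> ideals ?B" by (rule A.ideal_quot_image[OF I K])
  note q1 = quot_hom[OF A I] and q2 = quot_hom[OF B L]
  show ?thesis
  proof (rule first_isomorphism[OF A B.quot_alg_cstar[OF L] K(1) star_hom_comp[OF q1 q2]])
    show "(\<lambda>x. coset_rep ?B ?L (coset_rep A I x)) ` carrier A = carrier (quot_alg ?B ?L)"
      unfolding B.quot_alg_simps(1)[OF L] A.quot_alg_simps(1)[OF I] by (simp add: image_image)
    fix x assume x: "x \<in> carrier A"
    then show "coset_rep ?B ?L (coset_rep A I x) = \<zero>\<^bsub>quot_alg ?B ?L\<^esub> \<longleftrightarrow> x \<in> K"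
      unfolding B.quot_alg_simps(2)[OF L]
      using B.rep_eq_zero_iff[OF L star_homD(1)[OF q1 x]] A.ideal_quot_image(2)[OF I K x] by simp
  qed
qed

lemma star_iso_quot:
  assumes A: "cstar_algebra A" and B: "cstar_algebra B"
    and f: "star_hom A B f" "bij_betw f (carrier A) (carrier B)" and I: "I \<in> ideals A"
  shows "star_isomorphic (quot_alg A I) (quot_alg B (f ` I))"
proof -
  interpret A: cstar_algebra A by fact
  interpret B: cstar_algebra B by fact
  have L: "f ` I \<in> ideals B" by (rule star_iso_image_ideal[OF A B f I])
  note q = quot_hom[OF B L]
  have surj: "f ` carrier A = carrier B" and inj: "inj_on f (carrier A)"
    using f(2) by (simp_all add: bij_betw_def)
  show ?thesis
  proof (rule first_isomorphism[OF A B.quot_alg_cstar[OF L] I star_hom_comp[OF f(1) q]])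
    show "(\<lambda>x. coset_rep B (f ` I) (f x)) ` carrier A = carrier (quot_alg B (f ` I))"
      unfolding B.quot_alg_simps(1)[OF L] surj[symmetric] by (simp add: image_image)
    fix x assume x: "x \<in> carrier A"
    have "f x \<in> f ` I \<longleftrightarrow> x \<in> I"
      using inj_on_image_mem_iff[OF inj x A.ideal_subset[OF I]] .
    then show "coset_rep B (f ` I) (f x) = \<zero>\<^bsub>quot_alg B (f ` I)\<^esub> \<longleftrightarrow> x \<in> I"
      unfolding B.quot_alg_simps(2)[OF L]
      using B.rep_eq_zero_iff[OF L star_homD(1)[OF f(1) x]] by simp
  qed
qed

lemma quot_zero_iso:
  assumes A: "cstar_algebra A"
  shows "star_isomorphic (quot_alg A {\<zero>\<^bsub>A\<^esub>}) A"
  using A by (intro first_isomorphism[where f = "\<lambda>x. x"] cstar_algebra.zero_ideal) (auto simp: star_hom_def)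

section \<open>The operator G\<close>

lemma llD:
  assumes "ll P A I J"
  shows "I \<in> ideals A" "J \<in> ideals A" "I \<subseteq> J" "quot_alg (ideal_alg A J) I \<in> P"
  using assms by (simp_all add: ll_def)

text \<open>
  The non-zero ideals of \<open>A/I\<close> are the \<open>J/I\<close> with \<open>J\<close> strictly above \<open>I\<close>, and \<open>A/I\<close> is zero exactly
  for \<open>I = A\<close>.
\<close>

lemma GP_iff:
  "A \<in> GP P \<longleftrightarrow> cstar_algebra A \<and>
    (\<forall>I\<in>ideals A. I \<noteq> carrier A \<longrightarrow> (\<exists>J. ll P A I J \<and> J \<noteq> I))"
proof (cases "cstar_algebra A")
  case True
  then interpret A: cstar_algebra A .
  have quot_zero: "zero_algebra (quot_alg A I) \<longleftrightarrow> I = carrier A" if I: "I \<in> ideals A" for I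
  proof -
    have "zero_algebra (quot_alg A I) \<longleftrightarrow> (\<forall>x\<in>carrier A. coset_rep A I x = coset_rep A I \<zero>\<^bsub>A\<^esub>)"
      unfolding zero_algebra_def A.quot_alg_simps[OF I] using A.zero_closed by auto
    also have "\<dots> \<longleftrightarrow> carrier A \<subseteq> I" by (auto simp: A.rep_eq_zero_iff[OF I])
    finally show ?thesis using A.ideal_subset[OF I] by auto
  qed
  have ex: "(\<exists>L\<in>ideals (quot_alg A I). L \<noteq> {\<zero>\<^bsub>quot_alg A I\<^esub>} \<and> ideal_alg (quot_alg A I) L \<in> P) \<longleftrightarrow>
      (\<exists>J. ll P A I J \<and> J \<noteq> I)" if I: "I \<in> ideals A" for I
  proof
    assume "\<exists>L\<in>ideals (quot_alg A I). L \<noteq> {\<zero>\<^bsub>quot_alg A I\<^esub>} \<and> ideal_alg (quot_alg A I) L \<in> P"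
    then obtain L where L: "L \<in> ideals (quot_alg A I)" "L \<noteq> {\<zero>\<^bsub>quot_alg A I\<^esub>}"
      "ideal_alg (quot_alg A I) L \<in> P" by blast
    obtain J where J: "J \<in> ideals A" "I \<subseteq> J" "L = coset_rep A I ` J"
      using A.ideal_quot_preimage[OF I L(1)] by blast
    have "coset_rep A I ` I = {\<zero>\<^bsub>quot_alg A I\<^esub>}"
      unfolding A.quot_alg_simps(2)[OF I] using A.idealD(1,2)[OF I] A.rep_eq_zero_iff[OF I] by auto
    then have "J \<noteq> I" using L(2) J(3) by auto
    moreover have "ll P A I J"
      using I J L(3) by (simp add: ll_def ideal_alg_quot_alg)
    ultimately show "\<exists>J. ll P A I J \<and> J \<noteq> I" by blast
  next
    assume "\<exists>J. ll P A I J \<and> J \<noteq> I"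
    then obtain J where J: "ll P A I J" "J \<noteq> I" by blast
    note l = llD[OF J(1)]
    let ?L = "coset_rep A I ` J"
    have "?L \<noteq> {\<zero>\<^bsub>quot_alg A I\<^esub>}"
    proof
      assume "?L = {\<zero>\<^bsub>quot_alg A I\<^esub>}"
      then have "x \<in> I" if "x \<in> J" for x
        using that A.idealD(1)[OF l(2) that] A.rep_eq_zero_iff[OF I, of x]
        by (auto simp: A.quot_alg_simps(2)[OF I])
      then show False using l(3) J(2) by blast
    qed
    then show "\<exists>L\<in>ideals (quot_alg A I). L \<noteq> {\<zero>\<^bsub>quot_alg A I\<^esub>} \<and> ideal_alg (quot_alg A I) L \<in> P"
      using A.ideal_quot_image(1)[OF I l(2,3)] l(4) by (intro bexI[of _ ?L]) (simp_all add: ideal_alg_quot_alg)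
  qed
  have "I = carrier A" if "zero_algebra A" "I \<in> ideals A" for I
    using that A.idealD(2)[OF that(2)] A.ideal_subset[OF that(2)] by (auto simp: zero_algebra_def)
  then show ?thesis
    unfolding GP_def using True quot_zero ex by auto
qed (simp add: GP_def)

lemma P_upD:
  assumes "P \<in> P_up"
  shows "\<And>A. A \<in> P \<Longrightarrow> cstar_algebra A"
    and "\<And>A B. A \<in> P \<Longrightarrow> cstar_algebra B \<Longrightarrow> star_isomorphic A B \<Longrightarrow> B \<in> P"
    and "\<And>A I. A \<in> P \<Longrightarrow> I \<in> ideals A \<Longrightarrow> quot_alg A I \<in> P"
proof -
  note a = assms[unfolded P_up_def mem_Collect_eq]
  note b = a[THEN conjunct1, unfolded cstar_property_def]
  show "cstar_algebra A" if "A \<in> P" for A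
    using that by (rule b[THEN conjunct1, rule_format])
  show "B \<in> P" if "A \<in> P" "cstar_algebra B" "star_isomorphic A B" for A B
    by (rule b[THEN conjunct2, THEN conjunct2, rule_format, of A]) (intro conjI that)
  show "quot_alg A I \<in> P" if "A \<in> P" "I \<in> ideals A" for A I
    using that by (rule a[THEN conjunct2, rule_format])
qed

text \<open>
  The isomorphism carries the ideals \<open>I \<subset> J\<close> and the subquotient \<open>J/I\<close> from one algebra to the other.
\<close>

lemma GP_star_isomorphic:
  assumes P: "P \<in> P_up" and A: "A \<in> GP P" and B: "cstar_algebra B" and iso: "star_isomorphic A B"
  shows "B \<in> GP P"
  unfolding GP_iff
proof (intro conjI B ballI impI)
  have Ac: "cstar_algebra A" using A by (simp add: GP_iff)
  interpret A: cstar_algebra A by fact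
  interpret B: cstar_algebra B by fact
  obtain f where f: "star_hom A B f" "bij_betw f (carrier A) (carrier B)"
    using iso unfolding star_isomorphic_iff_hom by blast
  define g where "g = inv_into (carrier A) f"
  have g: "star_hom B A g" "bij_betw g (carrier B) (carrier A)" "\<And>y. y \<in> carrier B \<Longrightarrow> f (g y) = y"
    using star_hom_inverse[OF Ac f] by (simp_all add: g_def)
  fix I assume I: "I \<in> ideals B" "I \<noteq> carrier B"
  let ?I = "g ` I"
  have fI: "f ` ?I = I"
  proof -
    have "f (g y) = y" if "y \<in> I" for y using g(3) B.idealD(1)[OF I(1) that] by simp
    then show ?thesis by (simp add: image_image)
  qed
  have I': "?I \<in> ideals A" by (rule star_iso_image_ideal[OF B Ac g(1,2) I(1)])
  moreover have "?I \<noteq> carrier A" using fI f(2) I(2) by (auto simp: bij_betw_def)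
  ultimately obtain J where J: "ll P A ?I J" "J \<noteq> ?I"
    using A[unfolded GP_iff, THEN conjunct2, rule_format, of ?I] by blast
  note l = llD[OF J(1)]
  have fJ: "f ` J \<in> ideals B" by (rule star_iso_image_ideal[OF Ac B f l(2)])
  have JA: "J \<subseteq> carrier A" by (rule A.ideal_subset[OF l(2)])
  have hom: "star_hom (ideal_alg A J) (ideal_alg B (f ` J)) f"
    using star_homD[OF f(1)] A.idealD(1)[OF l(2)] by (simp add: star_hom_def)
  have bij: "bij_betw f (carrier (ideal_alg A J)) (carrier (ideal_alg B (f ` J)))"
    using f(2) JA inj_on_subset[of f "carrier A" J] by (simp add: bij_betw_def)
  have AJ: "cstar_algebra (ideal_alg A J)" by (rule A.ideal_alg_cstar[OF l(2)])
  have BJ: "cstar_algebra (ideal_alg B (f ` J))" by (rule B.ideal_alg_cstar[OF fJ])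
  have IJ: "?I \<in> ideals (ideal_alg A J)"
    using l by (simp add: A.ideals_ideal_alg[OF l(2)])
  have "I \<subseteq> f ` J" using fI l(3) by auto
  have "quot_alg (ideal_alg B (f ` J)) I \<in> P"
  proof (rule P_upD(2)[OF P l(4)])
    show "star_isomorphic (quot_alg (ideal_alg A J) ?I) (quot_alg (ideal_alg B (f ` J)) I)"
      using star_iso_quot[OF AJ BJ hom bij IJ] unfolding fI .
    have "I \<in> ideals (ideal_alg B (f ` J))"
      using star_iso_image_ideal[OF AJ BJ hom bij IJ] unfolding fI .
    then show "cstar_algebra (quot_alg (ideal_alg B (f ` J)) I)"
      by (rule cstar_algebra.quot_alg_cstar[OF BJ])
  qed
  then have "ll P B I (f ` J)"
    using I(1) fJ \<open>I \<subseteq> f ` J\<close> by (simp add: ll_def)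
  moreover have "f ` J \<noteq> I"
  proof
    assume "f ` J = I"
    then have "f ` J = f ` ?I" using fI by simp
    then have "J = ?I"
      using inj_on_image_eq_iff[of f "carrier A" J ?I] f(2) JA A.ideal_subset[OF I']
      by (simp add: bij_betw_def)
    then show False using J(2) by simp
  qed
  ultimately show "\<exists>J. ll P B I J \<and> J \<noteq> I" by blast
qed

text \<open>
  An ideal of \<open>A/I\<close> is \<open>K/I\<close>; the ideal \<open>J\<close> strictly above \<open>K\<close> with \<open>J/K \<in> P\<close> yields \<open>J/I\<close>, because
  \<open>(J/I)/(K/I)\<close> is isomorphic to \<open>J/K\<close>.
\<close>

lemma GP_quot:
  assumes P: "P \<in> P_up" and A: "A \<in> GP P" and I: "I \<in> ideals A"
  shows "quot_alg A I \<in> GP P"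
proof -
  have Ac: "cstar_algebra A" using A by (simp add: GP_iff)
  interpret A: cstar_algebra A by fact
  let ?B = "quot_alg A I"
  have B: "cstar_algebra ?B" by (rule A.quot_alg_cstar[OF I])
  then interpret B: cstar_algebra ?B .
  have "\<exists>M. ll P ?B L M \<and> M \<noteq> L" if L: "L \<in> ideals ?B" "L \<noteq> carrier ?B" for L
  proof -
    obtain K where K: "K \<in> ideals A" "I \<subseteq> K" "L = coset_rep A I ` K"
      using A.ideal_quot_preimage[OF I L(1)] by blast
    have "K \<noteq> carrier A" using L(2) K(3) by (auto simp: A.quot_alg_simps(1)[OF I])
    then obtain J where J: "ll P A K J" "J \<noteq> K"
      using A[unfolded GP_iff, THEN conjunct2, rule_format, of K] K(1) by blast
    note l = llD[OF J(1)]
    have IJ: "I \<subseteq> J" using K(2) l(3) by blast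
    let ?M = "coset_rep A I ` J"
    have M: "?M \<in> ideals ?B" by (rule A.ideal_quot_image[OF I l(2) IJ])
    have LM: "L \<subseteq> ?M" using K(3) l(3) by blast
    have AJ: "cstar_algebra (ideal_alg A J)" by (rule A.ideal_alg_cstar[OF l(2)])
    have rep: "coset_rep (ideal_alg A J) I = coset_rep A I"
      by (simp add: coset_rep_def a_r_coset_def' fun_eq_iff)
    have "star_isomorphic (quot_alg (ideal_alg A J) K)
        (quot_alg (quot_alg (ideal_alg A J) I) (coset_rep (ideal_alg A J) I ` K))"
      using I K l IJ by (intro quot_quot_iso[OF AJ]) (simp_all add: A.ideals_ideal_alg[OF l(2)])
    then have "star_isomorphic (quot_alg (ideal_alg A J) K) (quot_alg (ideal_alg ?B ?M) L)"
      by (simp add: rep ideal_alg_quot_alg K(3))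
    moreover have "cstar_algebra (quot_alg (ideal_alg ?B ?M) L)"
      using L(1) LM by (intro cstar_algebra.quot_alg_cstar[OF B.ideal_alg_cstar[OF M]])
        (simp add: B.ideals_ideal_alg[OF M])
    ultimately have "quot_alg (ideal_alg ?B ?M) L \<in> P"
      using P_upD(2)[OF P l(4)] by blast
    then have "ll P ?B L ?M" using L(1) M LM by (simp add: ll_def)
    moreover have "?M \<noteq> L"
    proof
      assume "?M = L"
      then have "x \<in> K" if "x \<in> J" for x
        using that A.ideal_quot_image(2)[OF I K(1,2), of x] A.idealD(1)[OF l(2) that] K(3) by blast
      then show False using l(3) J(2) by blast
    qed
    ultimately show ?thesis by blast
  qed
  then show ?thesis using B unfolding GP_iff by blast
qed

lemma GP_in_P_up:
  assumes P: "P \<in> P_up"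
  shows "GP P \<in> P_up"
proof -
  have "\<forall>A\<in>GP P. cstar_algebra A" "\<forall>A. cstar_algebra A \<and> zero_algebra A \<longrightarrow> A \<in> GP P"
    by (simp_all add: GP_def)
  then show ?thesis
    unfolding P_up_def cstar_property_def mem_Collect_eq
    using GP_star_isomorphic[OF P] GP_quot[OF P] by (intro conjI) (assumption, assumption, metis, metis)
qed

lemma subset_GP:
  assumes P: "P \<in> P_up"
  shows "P \<subseteq> GP P"
proof
  fix A assume A: "A \<in> P"
  interpret A: cstar_algebra A by (rule P_upD(1)[OF P A])
  have "ll P A I (carrier A)" if "I \<in> ideals A" for I
    using that P_upD(3)[OF P A that] A.carrier_ideal A.ideal_subset by (simp add: ll_def)
  then show "A \<in> GP P"
    unfolding GP_iff using A.cstar_algebra_axioms by blast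
qed

lemma GP_mono: "P \<subseteq> P1 \<Longrightarrow> GP P \<subseteq> GP P1"
  unfolding GP_def by blast

text \<open>
  Given \<open>J/I \<in> GP P\<close> with \<open>J \<noteq> I\<close>, apply the property of \<open>J/I\<close> to its zero ideal. The resulting ideal is
  \<open>K/I\<close> for an ideal \<open>K\<close> of \<open>J\<close>, and \<open>K\<close> is an ideal of \<open>A\<close>.
\<close>

lemma GP_GP_subset:
  assumes P: "P \<in> P_up"
  shows "GP (GP P) \<subseteq> GP P"
proof
  fix A assume A: "A \<in> GP (GP P)"
  then have Ac: "cstar_algebra A" by (simp add: GP_iff)
  interpret A: cstar_algebra A by fact
  have "\<exists>K. ll P A I K \<and> K \<noteq> I" if I: "I \<in> ideals A" "I \<noteq> carrier A" for I
  proof -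
    obtain J where J: "ll (GP P) A I J" "J \<noteq> I"
      using A[unfolded GP_iff, THEN conjunct2, rule_format, of I] I by blast
    note l = llD[OF J(1)]
    let ?J = "ideal_alg A J" and ?C = "quot_alg (ideal_alg A J) I"
    interpret J: cstar_algebra ?J by (rule A.ideal_alg_cstar[OF l(2)])
    have IJ: "I \<in> ideals ?J" using l by (simp add: A.ideals_ideal_alg[OF l(2)])
    have C: "cstar_algebra ?C" by (rule J.quot_alg_cstar[OF IJ])
    then interpret C: cstar_algebra ?C .
    have "{\<zero>\<^bsub>?C\<^esub>} \<noteq> carrier ?C"
    proof
      assume eq: "{\<zero>\<^bsub>?C\<^esub>} = carrier ?C"
      have "x \<in> I" if "x \<in> J" for x
      proof -
        have x: "x \<in> carrier ?J" using that by simp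
        then have "coset_rep ?J I x \<in> {\<zero>\<^bsub>?C\<^esub>}"
          unfolding eq J.quot_alg_simps(1)[OF IJ] by (rule imageI)
        then show ?thesis using J.rep_eq_zero_iff[OF IJ x] by (simp add: J.quot_alg_simps(2)[OF IJ])
      qed
      then show False using l(3) J(2) by blast
    qed
    then obtain L where L: "ll P ?C {\<zero>\<^bsub>?C\<^esub>} L" "L \<noteq> {\<zero>\<^bsub>?C\<^esub>}"
      using l(4)[unfolded GP_iff, THEN conjunct2, rule_format, OF C.zero_ideal] by blast
    note lL = llD[OF L(1)]
    have CL: "cstar_algebra (ideal_alg ?C L)" by (rule C.ideal_alg_cstar[OF lL(2)])
    have "ideal_alg ?C L \<in> P"
      using P_upD(2)[OF P lL(4) CL] quot_zero_iso[OF CL] by simp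
    obtain K where K: "K \<in> ideals ?J" "I \<subseteq> K" "L = coset_rep ?J I ` K"
      using J.ideal_quot_preimage[OF IJ lL(2)] by blast
    have "K \<in> ideals A" using A.ideal_of_ideal[OF l(2) K(1)] .
    moreover have "quot_alg (ideal_alg A K) I \<in> P"
      using \<open>ideal_alg ?C L \<in> P\<close> unfolding K(3) ideal_alg_quot_alg by simp
    ultimately have "ll P A I K" using I(1) K(2) by (simp add: ll_def)
    moreover have "K \<noteq> I"
    proof
      assume "K = I"
      then have "L = {\<zero>\<^bsub>?C\<^esub>}"
        unfolding K(3) J.quot_alg_simps(2)[OF IJ]
        using J.idealD(1,2)[OF IJ] J.rep_eq_zero_iff[OF IJ] by auto
      then show False using L(2) by simp
    qed
    ultimately show ?thesis by blast
  qed
  then show "A \<in> GP P" using Ac unfolding GP_iff by blast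
qed

section \<open>The second isomorphism theorem\<close>

lemma (in cstar_algebra) ideal_quot_norm:
  assumes "N \<in> ideals A"
  shows "cstar_algebra.quot_norm (ideal_alg A N) M x = quot_norm M x"
  using cstar_algebra.quot_norm_def[OF ideal_alg_cstar[OF assms]]
  by (simp add: quot_norm_def a_r_coset_def')

lemma (in cstar_algebra) alg_ideal_sum:
  assumes N: "N \<in> ideals A" and L: "L \<in> ideals A"
  shows "alg_ideal A {n \<oplus> l | n l. n \<in> N \<and> l \<in> L}" (is "alg_ideal A ?S")
proof -
  have c: "n \<in> carrier A" "l \<in> carrier A" if "n \<in> N" "l \<in> L" for n l
    using that idealD(1)[OF N] idealD(1)[OF L] by simp_all
  have I: "n \<oplus> l \<in> ?S" if "n \<in> N" "l \<in> L" for n l using that by blast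
  have "\<zero> \<in> ?S" using I[OF idealD(2)[OF N] idealD(2)[OF L]] by simp
  moreover have "(n \<oplus> l) \<oplus> (n' \<oplus> l') \<in> ?S" if "n \<in> N" "l \<in> L" "n' \<in> N" "l' \<in> L" for n l n' l'
  proof -
    have "(n \<oplus> l) \<oplus> (n' \<oplus> l') = (n \<oplus> n') \<oplus> (l \<oplus> l')"
      using c that by (simp add: a_ac)
    then show ?thesis using I[OF idealD(3)[OF N] idealD(3)[OF L]] that by simp
  qed
  moreover have "c' \<odot> (n \<oplus> l) \<in> ?S" if "n \<in> N" "l \<in> L" for c' n l
    using I[OF idealD(4)[OF N that(1), of c'] idealD(4)[OF L that(2), of c']] c that by simp
  moreover have "a \<otimes> (n \<oplus> l) \<in> ?S" "(n \<oplus> l) \<otimes> a \<in> ?S" if "n \<in> N" "l \<in> L" "a \<in> carrier A" for a n l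
    using I[OF idealD(5)[OF N that(1,3)] idealD(5)[OF L that(2,3)]]
      I[OF idealD(6)[OF N that(1,3)] idealD(6)[OF L that(2,3)]] c that by simp_all
  moreover have "n \<oplus> l \<in> carrier A" if "n \<in> N" "l \<in> L" for n l using c that by simp
  ultimately show ?thesis
    unfolding alg_ideal_def by (intro conjI) (safe, simp_all)
qed

text \<open>
  For \<open>n \<in> N\<close> and \<open>l \<in> L\<close>, let \<open>e \<in> N\<close> be an approximate unit for \<open>n\<close>. Then \<open>l e \<in> N \<inter> L\<close>, and \<open>n + l e\<close>
  is close to \<open>(n + l) e\<close>, whose norm is at most about twice the norm of \<open>n + l\<close>. The constant is not
  optimal; an estimate with some constant is enough to compare Cauchy sequences.
\<close>

lemma (in cstar_algebra) quot_norm_inter_le: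
  assumes N: "N \<in> ideals A" and L: "L \<in> ideals A" and n: "n \<in> N"
  shows "quot_norm (N \<inter> L) n \<le> 3 * quot_norm L n"
proof -
  have nc: "n \<in> carrier A" by (rule idealD(1)[OF N n])
  have NL: "N \<inter> L \<in> ideals A" by (rule inter_ideal[OF N L])
  have "quot_norm (N \<inter> L) n / 3 \<le> quot_norm L n"
  proof (rule quot_norm_greatest[OF L nc])
    fix l assume l: "l \<in> L"
    have lc: "l \<in> carrier A" by (rule idealD(1)[OF L l])
    have "quot_norm (N \<inter> L) n \<le> 3 * cs_norm A (n \<oplus> l)"
    proof (rule field_le_epsilon)
      fix d :: real assume "d > 0"
      define \<epsilon> where "\<epsilon> = min 1 d"
      have \<epsilon>: "\<epsilon> > 0" "\<epsilon> \<le> 1" "\<epsilon> \<le> d" using \<open>d > 0\<close> by (auto simp: \<epsilon>_def)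
      obtain e where e: "e \<in> N" "cs_norm A (n \<ominus> n \<otimes> e) < \<epsilon>"
        "\<And>z. z \<in> carrier A \<Longrightarrow> cs_norm A (z \<ominus> z \<otimes> e) \<le> (1 + \<epsilon>) * cs_norm A z"
        using approximate_unit[OF ideal_alg_ideal[OF N] n \<epsilon>(1)] by blast
      have ec: "e \<in> carrier A" by (rule idealD(1)[OF N e(1)])
      define w where "w = n \<oplus> l"
      have w: "w \<in> carrier A" using nc lc by (simp add: w_def)
      have "l \<otimes> e \<in> N \<inter> L"
        using idealD(5)[OF N e(1) lc] idealD(6)[OF L l ec] by simp
      then have "quot_norm (N \<inter> L) n \<le> cs_norm A (n \<oplus> l \<otimes> e)"
        by (rule quot_norm_le[OF NL nc])
      also have "n \<oplus> l \<otimes> e = (n \<ominus> n \<otimes> e) \<oplus> w \<otimes> e"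
        using nc lc ec by (simp add: w_def a_assoc[symmetric] diff_add_cancel)
      also have "cs_norm A \<dots> \<le> cs_norm A (n \<ominus> n \<otimes> e) + cs_norm A (w \<otimes> e)"
        using nc w ec by (intro norm_triangle) auto
      also have "cs_norm A (w \<otimes> e) \<le> cs_norm A w + cs_norm A (w \<otimes> e \<ominus> w)"
        using w ec by (intro norm_le_add_diff) auto
      also have "cs_norm A (w \<otimes> e \<ominus> w) \<le> (1 + \<epsilon>) * cs_norm A w"
        using e(3)[OF w] norm_diff_commute[of w "w \<otimes> e"] w ec by simp
      also have "(1 + \<epsilon>) * cs_norm A w \<le> 2 * cs_norm A w"
        using \<epsilon> norm_nonneg[OF w] by (intro mult_right_mono) auto
      finally show "quot_norm (N \<inter> L) n \<le> 3 * cs_norm A (n \<oplus> l) + d"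
        using e(2) \<epsilon>(3) by (simp add: w_def)
    qed
    then show "quot_norm (N \<inter> L) n / 3 \<le> cs_norm A (n \<oplus> l)" by simp
  qed
  then show ?thesis by simp
qed

text \<open>
  The closure of \<open>N + L\<close> makes \<open>K\<close> an ideal at once; that every \<open>x \<in> K\<close> is congruent to an element
  of \<open>N\<close> modulo \<open>L\<close> is then the surjectivity part of the isomorphism. If elements of \<open>N\<close> approximate
  \<open>x\<close> modulo \<open>L\<close>, they form a Cauchy sequence modulo \<open>L\<close>, hence by the preceding estimate also modulo
  \<open>N \<inter> L\<close>, and \<open>N/(N \<inter> L)\<close> is complete.
\<close>

lemma (in cstar_algebra) second_isomorphism:
  assumes N: "N \<in> ideals A" and L: "L \<in> ideals A"
  defines "K \<equiv> cs_topology A closure_of {n \<oplus> l | n l. n \<in> N \<and> l \<in> L}"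
  shows "K \<in> ideals A" "N \<subseteq> K" "L \<subseteq> K"
    "star_isomorphic (quot_alg (ideal_alg A N) (N \<inter> L)) (quot_alg (ideal_alg A K) L)"
proof -
  let ?S = "{n \<oplus> l | n l. n \<in> N \<and> l \<in> L}"
  have NL: "N \<inter> L \<in> ideals A" by (rule inter_ideal[OF N L])
  have NA: "n \<in> carrier A" if "n \<in> N" for n by (rule idealD(1)[OF N that])
  have LA: "l \<in> carrier A" if "l \<in> L" for l by (rule idealD(1)[OF L that])
  have S: "?S \<subseteq> carrier A" using NA LA by auto
  have "n = n \<oplus> \<zero>" if "n \<in> N" for n using NA[OF that] by simp
  then have NS: "N \<subseteq> ?S" using idealD(2)[OF L] by blast
  have "l = \<zero> \<oplus> l" if "l \<in> L" for l using LA[OF that] by simp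
  then have LS: "L \<subseteq> ?S" using idealD(2)[OF N] by blast
  have SK: "?S \<subseteq> K" unfolding K_def using S by (intro closure_of_subset) simp
  show K: "K \<in> ideals A" unfolding K_def by (rule closure_of_alg_ideal[OF alg_ideal_sum[OF N L]])
  show NK: "N \<subseteq> K" using NS SK by blast
  show LK: "L \<subseteq> K" using LS SK by blast
  have approx: "\<exists>n\<in>N. quot_norm L (x \<ominus> n) < e" if x: "x \<in> K" and e: "e > 0" for x and e :: real
  proof -
    have xc: "x \<in> carrier A" by (rule idealD(1)[OF K x])
    obtain n l where nl: "n \<in> N" "l \<in> L" "cs_norm A (x \<ominus> (n \<oplus> l)) < e"
      using x e unfolding K_def in_closure_of_iff[OF S] by blast
    have "x \<ominus> (n \<oplus> l) = (x \<ominus> n) \<oplus> \<ominus> l"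
      using xc NA[OF nl(1)] LA[OF nl(2)] by (simp add: minus_eq minus_add a_ac)
    then have "quot_norm L (x \<ominus> n) \<le> cs_norm A (x \<ominus> (n \<oplus> l))"
      using quot_norm_le[OF L, of "x \<ominus> n" "\<ominus> l"] xc NA[OF nl(1)] idealD(8)[OF L nl(2)] by simp
    then show ?thesis using nl by (intro bexI[of _ n]) auto
  qed
  have surj: "\<exists>n\<in>N. x \<ominus> n \<in> L" if x: "x \<in> K" for x
  proof -
    have xc: "x \<in> carrier A" by (rule idealD(1)[OF K x])
    have "\<forall>j::nat. \<exists>n. n \<in> N \<and> quot_norm L (x \<ominus> n) < (1/2) ^ j"
      using approx[OF x] by (simp add: Bex_def)
    from choice[OF this] obtain s where "\<forall>j. s j \<in> N \<and> quot_norm L (x \<ominus> s j) < (1/2) ^ j" ..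
    then have s: "s j \<in> N" "quot_norm L (x \<ominus> s j) < (1/2) ^ j" for j by simp_all
    have small: "\<exists>M. \<forall>j\<ge>M. (1/2) ^ j < e" if e: "e > 0" for e :: real
    proof -
      obtain M where M: "(1/2) ^ M < e" using real_arch_pow_inv[OF e, of "1/2"] by auto
      have "(1/2) ^ j < e" if "j \<ge> M" for j
      proof -
        have "(1/2 :: real) ^ j \<le> (1/2) ^ M" by (rule power_decreasing) (use that in auto)
        then show ?thesis using M by linarith
      qed
      then show ?thesis by blast
    qed
    interpret N: cstar_algebra "ideal_alg A N" by (rule ideal_alg_cstar[OF N])
    have NLN: "N \<inter> L \<in> ideals (ideal_alg A N)" using NL by (simp add: ideals_ideal_alg[OF N])
    have qn: "N.quot_norm (N \<inter> L) (a \<ominus>\<^bsub>ideal_alg A N\<^esub> b) = quot_norm (N \<inter> L) (a \<ominus> b)"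
      if "a \<in> N" "b \<in> N" for a b
      by (simp only: ideal_quot_norm[OF N] minus_ideal_alg[OF N that])
    obtain n where n: "n \<in> N" "\<And>e. e > 0 \<Longrightarrow> \<exists>M. \<forall>j\<ge>M. quot_norm (N \<inter> L) (s j \<ominus> n) < e"
    proof (rule N.quot_norm_cauchy_has_limit[OF NLN, of s])
      show "s j \<in> carrier (ideal_alg A N)" for j using s by simp
      fix e :: real assume e: "e > 0"
      \<comment> \<open>the sixth makes \<open>3 * (e / 6 + e / 6)\<close> equal to \<open>e\<close>\<close>
      then obtain M where M: "\<forall>j\<ge>M. (1/2) ^ j < e / 6" using small[of "e/6"] by auto
      have "quot_norm (N \<inter> L) (s i \<ominus> s j) < e" if "i \<ge> M" "j \<ge> M" for i j
      proof -
        have "quot_norm (N \<inter> L) (s i \<ominus> s j) \<le> 3 * quot_norm L (s i \<ominus> s j)"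
          by (intro quot_norm_inter_le N L idealD(7)[OF N] s)
        moreover have "quot_norm L (s i \<ominus> s j) \<le> quot_norm L (s i \<ominus> x) + quot_norm L (x \<ominus> s j)"
          using s NA xc by (intro quot_norm_diff_triangle[OF L]) auto
        moreover have "quot_norm L (s i \<ominus> x) = quot_norm L (x \<ominus> s i)"
          using s NA xc by (intro quot_norm_diff_commute[OF L]) auto
        moreover have "quot_norm L (x \<ominus> s i) < e / 6" "quot_norm L (x \<ominus> s j) < e / 6"
          using less_trans[OF s(2)[of i], of "e / 6"] less_trans[OF s(2)[of j], of "e / 6"] M that
          by simp_all
        ultimately show ?thesis by simp
      qed
      then show "\<exists>M. \<forall>i\<ge>M. \<forall>j\<ge>M. N.quot_norm (N \<inter> L) (s i \<ominus>\<^bsub>ideal_alg A N\<^esub> s j) < e"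
        using qn s(1) by (intro exI[of _ M]) simp
    next
      fix n assume "n \<in> carrier (ideal_alg A N)"
        and lim: "\<And>e. e > 0 \<Longrightarrow> \<exists>M. \<forall>j\<ge>M. N.quot_norm (N \<inter> L) (s j \<ominus>\<^bsub>ideal_alg A N\<^esub> n) < e"
      then have "n \<in> N" by simp
      then show thesis by (intro that[of n]) (use lim qn s(1) in simp_all)
    qed
    have nc: "n \<in> carrier A" by (rule NA[OF n(1)])
    have le: "quot_norm L a \<le> quot_norm (N \<inter> L) a" if "a \<in> carrier A" for a
      using that by (intro quot_norm_greatest[OF NL]) (auto intro: quot_norm_le[OF L])
    have "quot_norm L (x \<ominus> n) \<le> 0"
    proof (rule field_le_epsilon)
      fix e :: real assume e: "e > 0"
      obtain M1 where M1: "\<forall>j\<ge>M1. (1/2) ^ j < e / 2" using small[of "e/2"] e by auto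
      obtain M2 where M2: "\<forall>j\<ge>M2. quot_norm (N \<inter> L) (s j \<ominus> n) < e / 2" using n(2)[of "e/2"] e by auto
      define j where "j = max M1 M2"
      have "quot_norm L (x \<ominus> n) \<le> quot_norm L (x \<ominus> s j) + quot_norm L (s j \<ominus> n)"
        using s NA xc nc by (intro quot_norm_diff_triangle[OF L]) auto
      moreover have "quot_norm L (x \<ominus> s j) < e / 2"
        using less_trans[OF s(2)[of j], of "e / 2"] M1 by (simp add: j_def)
      moreover have "quot_norm L (s j \<ominus> n) < e / 2"
        using le_less_trans[OF le[of "s j \<ominus> n"], of "e / 2"] M2 NA[OF s(1)[of j]] nc
        by (simp add: j_def)
      ultimately show "quot_norm L (x \<ominus> n) \<le> 0 + e" by simp
    qed
    then have "quot_norm L (x \<ominus> n) = 0" using quot_norm_nonneg[OF L, of "x \<ominus> n"] xc nc by simp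
    then show ?thesis using n(1) quot_norm_eq_zero_iff[OF L, of "x \<ominus> n"] xc nc by auto
  qed
  interpret K: cstar_algebra "ideal_alg A K" by (rule ideal_alg_cstar[OF K])
  have LKi: "L \<in> ideals (ideal_alg A K)" using L LK by (simp add: ideals_ideal_alg[OF K])
  let ?Q = "quot_alg (ideal_alg A K) L" and ?rep = "coset_rep (ideal_alg A K) L"
  have hom: "star_hom (ideal_alg A K) ?Q ?rep" by (rule quot_hom[OF K.cstar_algebra_axioms LKi])
  show "star_isomorphic (quot_alg (ideal_alg A N) (N \<inter> L)) ?Q"
  proof (rule first_isomorphism[OF ideal_alg_cstar[OF N] K.quot_alg_cstar[OF LKi], where f = ?rep])
    show "N \<inter> L \<in> ideals (ideal_alg A N)" using NL by (simp add: ideals_ideal_alg[OF N])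
    show "star_hom (ideal_alg A N) ?Q ?rep"
      using star_homD[OF hom] subsetD[OF NK] by (simp add: star_hom_def image_subset_iff)
    show "?rep ` carrier (ideal_alg A N) = carrier ?Q"
    proof
      show "?rep ` carrier (ideal_alg A N) \<subseteq> carrier ?Q"
        unfolding K.quot_alg_simps(1)[OF LKi] using NK by auto
      show "carrier ?Q \<subseteq> ?rep ` carrier (ideal_alg A N)"
      proof
        fix q assume "q \<in> carrier ?Q"
        then obtain x where x: "x \<in> K" "q = ?rep x" unfolding K.quot_alg_simps(1)[OF LKi] by auto
        obtain n where n: "n \<in> N" "x \<ominus> n \<in> L" using surj[OF x(1)] by blast
        have nK: "n \<in> K" using n NK by blast
        have "?rep x = ?rep n"
          using x(1) nK n(2) by (subst K.rep_eq_iff[OF LKi]) (simp_all add: minus_ideal_alg[OF K])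
        then show "q \<in> ?rep ` carrier (ideal_alg A N)" using x(2) n(1) by simp
      qed
    qed
    fix x assume x: "x \<in> carrier (ideal_alg A N)"
    then have "x \<in> carrier (ideal_alg A K)" using NK by auto
    then show "?rep x = \<zero>\<^bsub>?Q\<^esub> \<longleftrightarrow> x \<in> N \<inter> L"
      unfolding K.quot_alg_simps(2)[OF LKi] using K.rep_eq_zero_iff[OF LKi] x by simp
  qed
qed

section \<open>Chains of ideals\<close>

lemma ideal_in_GP_iff:
  assumes A: "cstar_algebra A" and J: "J \<in> ideals A"
  shows "ideal_alg A J \<in> GP P \<longleftrightarrow>
    (\<forall>L\<in>ideals A. L \<subset> J \<longrightarrow> (\<exists>K. ll P A L K \<and> K \<noteq> L \<and> K \<subseteq> J))"
proof -
  interpret A: cstar_algebra A by fact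
  have "ll P (ideal_alg A J) L K \<longleftrightarrow> ll P A L K \<and> K \<subseteq> J" for L K
    unfolding ll_def A.ideals_ideal_alg[OF J] by auto
  then show ?thesis
    unfolding GP_iff A.ideals_ideal_alg[OF J] using A.ideal_alg_cstar[OF J] by auto
qed

text \<open>
  For an ideal \<open>L\<close> strictly below \<open>J\<close>, take the first index \<open>k\<close> with \<open>F k\<close> not contained in \<open>L\<close>. It is
  neither the least index nor a limit, since \<open>L\<close> is closed, so \<open>k\<close> is the successor of some \<open>j\<close> with
  \<open>F j \<subseteq> L\<close>. For \<open>N = F k\<close> the algebra \<open>N/(N \<inter> L)\<close> is a quotient of \<open>N/F j \<in> P\<close>, and by the second
  isomorphism theorem it is \<open>K/L\<close>, where \<open>K\<close> is the closure of \<open>N + L\<close>.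
\<close>

lemma ll_tri_imp_GP:
  assumes P: "P \<in> P_up" and A: "cstar_algebra A" and J: "J \<in> ideals A"
    and tri: "ll_tri P A {\<zero>\<^bsub>A\<^esub>} J"
  shows "ideal_alg A J \<in> GP P"
  unfolding ideal_in_GP_iff[OF A J]
proof (intro ballI impI)
  interpret A: cstar_algebra A by fact
  fix L assume L: "L \<in> ideals A" "L \<subset> J"
  obtain r :: "'a set rel" and F lo hi where Wo: "Well_order r" and lo: "lo \<in> Field r" and hi: "hi \<in> Field r"
    and bounds: "\<forall>k\<in>Field r. (lo, k) \<in> r \<and> (k, hi) \<in> r" and Fi: "\<forall>k\<in>Field r. F k \<in> ideals A"
    and F: "F lo = {\<zero>\<^bsub>A\<^esub>}" "F hi = J"
    and succ: "\<forall>k\<in>underS r hi. ll P A (F k) (F (wo_rel.suc r {k}))"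
    and limit: "\<forall>b\<in>Field r. b \<noteq> lo \<and> (\<forall>k\<in>underS r b. b \<noteq> wo_rel.suc r {k}) \<longrightarrow>
        F b = cs_topology A closure_of (\<Union>k\<in>underS r b. F k)"
    using tri unfolding ll_tri_def by blast
  interpret wo: wo_rel r by (rule wo_rel.intro[OF Wo])
  have under_hi: "k \<in> underS r hi" if "k \<in> underS r b" "b \<in> Field r" for k b
  proof -
    have "(b, hi) \<in> r" using bounds that(2) by blast
    then show ?thesis
      using that(1) wo.TRANS wo.ANTISYM unfolding underS_def trans_def antisym_def by blast
  qed
  \<comment> \<open>The family is increasing; this is needed for \<open>N \<subseteq> F hi = J\<close>.\<close>
  have mono: "\<forall>j. (j, b) \<in> r \<longrightarrow> F j \<subseteq> F b" for b
  proof (induction b rule: wo.well_order_induct)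
    case (1 b)
    show ?case
    proof (intro allI impI)
      fix j assume jb: "(j, b) \<in> r"
      then have b: "b \<in> Field r" and jf: "j \<in> Field r" by (auto simp: Field_def)
      show "F j \<subseteq> F b"
      proof (cases "j = b")
        case False
        then have jS: "j \<in> underS r b" using jb by (simp add: underS_def)
        have "b \<noteq> lo"
        proof
          assume "b = lo"
          then have "(b, j) \<in> r" using bounds jf by blast
          then show False using jb False wo.ANTISYM unfolding antisym_def by blast
        qed
        show ?thesis
        proof (cases "\<exists>i\<in>underS r b. b = wo_rel.suc r {i}")
          case True
          then obtain i where i: "i \<in> underS r b" "b = wo_rel.suc r {i}" by blast
          have ib: "(i, b) \<in> r" "i \<noteq> b" using i(1) by (auto simp: underS_def)
          have ifl: "i \<in> Field r" using ib(1) by (auto simp: Field_def)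
          have "(j, i) \<in> r"
          proof (rule ccontr)
            assume "(j, i) \<notin> r"
            then have "(i, j) \<in> r" "i \<noteq> j"
              using wo.TOTALS ifl jf by auto
            then have "j \<in> AboveS r {i}" using jf by (simp add: AboveS_def)
            then have "(b, j) \<in> r" using wo.suc_least_AboveS i(2) by simp
            then show False using jb False wo.ANTISYM unfolding antisym_def by blast
          qed
          then have "F j \<subseteq> F i" using 1 ib by blast
          moreover have "F i \<subseteq> F b"
            using succ under_hi[OF i(1) b] i(2) llD(3) by metis
          ultimately show ?thesis by blast
        next
          case False
          then have "F b = cs_topology A closure_of (\<Union>k\<in>underS r b. F k)"
            using limit b \<open>b \<noteq> lo\<close> by blast
          moreover have "(\<Union>k\<in>underS r b. F k) \<subseteq> cs_topology A closure_of (\<Union>k\<in>underS r b. F k)"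
          proof (rule closure_of_subset)
            have "F k \<subseteq> carrier A" if "k \<in> underS r b" for k
              using Fi A.ideal_subset underS_Field[OF that] by blast
            then show "(\<Union>k\<in>underS r b. F k) \<subseteq> topspace (cs_topology A)" by auto
          qed
          ultimately show ?thesis using jS by blast
        qed
      qed simp
    qed
  qed
  define S where "S = {k \<in> Field r. \<not> F k \<subseteq> L}"
  have SF: "S \<subseteq> Field r" by (auto simp: S_def)
  have hiS: "hi \<in> S" using hi F(2) L(2) by (auto simp: S_def)
  define k where "k = wo.minim S"
  have kS: "k \<in> S" unfolding k_def using wo.minim_in[OF SF] hiS by blast
  have k: "k \<in> Field r" "\<not> F k \<subseteq> L" using kS by (auto simp: S_def)
  have below: "F j \<subseteq> L" if "j \<in> underS r k" for j
  proof (rule ccontr)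
    assume "\<not> F j \<subseteq> L"
    moreover have jk: "(j, k) \<in> r" "j \<noteq> k" using that by (auto simp: underS_def)
    ultimately have "j \<in> S" by (auto simp: S_def Field_def)
    then have "(k, j) \<in> r" unfolding k_def using wo.minim_least[OF SF] by blast
    then show False using jk wo.ANTISYM unfolding antisym_def by blast
  qed
  have "k \<noteq> lo" using k(2) F(1) A.idealD(2)[OF L(1)] by auto
  have "\<exists>j\<in>underS r k. k = wo_rel.suc r {j}"
  proof (rule ccontr)
    assume "\<not> ?thesis"
    then have "F k = cs_topology A closure_of (\<Union>j\<in>underS r k. F j)"
      using limit k(1) \<open>k \<noteq> lo\<close> by blast
    also have "\<dots> \<subseteq> L" using below by (intro A.closure_of_subset_ideal[OF _ L(1)]) blast
    finally show False using k(2) by simp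
  qed
  then obtain j where j: "j \<in> underS r k" "k = wo_rel.suc r {j}" by blast
  define N where "N = F k"
  have "ll P A (F j) (F (wo_rel.suc r {j}))"
    using succ under_hi[OF j(1) k(1)] by blast
  then have llN: "ll P A (F j) N" by (simp add: N_def j(2)[symmetric])
  note l = llD[OF llN]
  define M where "M = N \<inter> L"
  have M: "M \<in> ideals A" unfolding M_def by (rule A.inter_ideal[OF l(2) L(1)])
  have jM: "F j \<subseteq> M" using l(3) below[OF j(1)] by (simp add: M_def)
  interpret N: cstar_algebra "ideal_alg A N" by (rule A.ideal_alg_cstar[OF l(2)])
  have jN: "F j \<in> ideals (ideal_alg A N)" and MN: "M \<in> ideals (ideal_alg A N)"
    using l M by (simp_all add: A.ideals_ideal_alg[OF l(2)] M_def)
  let ?B = "quot_alg (ideal_alg A N) (F j)" and ?M = "coset_rep (ideal_alg A N) (F j) ` M"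
  have "?M \<in> ideals ?B" by (rule N.ideal_quot_image[OF jN MN jM])
  then have "quot_alg ?B ?M \<in> P" by (rule P_upD(3)[OF P l(4)])
  moreover have "star_isomorphic (quot_alg ?B ?M) (quot_alg (ideal_alg A N) M)"
    by (rule star_isomorphic_sym[OF N.quot_alg_cstar[OF MN]
          quot_quot_iso[OF N.cstar_algebra_axioms jN MN jM]])
  ultimately have NM: "quot_alg (ideal_alg A N) M \<in> P"
    by (rule P_upD(2)[OF P _ N.quot_alg_cstar[OF MN]])
  define K where "K = cs_topology A closure_of {n \<oplus>\<^bsub>A\<^esub> l | n l. n \<in> N \<and> l \<in> L}"
  note K = A.second_isomorphism[OF l(2) L(1), folded K_def M_def]
  have "L \<in> ideals (ideal_alg A K)" using L(1) K(3) by (simp add: A.ideals_ideal_alg[OF K(1)])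
  then have "quot_alg (ideal_alg A K) L \<in> P"
    by (intro P_upD(2)[OF P NM _ K(4)] cstar_algebra.quot_alg_cstar[OF A.ideal_alg_cstar[OF K(1)]])
  then have "ll P A L K" using L(1) K by (simp add: ll_def)
  moreover have "K \<noteq> L" using K(2) k(2) by (auto simp: N_def)
  moreover have "K \<subseteq> J" unfolding K_def
  proof (rule A.closure_of_subset_ideal[OF _ J])
    have "N \<subseteq> J" using mono[of hi] bounds k(1) F(2) by (auto simp: N_def)
    then show "{n \<oplus>\<^bsub>A\<^esub> l | n l. n \<in> N \<and> l \<in> L} \<subseteq> J"
      using L(2) A.idealD(3)[OF J] by blast
  qed
  ultimately show "\<exists>K. ll P A L K \<and> K \<noteq> L \<and> K \<subseteq> J" by blast
qed

text \<open>
  Choose for each ideal \<open>L\<close> strictly below \<open>J\<close> an ideal \<open>f L\<close> strictly above it with subquotient in \<open>P\<close>.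
  The tower generated by \<open>0\<close> under \<open>f\<close> and closures of unions of chains is a chain, its top is a fixed point of
  \<open>f\<close> and so equals \<open>J\<close>, and \<open>f\<close> is its successor function. Ordered by inclusion, the tower is therefore
  the required family with itself as index set.
\<close>

lemma GP_imp_ll_tri:
  assumes A: "cstar_algebra A" and J: "J \<in> ideals A" and GP: "ideal_alg A J \<in> GP P"
  shows "ll_tri P A {\<zero>\<^bsub>A\<^esub>} J"
proof -
  interpret A: cstar_algebra A by fact
  let ?z = "{\<zero>\<^bsub>A\<^esub>}"
  define Below where "Below = {L \<in> ideals A. L \<subseteq> J}"
  have zBelow: "?z \<in> Below" using A.zero_ideal A.idealD(2)[OF J] by (simp add: Below_def)
  have JBelow: "J \<in> Below" using J by (simp add: Below_def)
  define f where "f L = (if L = J then J else SOME K. ll P A L K \<and> K \<noteq> L \<and> K \<subseteq> J)" for L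
  have f: "ll P A L (f L)" "f L \<noteq> L" "f L \<subseteq> J" if "L \<in> Below" "L \<noteq> J" for L
  proof -
    have "\<exists>K. ll P A L K \<and> K \<noteq> L \<and> K \<subseteq> J"
      using GP that unfolding ideal_in_GP_iff[OF A J] Below_def by auto
    from someI_ex[OF this] show "ll P A L (f L)" "f L \<noteq> L" "f L \<subseteq> J"
      using that(2) by (simp_all add: f_def)
  qed
  have fJ: "f J = J" by (simp add: f_def)
  define leq where "leq = {(K, L). K \<in> Below \<and> L \<in> Below \<and> K \<subseteq> L}"
  have Field_leq: "Field leq = Below" by (auto simp: leq_def Field_def)
  define lub where "lub M = cs_topology A closure_of (\<Union>M)" for M
  have chain: "M \<subseteq> Below" "\<And>K L. K \<in> M \<Longrightarrow> L \<in> M \<Longrightarrow> K \<subseteq> L \<or> L \<subseteq> K" if "M \<in> Chains leq" for M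
    using that unfolding Chains_def leq_def by blast+
  have lub_Below: "lub M \<in> Below" and lub_upper: "\<And>L. L \<in> M \<Longrightarrow> L \<subseteq> lub M"
    and lub_least: "\<And>Z. Z \<in> Below \<Longrightarrow> (\<And>L. L \<in> M \<Longrightarrow> L \<subseteq> Z) \<Longrightarrow> lub M \<subseteq> Z"
    if M: "M \<in> Chains leq" "M \<noteq> {}" for M
  proof -
    have ideal: "L \<in> ideals A" "L \<subseteq> J" if "L \<in> M" for L
      using chain(1)[OF M(1)] that by (auto simp: Below_def)
    have sub: "\<Union>M \<subseteq> carrier A" using ideal A.ideal_subset by blast
    have "x \<oplus>\<^bsub>A\<^esub> y \<in> \<Union>M" if xy: "x \<in> \<Union>M" "y \<in> \<Union>M" for x y
    proof -
      obtain K L where KL: "K \<in> M" "L \<in> M" "x \<in> K" "y \<in> L" using xy by blast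
      consider "K \<subseteq> L" | "L \<subseteq> K" using chain(2)[OF M(1) KL(1,2)] by blast
      then show ?thesis
      proof cases
        case 1
        then have "x \<oplus>\<^bsub>A\<^esub> y \<in> L" using KL by (intro A.idealD(3)[OF ideal(1)[OF KL(2)]]) auto
        then show ?thesis using KL by blast
      next
        case 2
        then have "x \<oplus>\<^bsub>A\<^esub> y \<in> K" using KL by (intro A.idealD(3)[OF ideal(1)[OF KL(1)]]) auto
        then show ?thesis using KL by blast
      qed
    qed
    moreover have "\<zero>\<^bsub>A\<^esub> \<in> \<Union>M" using M(2) A.idealD(2)[OF ideal(1)] by blast
    moreover have "c \<odot>\<^bsub>A\<^esub> x \<in> \<Union>M" if "x \<in> \<Union>M" for c x
      using that A.idealD(4)[OF ideal(1)] by blast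
    moreover have "a \<otimes>\<^bsub>A\<^esub> x \<in> \<Union>M" "x \<otimes>\<^bsub>A\<^esub> a \<in> \<Union>M" if "x \<in> \<Union>M" "a \<in> carrier A" for a x
      using that A.idealD(5,6)[OF ideal(1)] by blast+
    ultimately have "alg_ideal A (\<Union>M)"
      using sub by (simp only: alg_ideal_def) simp
    then have "lub M \<in> ideals A"
      unfolding lub_def by (rule A.closure_of_alg_ideal)
    moreover have least: "lub M \<subseteq> Z" if "Z \<in> Below" "\<And>L. L \<in> M \<Longrightarrow> L \<subseteq> Z" for Z
      unfolding lub_def using that by (intro A.closure_of_subset_ideal) (auto simp: Below_def)
    moreover have "lub M \<subseteq> J" using ideal(2) by (intro least JBelow)
    ultimately show "lub M \<in> Below" "\<And>Z. Z \<in> Below \<Longrightarrow> (\<And>L. L \<in> M \<Longrightarrow> L \<subseteq> Z) \<Longrightarrow> lub M \<subseteq> Z"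
      by (simp_all add: Below_def)
    have "\<Union>M \<subseteq> lub M" unfolding lub_def using sub by (intro closure_of_subset) simp
    then show "L \<subseteq> lub M" if "L \<in> M" for L using that by blast
  qed
  interpret bw: bourbaki_witt_fixpoint lub leq f
  proof
    show "Partial_order leq"
      unfolding order_on_defs Field_leq by (auto simp: refl_on_def trans_def antisym_def leq_def)
    show "(lub M, Z) \<in> leq" if M: "M \<in> Chains leq" "M \<noteq> {}" and Z: "\<And>L. L \<in> M \<Longrightarrow> (L, Z) \<in> leq" for M Z
    proof -
      have "Z \<in> Below" "\<And>L. L \<in> M \<Longrightarrow> L \<subseteq> Z" using M(2) Z by (auto simp: leq_def)
      then show ?thesis using lub_least[OF M] lub_Below[OF M] by (simp add: leq_def)
    qed
    show "(L, lub M) \<in> leq" if M: "M \<in> Chains leq" and L: "L \<in> M" for M L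
    proof -
      have "M \<noteq> {}" using L by auto
      then show ?thesis using chain(1)[OF M] lub_Below[OF M] lub_upper[OF M] L by (auto simp: leq_def)
    qed
    show "lub M \<in> Field leq" if "M \<in> Chains leq" "M \<noteq> {}" for M
      using lub_Below[OF that] by (simp add: Field_leq)
    show "(L, f L) \<in> leq" if "L \<in> Field leq" for L
    proof (cases "L = J")
      case True
      then show ?thesis using JBelow fJ by (simp add: leq_def)
    next
      case False
      have L: "L \<in> Below" using that by (simp add: Field_leq)
      show ?thesis
        using L f(3)[OF L False] llD(2,3)[OF f(1)[OF L False]] by (simp add: leq_def Below_def)
    qed
  qed
  define T where "T = bw.iterates_above ?z"
  have zF: "?z \<in> Field leq" using zBelow by (simp add: Field_leq)
  have TBelow: "L \<in> Below" if "L \<in> T" for L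
    using bw.iterates_above_Field[of L ?z] that zF by (simp add: T_def Field_leq)
  have zT: "?z \<in> T" unfolding T_def by (rule bw.base)
  have fT: "f L \<in> T" if "L \<in> T" for L using that unfolding T_def by (rule bw.step)
  have lubT: "lub M \<in> T" if "M \<in> Chains leq" "M \<noteq> {}" "M \<subseteq> T" for M
    using that unfolding T_def by (intro bw.Sup) auto
  have T_Chain: "T \<in> Chains leq" unfolding T_def by (rule bw.chain_iterates_above[OF zF])
  have sub_Chain: "M \<in> Chains leq" if "M \<subseteq> T" for M
    using in_Chains_subset[OF T_Chain that] .
  have T_linear: "K \<subseteq> L \<or> L \<subseteq> K" if "K \<in> T" "L \<in> T" for K L
    by (rule chain(2)[OF T_Chain that])
  have z_le: "?z \<subseteq> L" if "L \<in> T" for L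
    using A.idealD(2) TBelow[OF that] by (simp add: Below_def)
  have le_J: "L \<subseteq> J" if "L \<in> T" for L using TBelow[OF that] by (simp add: Below_def)
  have next_le: "f K \<subseteq> L" if K: "K \<in> T" and L: "L \<in> T" and less: "K \<subset> L" for K L
  proof -
    have KF: "K \<in> Field leq" "L \<in> Field leq" using TBelow K L by (simp_all add: Field_leq)
    have "K \<in> bw.iterates_above L \<or> L \<in> bw.iterates_above K"
      using bw.iterates_above_triangle[OF _ _ zF] K L by (simp add: T_def)
    moreover have "K \<notin> bw.iterates_above L"
      using bw.iterates_above_ge[OF _ KF(2), of K] less by (auto simp: leq_def)
    ultimately have "L \<in> bw.iterates_above K" by blast
    then have "L = K \<or> L \<in> bw.iterates_above (f K)"
      by (rule bw.iterates_above_successor[OF _ KF(1)])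
    then have "L \<in> bw.iterates_above (f K)" using less by blast
    moreover have "f K \<in> Field leq" using TBelow[OF fT[OF K]] by (simp add: Field_leq)
    ultimately have "(f K, L) \<in> leq" by (rule bw.iterates_above_ge)
    then show ?thesis by (simp add: leq_def)
  qed
  have f_greater: "K \<subset> f K" if "K \<in> T" "K \<noteq> J" for K
    using f(2)[OF TBelow[OF that(1)] that(2)] llD(3)[OF f(1)[OF TBelow[OF that(1)] that(2)]] by blast
  have JT: "J \<in> T"
  proof -
    have fix_T: "bw.fixp_above ?z \<in> T" unfolding T_def by (rule bw.fixp_iterates_above)
    have "f (bw.fixp_above ?z) = bw.fixp_above ?z" using bw.fixp_above_unfold[OF zF] by simp
    then have "bw.fixp_above ?z = J" using f_greater[OF fix_T] by blast
    then show ?thesis using fix_T by simp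
  qed
  have least: "\<exists>m\<in>S. \<forall>L\<in>S. m \<subseteq> L" if S: "S \<subseteq> T" "S \<noteq> {}" for S
  proof -
    \<comment> \<open>The supremum \<open>m\<close> of all lower bounds of \<open>S\<close> in the tower belongs to \<open>S\<close>: otherwise \<open>f m\<close> would
        be a lower bound as well.\<close>
    define M where "M = {L \<in> T. \<forall>K\<in>S. L \<subseteq> K}"
    have zM: "?z \<in> M" using zT z_le S(1) by (auto simp: M_def)
    have M_Chain: "M \<in> Chains leq" and MT: "M \<subseteq> T" and "M \<noteq> {}"
      using sub_Chain[of M] zM by (auto simp: M_def)
    define m where "m = lub M"
    have mT: "m \<in> T" unfolding m_def by (rule lubT[OF M_Chain \<open>M \<noteq> {}\<close> MT])
    have m_le: "m \<subseteq> K" if "K \<in> S" for K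
      unfolding m_def using TBelow S(1) that by (intro lub_least[OF M_Chain \<open>M \<noteq> {}\<close>]) (auto simp: M_def)
    have "m \<in> S"
    proof (rule ccontr)
      assume "m \<notin> S"
      then have less: "m \<subset> K" if "K \<in> S" for K using m_le[OF that] that by blast
      then have "f m \<subseteq> K" if "K \<in> S" for K using next_le[OF mT _ less] that S(1) by blast
      then have "f m \<in> M" using fT[OF mT] by (simp add: M_def)
      then have "f m \<subseteq> m" unfolding m_def by (rule lub_upper[OF M_Chain \<open>M \<noteq> {}\<close>])
      then have "m = J" using f_greater[OF mT] by blast
      then show False using S less le_J by blast
    qed
    then show ?thesis using m_le by blast
  qed
  define r where "r = {(K, L). K \<in> T \<and> L \<in> T \<and> K \<subseteq> L}"
  have Field_r: "Field r = T" by (auto simp: r_def Field_def)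
  have Wo: "Well_order r"
    unfolding well_order_on_def linear_order_on_def partial_order_on_def preorder_on_def Field_r
  proof (intro conjI)
    show "refl_on T r" "trans r" "antisym r" by (auto simp: refl_on_def trans_def antisym_def r_def)
    show "total_on T r" using T_linear by (auto simp: total_on_def r_def)
    show "wf (r - Id)"
      unfolding wf_eq_minimal
    proof (intro allI impI)
      fix Q and x :: "'a set" assume x: "x \<in> Q"
      show "\<exists>m\<in>Q. \<forall>y. (y, m) \<in> r - Id \<longrightarrow> y \<notin> Q"
      proof (cases "Q \<inter> T = {}")
        case True
        then show ?thesis using x by (intro bexI[of _ x]) (auto simp: r_def)
      next
        case False
        then obtain m where m: "m \<in> Q \<inter> T" "\<forall>L\<in>Q \<inter> T. m \<subseteq> L" using least[of "Q \<inter> T"] by blast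
        then have "\<forall>y. (y, m) \<in> r - Id \<longrightarrow> y \<notin> Q" by (auto simp: r_def)
        then show ?thesis using m(1) by blast
      qed
    qed
  qed (auto simp: r_def)
  interpret wo: wo_rel r by (rule wo_rel.intro[OF Wo])
  have underS_iff: "K \<in> underS r L \<longleftrightarrow> K \<in> T \<and> L \<in> T \<and> K \<subset> L" for K L
    by (auto simp: underS_def r_def)
  have suc: "wo_rel.suc r {K} = f K" if K: "K \<in> T" "K \<noteq> J" for K
  proof (rule wo.equals_suc_AboveS[symmetric])
    show "{K} \<subseteq> Field r" using K by (simp add: Field_r)
    show "f K \<in> AboveS r {K}"
      using f_greater[OF K] fT[OF K(1)] K(1) unfolding AboveS_def Field_r by (auto simp: r_def)
    fix L assume "L \<in> AboveS r {K}"
    then have L: "L \<in> T" "K \<subset> L" unfolding AboveS_def Field_r by (auto simp: r_def)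
    then show "(f K, L) \<in> r" using next_le[OF K(1) L] fT[OF K(1)] by (simp add: r_def)
  qed
  show ?thesis
    unfolding ll_tri_def
  proof (rule exI[of _ r], rule exI[of _ "\<lambda>L. L"], rule exI[of _ ?z], rule exI[of _ J],
      intro conjI ballI impI refl)
    show "Well_order r" by (rule Wo)
    show "?z \<in> Field r" "J \<in> Field r" using zT JT by (simp_all add: Field_r)
    show "(?z, k) \<in> r" "(k, J) \<in> r" if "k \<in> Field r" for k
      using that zT JT z_le le_J unfolding Field_r by (simp_all add: r_def)
    show "k \<in> ideals A" if "k \<in> Field r" for k
      using that TBelow by (simp add: Field_r Below_def)
    show "ll P A k (wo_rel.suc r {k})" if "k \<in> underS r J" for k
    proof -
      have k: "k \<in> T" "k \<noteq> J" using that by (auto simp: underS_iff)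
      show ?thesis unfolding suc[OF k] by (rule f(1)[OF TBelow[OF k(1)] k(2)])
    qed
    fix b assume b: "b \<in> Field r" and lim: "b \<noteq> ?z \<and> (\<forall>k\<in>underS r b. b \<noteq> wo_rel.suc r {k})"
    have bT: "b \<in> T" using b by (simp add: Field_r)
    have U: "underS r b \<in> Chains leq" "underS r b \<subseteq> T" "underS r b \<noteq> {}"
    proof -
      show sub: "underS r b \<subseteq> T" by (auto simp: underS_iff)
      then show "underS r b \<in> Chains leq" by (rule sub_Chain)
      have "?z \<in> underS r b" using z_le[OF bT] zT bT lim unfolding underS_iff by blast
      then show "underS r b \<noteq> {}" by blast
    qed
    define m where "m = lub (underS r b)"
    have mT: "m \<in> T" unfolding m_def by (rule lubT[OF U(1,3,2)])
    have "m \<subseteq> b" unfolding m_def using TBelow[OF bT]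
      by (rule lub_least[OF U(1,3)]) (auto simp: underS_iff)
    have "m = b"
    proof (rule ccontr)
      assume "m \<noteq> b"
      then have less: "m \<subset> b" using \<open>m \<subseteq> b\<close> by blast
      then have m: "m \<in> underS r b" "m \<noteq> J" using mT bT le_J[OF bT] by (auto simp: underS_iff)
      then have "f m \<noteq> b" using lim suc[OF mT] by auto
      then have "f m \<in> underS r b" using next_le[OF mT bT less] fT[OF mT] bT by (auto simp: underS_iff)
      then have "f m \<subseteq> m" unfolding m_def by (rule lub_upper[OF U(1,3)])
      then show False using f_greater[OF mT m(2)] by blast
    qed
    then show "b = cs_topology A closure_of (\<Union>k\<in>underS r b. k)"
      by (simp add: m_def lub_def)
  qed
qed

section \<open>The radical\<close>

lemma (in cstar_algebra) alg_ideal_ideal_sum: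
  assumes S: "S \<subseteq> ideals A"
  shows "alg_ideal A (ideal_sum A S)"
proof -
  have SA: "y \<in> carrier A" if "J \<in> S" "y \<in> J" for J y
    using that S idealD(1) by blast
  have I: "finsum A x T \<in> ideal_sum A S" if "finite T" "T \<subseteq> S" "\<And>J. J \<in> T \<Longrightarrow> x J \<in> J" for x T
    using that unfolding ideal_sum_def by blast
  have E: "\<exists>x T. s = finsum A x T \<and> finite T \<and> T \<subseteq> S \<and> (\<forall>J\<in>T. x J \<in> J)" if "s \<in> ideal_sum A S" for s
    using that unfolding ideal_sum_def by blast
  have clo: "x \<in> T \<rightarrow> carrier A" if "T \<subseteq> S" "\<forall>J\<in>T. x J \<in> J" for x T
    using that SA by blast
  show ?thesis
    unfolding alg_ideal_def
  proof (intro conjI ballI allI subsetI)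
    show "s \<in> carrier A" if "s \<in> ideal_sum A S" for s
      using E[OF that] clo by (auto intro!: finsum_closed)
    show "\<zero> \<in> ideal_sum A S" using I[of "{}"] by simp
  next
    fix s t assume "s \<in> ideal_sum A S" "t \<in> ideal_sum A S"
    then obtain x T y U where x: "s = finsum A x T" "finite T" "T \<subseteq> S" "\<forall>J\<in>T. x J \<in> J"
      and y: "t = finsum A y U" "finite U" "U \<subseteq> S" "\<forall>J\<in>U. y J \<in> J"
      using E by meson
    define x' where "x' J = (if J \<in> T then x J else \<zero>)" for J
    define y' where "y' J = (if J \<in> U then y J else \<zero>)" for J
    have zJ: "\<zero> \<in> J" if "J \<in> S" for J using that S idealD(2) by blast
    have mem: "x' J \<in> J" "y' J \<in> J" if "J \<in> T \<union> U" for J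
      using that x y zJ by (auto simp: x'_def y'_def)
    have TU: "T \<union> U \<subseteq> S" "finite (T \<union> U)" using x y by auto
    have c: "x' \<in> T \<union> U \<rightarrow> carrier A" "y' \<in> T \<union> U \<rightarrow> carrier A"
      using clo[OF TU(1)] mem by blast+
    have "s = finsum A x' (T \<union> U)"
      unfolding x(1) using TU c(1) by (intro add.finprod_mono_neutral_cong_left) (auto simp: x'_def)
    moreover have "t = finsum A y' (T \<union> U)"
      unfolding y(1) using TU c(2) by (intro add.finprod_mono_neutral_cong_left) (auto simp: y'_def)
    ultimately have "s \<oplus> t = finsum A (\<lambda>J. x' J \<oplus> y' J) (T \<union> U)"
      using finsum_addf[OF c] by simp
    moreover have "x' J \<oplus> y' J \<in> J" if "J \<in> T \<union> U" for J
      using mem[OF that] idealD(3)[of J] S TU(1) that by blast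
    ultimately show "s \<oplus> t \<in> ideal_sum A S"
      using I[OF TU(2,1)] by simp
  next
    fix s c assume "s \<in> ideal_sum A S"
    then obtain x T where x: "s = finsum A x T" "finite T" "T \<subseteq> S" "\<forall>J\<in>T. x J \<in> J"
      using E by meson
    have "c \<odot> s = finsum A (\<lambda>J. c \<odot> x J) T"
      unfolding x(1) by (rule finsum_smult_ldistr[OF x(2) _ clo[OF x(3,4)]]) (simp add: ring_of_type_algebra_simps)
    moreover have "c \<odot> x J \<in> J" if "J \<in> T" for J
      using x(3,4) that S idealD(4)[of J] by blast
    ultimately show "c \<odot> s \<in> ideal_sum A S" using I[OF x(2,3)] by simp
  next
    fix s a assume "s \<in> ideal_sum A S" and a: "a \<in> carrier A"
    then obtain x T where x: "s = finsum A x T" "finite T" "T \<subseteq> S" "\<forall>J\<in>T. x J \<in> J"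
      using E by meson
    have "a \<otimes> finsum A x T = finsum A (\<lambda>J. a \<otimes> x J) T \<and> finsum A x T \<otimes> a = finsum A (\<lambda>J. x J \<otimes> a) T"
      using x(2) clo[OF x(3,4)]
    proof (induction T rule: finite_induct)
      case empty
      then show ?case using a by simp
    next
      case (insert J T)
      then have "x J \<in> carrier A" "x \<in> T \<rightarrow> carrier A" by auto
      then show ?case
        using insert a by (simp add: finsum_insert Pi_def)
    qed
    moreover have "a \<otimes> x J \<in> J" "x J \<otimes> a \<in> J" if "J \<in> T" for J
      using x(3,4) that S a idealD(5)[of J "x J" a] idealD(6)[of J "x J" a] by blast+
    ultimately show "a \<otimes> s \<in> ideal_sum A S" "s \<otimes> a \<in> ideal_sum A S"
      using I[OF x(2,3)] x(1) by simp_all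
  qed
qed

lemma cs_radical_ideal:
  assumes "cstar_algebra A"
  shows "cs_radical P A \<in> ideals A"
  unfolding cs_radical_def
  by (intro cstar_algebra.closure_of_alg_ideal cstar_algebra.alg_ideal_ideal_sum assms) auto

lemma ll_tri_mono:
  assumes "P \<subseteq> P1" "ll_tri P A I J"
  shows "ll_tri P1 A I J"
proof -
  obtain r :: "'a set rel" and F lo hi where r: "Well_order r" "lo \<in> Field r" "hi \<in> Field r"
    "\<forall>k\<in>Field r. (lo, k) \<in> r \<and> (k, hi) \<in> r" "\<forall>k\<in>Field r. F k \<in> ideals A" "F lo = I" "F hi = J"
    and succ: "\<forall>k\<in>underS r hi. ll P A (F k) (F (wo_rel.suc r {k}))"
    and lim: "\<forall>b\<in>Field r. b \<noteq> lo \<and> (\<forall>k\<in>underS r b. b \<noteq> wo_rel.suc r {k}) \<longrightarrow>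
        F b = cs_topology A closure_of (\<Union>k\<in>underS r b. F k)"
    using assms(2) unfolding ll_tri_def by blast
  have "\<forall>k\<in>underS r hi. ll P1 A (F k) (F (wo_rel.suc r {k}))"
    using succ assms(1) by (auto simp: ll_def)
  then show ?thesis
    unfolding ll_tri_def using r lim by (intro exI[of _ r] exI[of _ F] exI[of _ lo] exI[of _ hi] conjI)
qed

lemma cs_radical_mono:
  assumes "P \<subseteq> P1"
  shows "cs_radical P A \<subseteq> cs_radical P1 A"
  unfolding cs_radical_def
proof (rule closure_of_mono)
  show "ideal_sum A {J \<in> ideals A. ll_tri P A {\<zero>\<^bsub>A\<^esub>} J} \<subseteq> ideal_sum A {J \<in> ideals A. ll_tri P1 A {\<zero>\<^bsub>A\<^esub>} J}"
    unfolding ideal_sum_def using ll_tri_mono[OF assms] by blast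
qed

lemma ll_tri_iff_GP:
  assumes "P \<in> P_up" "cstar_algebra A" "J \<in> ideals A"
  shows "ll_tri P A {\<zero>\<^bsub>A\<^esub>} J \<longleftrightarrow> ideal_alg A J \<in> GP P"
  using ll_tri_imp_GP[OF assms] GP_imp_ll_tri[OF assms(2,3)] by blast

lemma GP_idem: "P \<in> P_up \<Longrightarrow> GP (GP P) = GP P"
  using GP_GP_subset subset_GP GP_in_P_up by blast

lemma GP_eq_between:
  assumes "P \<in> P_up" "P \<subseteq> P1" "P1 \<subseteq> GP P"
  shows "GP P = GP P1"
  using GP_mono[OF assms(2)] GP_mono[OF assms(3)] GP_idem[OF assms(1)] by blast

text \<open>
  By \<open>ll_tri_iff_GP\<close>, the ideals that generate the radical depend on \<open>GP P\<close> only.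
\<close>

lemma cs_radical_eq:
  assumes "P \<in> P_up" "P1 \<in> P_up" "GP P = GP P1" "cstar_algebra A"
  shows "cs_radical P A = cs_radical P1 A"
proof -
  have "{J \<in> ideals A. ll_tri P A {\<zero>\<^bsub>A\<^esub>} J} = {J \<in> ideals A. ll_tri P1 A {\<zero>\<^bsub>A\<^esub>} J}"
    using ll_tri_iff_GP[OF assms(1,4)] ll_tri_iff_GP[OF assms(2,4)] assms(3) by blast
  then show ?thesis by (simp only: cs_radical_def)
qed

theorem proposition4p10:
  shows "(\<forall>P \<in> (P_up :: 'a cstar set set).
            GP P \<in> P_up \<and> P \<subseteq> GP P \<and> GP P = GP (GP P)) \<and>
         (\<forall>P \<in> (P_up :: 'a cstar set set). \<forall>P1 \<in> P_up. P \<subseteq> P1 \<longrightarrow>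
            GP P \<subseteq> GP P1 \<and>
            (\<forall>A. cstar_algebra A \<longrightarrow>
              cs_radical P A \<in> ideals A \<and> cs_radical P1 A \<in> ideals A \<and> cs_radical P A \<subseteq> cs_radical P1 A)) \<and>
         (\<forall>P \<in> (P_up :: 'a cstar set set). \<forall>P1 \<in> P_up. P \<subseteq> P1 \<and> P1 \<subseteq> GP P \<longrightarrow>
            GP P = GP P1 \<and>
            (\<forall>A. cstar_algebra A \<longrightarrow> cs_radical P A = cs_radical P1 A))"
proof (intro conjI ballI impI allI)
  fix P :: "'a cstar set" assume P: "P \<in> P_up"
  show "GP P \<in> P_up" by (rule GP_in_P_up[OF P])
  show "P \<subseteq> GP P" by (rule subset_GP[OF P])
  show "GP P = GP (GP P)" by (rule GP_idem[OF P, symmetric])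
next
  fix P P1 :: "'a cstar set" assume "P \<subseteq> P1"
  then show "GP P \<subseteq> GP P1" by (rule GP_mono)
next
  fix P P1 :: "'a cstar set" and A :: "'a cstar"
  assume "P \<subseteq> P1" "cstar_algebra A"
  then show "cs_radical P A \<in> ideals A" "cs_radical P1 A \<in> ideals A"
    "cs_radical P A \<subseteq> cs_radical P1 A"
    by (simp_all add: cs_radical_ideal cs_radical_mono)
next
  fix P P1 :: "'a cstar set"
  assume P: "P \<in> P_up" "P1 \<in> P_up" and between: "P \<subseteq> P1 \<and> P1 \<subseteq> GP P"
  show eq: "GP P = GP P1" using between by (intro GP_eq_between[OF P(1)]) auto
  show "cs_radical P A = cs_radical P1 A" if "cstar_algebra A" for A
    by (rule cs_radical_eq[OF P eq that])
qed

end
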